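(* Let $u\in\mathcal{A}$ be a strong local minimizer of $E$ in $\mathcal{A}$, i.e. there is $\gamma>0$ such that $E(v)\ge E(u)$ for all $v\in\mathcal{A}$ with $\|v-u\|_{\infty;\Omega}<\gamma$. Suppose further that $F(u,B(z,\delta),r')=0$ for some ball $B(z,\delta)$ compactly contained in $\Omega$ and some $r'$ with $0<r'<\operatorname{dist}(B(z,\delta),\partial\Omega)$. Then $u$ is Hölder continuous on any compact subset of $B(z,\delta)$.
   Context: $\Omega\subset\mathbb{R}^2$ is a bounded domain with Lipschitz boundary. $u_0:\overline\Omega\to\mathbb{R}^2$ is a homeomorphism onto its image, and $$\mathcal{A}_1=\{u\in W^{1,2}(\Omega,\mathbb{R}^2):\ \det\nabla u>0\ \text{a.e. in }\Omega,\ u|_{\partial\Omega}=u_0|_{\partial\Omega}\}$$ (boundary values in the sense of trace) is assumed nonempty. Every $u\in\mathcal{A}_1$ has a continuous representative in $\Omega$, with which it is identified. Energy: fix $\lambda>0$ and let $E(u)=\int_\Omega \lambda|\nabla u|^2+h(\det\nabla u)\,dx$, where $h:\mathbb{R}\to[0,+\infty]$ is given by $h(s)=+\infty$ for $s\le 0$, $h(s)=|\ln s|$ for $s\in(0,c_1)$, $h(s)=\theta(s)$ for $s\in[c_1,c_2]$, $h(s)=ls+m$ for $s>c_2$. Here $l,m>0$ and $0<c_1<1<c_2<+\infty$ are constants, and $\theta>0$ is of class $C^2$ on $(c_1,c_2)$ with $\ddot\theta>0$, $C^1$ up to the endpoints, $\theta(c_1)=|\ln c_1|$, $\theta(c_2)=lc_2+m$,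 $\dot\theta(c_1)=-1/c_1$, $\dot\theta(c_2)=l$, $\dot\theta(1)=0$, $\theta(1)>0$. (Thus $h$ is $C^1$ and convex on $(0,\infty)$ with its minimum at $1$.) Set $\mathcal{A}=\{u\in\mathcal{A}_1: E(u)<+\infty\}$. Twist: for $x_0\in\Omega$ and a.e. $x\in\Omega$, $$t(x,x_0,u)=\operatorname{adj}\nabla u(x)\,(u(x)-u(x_0))\cdot\frac{x-x_0}{|x-x_0|},$$ where $\operatorname{adj}$ is the adjugate matrix (transpose of the cofactor matrix). Functional $F$: let $g(s)=-s$ for $s\le0$ and $g(s)=0$ for $s\ge0$. For $\Omega'$ compactly contained in $\Omega$ and $r'\in(0,\operatorname{dist}(\Omega',\partial\Omega))$, $$F(u,\Omega',r')=\int_{\Omega'}\int_{B(x_0,r')}g(t(x,x_0,u))\,dx\,dx_0 .$$ *)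

theory Defs
  imports "HOL-Analysis.Analysis" "HOL-Probability.Essential_Supremum"
begin

section \<open>Lipschitz domains\<close>

definition compactly_contained :: "'a::metric_space set \<Rightarrow> 'a set \<Rightarrow> bool" where
  "compactly_contained A \<Omega> \<longleftrightarrow> compact (closure A) \<and> closure A \<subseteq> \<Omega>"

text \<open>Near every boundary point, in suitable orthonormal coordinates given by \<open>Q\<close>, the set lies
  strictly above the graph of a Lipschitz function \<open>\<gamma>\<close>.\<close>

definition lipschitz_boundary :: "(real^2) set \<Rightarrow> bool" where
  "lipschitz_boundary \<Omega> \<longleftrightarrow>
     (\<forall>p\<in>frontier \<Omega>. \<exists>r>0. \<exists>Q :: real^2 \<Rightarrow> real^2. \<exists>\<gamma> :: real \<Rightarrow> real. \<exists>L.
        orthogonal_transformation Q \<and> L-lipschitz_on UNIV \<gamma> \<and>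
        \<Omega> \<inter> ball p r = {x \<in> ball p r. \<gamma> (Q x $ 1) < Q x $ 2})"

definition lipschitz_domain :: "(real^2) set \<Rightarrow> bool" where
  "lipschitz_domain \<Omega> \<longleftrightarrow>
     open \<Omega> \<and> connected \<Omega> \<and> \<Omega> \<noteq> {} \<and> bounded \<Omega> \<and> lipschitz_boundary \<Omega>"

section \<open>The Sobolev space of maps with square-integrable weak gradient\<close>

primrec C_k :: "nat \<Rightarrow> (real^2 \<Rightarrow> real) \<Rightarrow> bool" where
  "C_k 0 f \<longleftrightarrow> continuous_on UNIV f"
| "C_k (Suc k) f \<longleftrightarrow>
     (\<exists>D :: real^2 \<Rightarrow> real^2. (\<forall>x. (f has_derivative (\<lambda>h. D x \<bullet> h)) (at x)) \<and>
        (\<forall>i. C_k k (\<lambda>x. D x $ i)))"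

definition test_function :: "(real^2) set \<Rightarrow> (real^2 \<Rightarrow> real) \<Rightarrow> bool" where
  "test_function \<Omega> \<phi> \<longleftrightarrow> (\<forall>k. C_k k \<phi>) \<and> compactly_contained {x. \<phi> x \<noteq> 0} \<Omega>"

definition partial_deriv :: "2 \<Rightarrow> (real^2 \<Rightarrow> real) \<Rightarrow> real^2 \<Rightarrow> real" where
  "partial_deriv j \<phi> x = frechet_derivative \<phi> (at x) (axis j 1)"

definition L2_on :: "(real^2) set \<Rightarrow> (real^2 \<Rightarrow> 'b::euclidean_space) \<Rightarrow> bool" where
  "L2_on \<Omega> f \<longleftrightarrow> f \<in> borel_measurable (lebesgue_on \<Omega>) \<and>
     integrable (lebesgue_on \<Omega>) (\<lambda>x. (norm (f x))\<^sup>2)"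

text \<open>The entry in row \<open>i\<close> and column \<open>j\<close> is the weak derivative of \<open>u\<^sub>i\<close> in direction \<open>j\<close>.\<close>

definition weak_gradient :: "(real^2) set \<Rightarrow> (real^2 \<Rightarrow> real^2) \<Rightarrow> (real^2 \<Rightarrow> real^2^2) \<Rightarrow> bool" where
  "weak_gradient \<Omega> u G \<longleftrightarrow> L2_on \<Omega> G \<and>
     (\<forall>\<phi> i j. test_function \<Omega> \<phi> \<longrightarrow>
        integral\<^sup>L (lebesgue_on \<Omega>) (\<lambda>x. u x $ i * partial_deriv j \<phi> x)
          = - integral\<^sup>L (lebesgue_on \<Omega>) (\<lambda>x. G x $ i $ j * \<phi> x))"

definition W12 :: "(real^2) set \<Rightarrow> (real^2 \<Rightarrow> real^2) set" where
  "W12 \<Omega> = {u. L2_on \<Omega> u \<and> (\<exists>G. weak_gradient \<Omega> u G)}"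

text \<open>Weak gradients are unique up to null sets, so every use below is independent of the choice.\<close>

definition grad :: "(real^2) set \<Rightarrow> (real^2 \<Rightarrow> real^2) \<Rightarrow> real^2 \<Rightarrow> real^2^2" where
  "grad \<Omega> u = (SOME G. weak_gradient \<Omega> u G)"

section \<open>Boundary values in the sense of trace\<close>

definition hausdorff1_delta :: "real \<Rightarrow> 'a::metric_space set \<Rightarrow> ennreal" where
  "hausdorff1_delta \<delta> A =
     (INF C \<in> {C :: nat \<Rightarrow> 'a set. A \<subseteq> (\<Union>i. C i) \<and> (\<forall>i. bounded (C i) \<and> diameter (C i) \<le> \<delta>)}.
        \<Sum>i. ennreal (diameter (C i)))"

text \<open>One-dimensional Hausdorff measure. The Hausdorff outer measure is a metric outer measure, hence
  countably additive on Borel sets, so \<^const>\<open>measure_of\<close> does not fall back to the zero measure.\<close>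

definition hausdorff1 :: "'a::metric_space measure" where
  "hausdorff1 = measure_of UNIV (sets borel) (\<lambda>A. SUP \<delta>\<in>{0<..}. hausdorff1_delta \<delta> A)"

text \<open>The trace operator on a Lipschitz domain is the continuous extension, from \<open>W\<^sup>1\<^sup>,\<^sup>2\<close> to \<open>L\<^sup>2\<close> of the
  boundary, of the restriction map on Sobolev maps that are continuous up to the boundary. Its graph
  is therefore described by approximating sequences.\<close>

definition has_trace :: "(real^2) set \<Rightarrow> (real^2 \<Rightarrow> real^2) \<Rightarrow> (real^2 \<Rightarrow> real^2) \<Rightarrow> bool" where
  "has_trace \<Omega> u w \<longleftrightarrow>
     (\<exists>\<phi> :: nat \<Rightarrow> real^2 \<Rightarrow> real^2.
        (\<forall>n. \<phi> n \<in> W12 \<Omega> \<and> continuous_on (closure \<Omega>) (\<phi> n)) \<and>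
        (\<lambda>n. \<integral>\<^sup>+x. ennreal ((norm (\<phi> n x - u x))\<^sup>2) \<partial>lebesgue_on \<Omega>) \<longlonglongrightarrow> 0 \<and>
        (\<lambda>n. \<integral>\<^sup>+x. ennreal ((norm (grad \<Omega> (\<phi> n) x - grad \<Omega> u x))\<^sup>2) \<partial>lebesgue_on \<Omega>) \<longlonglongrightarrow> 0 \<and>
        (\<lambda>n. \<integral>\<^sup>+x\<in>frontier \<Omega>. ennreal ((norm (\<phi> n x - w x))\<^sup>2) \<partial>hausdorff1) \<longlonglongrightarrow> 0)"

section \<open>Admissible maps and energy\<close>

text \<open>Maps are not required to be continuous here: the class is closed under modification on null
  sets, and where the continuous representative matters it has to be selected explicitly.\<close>

definition admissible1 :: "(real^2) set \<Rightarrow> (real^2 \<Rightarrow> real^2) \<Rightarrow> (real^2 \<Rightarrow> real^2) set" where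
  "admissible1 \<Omega> u0 =
     {u \<in> W12 \<Omega>. (AE x in lebesgue_on \<Omega>. det (grad \<Omega> u x) > 0) \<and> has_trace \<Omega> u u0}"

definition theta_conditions ::
    "real \<Rightarrow> real \<Rightarrow> real \<Rightarrow> real \<Rightarrow> (real \<Rightarrow> real) \<Rightarrow> bool" where
  "theta_conditions l m c1 c2 \<theta> \<longleftrightarrow>
     (\<forall>s\<in>{c1..c2}. \<theta> s > 0) \<and>
     (\<exists>\<theta>' \<theta>''.
        (\<forall>s\<in>{c1..c2}. (\<theta> has_real_derivative \<theta>' s) (at s within {c1..c2})) \<and>
        continuous_on {c1..c2} \<theta>' \<and>
        (\<forall>s\<in>{c1<..<c2}. (\<theta>' has_real_derivative \<theta>'' s) (at s)) \<and>
        continuous_on {c1<..<c2} \<theta>'' \<and>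
        (\<forall>s\<in>{c1<..<c2}. \<theta>'' s > 0) \<and>
        \<theta>' c1 = - 1 / c1 \<and> \<theta>' c2 = l \<and> \<theta>' 1 = 0) \<and>
     \<theta> c1 = \<bar>ln c1\<bar> \<and> \<theta> c2 = l * c2 + m \<and> \<theta> 1 > 0"

definition h_fun :: "real \<Rightarrow> real \<Rightarrow> real \<Rightarrow> real \<Rightarrow> (real \<Rightarrow> real) \<Rightarrow> real \<Rightarrow> ennreal" where
  "h_fun l m c1 c2 \<theta> s =
     (if s \<le> 0 then \<infinity>
      else if s < c1 then ennreal \<bar>ln s\<bar>
      else if s \<le> c2 then ennreal (\<theta> s)
      else ennreal (l * s + m))"

text \<open>The norm on \<^typ>\<open>real^2^2\<close> is the Frobenius norm.\<close>

definition energy ::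
    "real \<Rightarrow> (real \<Rightarrow> ennreal) \<Rightarrow> (real^2) set \<Rightarrow> (real^2 \<Rightarrow> real^2) \<Rightarrow> ennreal" where
  "energy lam h \<Omega> u =
     (\<integral>\<^sup>+x. (ennreal (lam * (norm (grad \<Omega> u x))\<^sup>2) + h (det (grad \<Omega> u x))) \<partial>lebesgue_on \<Omega>)"

definition admissible ::
    "real \<Rightarrow> (real \<Rightarrow> ennreal) \<Rightarrow> (real^2) set \<Rightarrow> (real^2 \<Rightarrow> real^2) \<Rightarrow> (real^2 \<Rightarrow> real^2) set" where
  "admissible lam h \<Omega> u0 = {u \<in> admissible1 \<Omega> u0. energy lam h \<Omega> u < \<infinity>}"

definition sup_norm_on :: "(real^2) set \<Rightarrow> (real^2 \<Rightarrow> real^2) \<Rightarrow> ereal" where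
  "sup_norm_on \<Omega> f = esssup (lebesgue_on \<Omega>) (\<lambda>x. ereal (norm (f x)))"

definition strong_local_minimizer ::
    "real \<Rightarrow> (real \<Rightarrow> ennreal) \<Rightarrow> (real^2) set \<Rightarrow> (real^2 \<Rightarrow> real^2) \<Rightarrow> (real^2 \<Rightarrow> real^2) \<Rightarrow> bool" where
  "strong_local_minimizer lam h \<Omega> u0 u \<longleftrightarrow>
     u \<in> admissible lam h \<Omega> u0 \<and>
     (\<exists>\<gamma>>0. \<forall>v\<in>admissible lam h \<Omega> u0.
        sup_norm_on \<Omega> (\<lambda>x. v x - u x) < ereal \<gamma> \<longrightarrow> energy lam h \<Omega> v \<ge> energy lam h \<Omega> u)"

section \<open>Twist\<close>

definition cof2 :: "real^2^2 \<Rightarrow> real^2^2" where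
  "cof2 A = vector [vector [A $ 2 $ 2, - (A $ 2 $ 1)], vector [- (A $ 1 $ 2), A $ 1 $ 1]]"

definition adj2 :: "real^2^2 \<Rightarrow> real^2^2" where
  "adj2 A = transpose (cof2 A)"

lemma matrix_mul_adj2: "A ** adj2 A = mat (det A)"
  by (simp add: adj2_def cof2_def vec_eq_iff matrix_matrix_mult_def transpose_def mat_def det_2
      forall_2 sum_2 algebra_simps)

definition twist ::
    "(real^2) set \<Rightarrow> (real^2 \<Rightarrow> real^2) \<Rightarrow> real^2 \<Rightarrow> real^2 \<Rightarrow> real" where
  "twist \<Omega> u x x0 =
     (adj2 (grad \<Omega> u x) *v (u x - u x0)) \<bullet> ((x - x0) /\<^sub>R norm (x - x0))"

definition g_fun :: "real \<Rightarrow> real" where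
  "g_fun s = (if s \<le> 0 then - s else 0)"

definition F_functional ::
    "(real^2) set \<Rightarrow> (real^2 \<Rightarrow> real^2) \<Rightarrow> (real^2) set \<Rightarrow> real \<Rightarrow> ennreal" where
  "F_functional \<Omega> u \<Omega>' r' =
     (\<integral>\<^sup>+x0. (\<integral>\<^sup>+x. ennreal (g_fun (twist \<Omega> u x x0)) \<partial>lebesgue_on (ball x0 r')) \<partial>lebesgue_on \<Omega>')"

section \<open>Hoelder continuity\<close>

definition hoelder_on :: "'a::metric_space set \<Rightarrow> ('a \<Rightarrow> 'b::metric_space) \<Rightarrow> bool" where
  "hoelder_on K f \<longleftrightarrow>
     (\<exists>\<alpha> C. 0 < \<alpha> \<and> \<alpha> \<le> 1 \<and> (\<forall>x\<in>K. \<forall>y\<in>K. dist (f x) (f y) \<le> C * dist x y powr \<alpha>))"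

end

theory Submission
  imports Defs "HOL-Computational_Algebra.Polynomial"
begin

text \<open>
  Let \<open>\<zeta>\<close> be a radially decreasing cutoff centred at \<open>p\<close> and \<open>v = u - \<epsilon> \<zeta> (u - u p)\<close>. The
  determinant of the gradient of \<open>v\<close> is \<open>(1 - \<epsilon> \<zeta>)\<^sup>2 det \<nabla>u\<close> plus a nonnegative multiple of the twist
  about \<open>p\<close>, so positive twist makes \<open>v\<close> an admissible competitor although \<open>h\<close> is infinite on
  nonpositive numbers. Since \<open>h\<close> decreases at most logarithmically and has slope at most \<open>l\<close>,
  minimality gives, after division by \<open>\<epsilon>\<close>, a Caccioppoli inequality whose right-hand side contains
  \<open>u - u p\<close> only on an annulus. Both components of \<open>u\<close> obey the maximum and minimum principle because
  \<open>det \<nabla>u > 0\<close>, and choosing good horizontal and vertical lines in a square annulus (Courant and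
  Lebesgue) bounds the oscillation of \<open>u\<close> inside by the Dirichlet energy of the annulus. Inserting this
  into the Caccioppoli inequality and filling the hole yields a power-type decay of the Dirichlet
  energy, and the oscillation bound turns that decay into Hoelder continuity. The hypothesis on
  \<open>F\<close> supplies the twist condition at every centre, not just at almost every one, since the inner
  integral of \<open>F\<close> is lower semicontinuous in \<open>x\<^sub>0\<close>.
\<close>

subsection \<open>Smooth functions and cutoffs\<close>

text \<open>There is no Euler-Lagrange equation to start from: \<open>h\<close> is singular at zero
  and the determinant has no positive lower bound, so a general variation may leave the admissible
  class however small it is. The variation used here is a scaling plus a perturbation of rank one,
  whose effect on a 2 by 2 determinant is linear; energies are compared at positive
  \<open>\<epsilon>\<close> and nothing is differentiated. The decay closes because of dimension
  two: the slope of the cutoff has size \<open>1 / \<rho>\<close>, the relevant area is of order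
  \<open>\<rho>^2\<close>, and the squared oscillation is of the order of an energy, so no power of
  the radius is lost. The maximum principle has no equation to appeal to either. It rests on the
  Jacobian being a null Lagrangian, proved for mollified functions and carried to the limit,
  uniformly for values and in mean square for gradients. Axis-parallel lines are selected rather
  than circles so that integration in Cartesian coordinates suffices; the square annulus then has to
  be enclosed in discs, which fixes the ratio 6 between successive radii.\<close>

definition exp_bump :: "real poly \<Rightarrow> real \<Rightarrow> real" where
  "exp_bump p t = (if t > 0 then poly p (1 / t) * exp (- 1 / t) else 0)"

lemma poly_times_exp_minus_tendsto_0: "((\<lambda>x. poly p x * exp (- x)) \<longlongrightarrow> (0::real)) at_top"
proof -
  have "((\<lambda>x. \<Sum>i\<le>degree p. coeff p i * (x ^ i / exp x)) \<longlongrightarrow> (\<Sum>i\<le>degree p. coeff p i * 0)) at_top"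
    by (intro tendsto_sum tendsto_mult tendsto_const tendsto_power_div_exp_0)
  then show ?thesis
    by (simp add: poly_altdef sum_distrib_right exp_minus divide_inverse mult.assoc)
qed

lemma exp_bump_tendsto_0: "(exp_bump p \<longlongrightarrow> 0) (at_right 0)"
proof -
  have "((\<lambda>x. poly p (inverse x) * exp (- inverse x)) \<longlongrightarrow> (0::real)) (at_right 0)"
    using filterlim_compose[OF poly_times_exp_minus_tendsto_0 filterlim_inverse_at_top_right]
    by simp
  then show ?thesis
    by (rule Lim_transform_eventually)
      (simp add: exp_bump_def eventually_at_filter divide_inverse)
qed

text \<open>Differentiating \<open>p(1/t) * exp(-1/t)\<close> and writing \<open>X = 1/t\<close>,
  whose derivative is \<open>- X^2\<close>, gives the polynomial \<open>X^2 * (p - p')\<close>. So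
  the family \<open>exp_bump\<close> is closed under differentiation, and smoothness of every order
  is a single induction.\<close>

definition bump_deriv :: "real poly \<Rightarrow> real poly" where
  "bump_deriv p = [:0, 0, 1:] * (p - pderiv p)"

lemma exp_bump_DERIV [derivative_intros]:
  "(exp_bump p has_real_derivative exp_bump (bump_deriv p) t) (at t)"
proof -
  consider "t > 0" | "t < 0" | "t = 0" by linarith
  then show ?thesis
  proof cases
    case 1
    have "((\<lambda>t. poly p (1 / t) * exp (- 1 / t)) has_real_derivative
        poly p (1/t) * (exp (-1/t) * (1 / t^2)) + poly (pderiv p) (1/t) * (- 1 / t^2) * exp (-1/t)) (at t)"
      using 1 by (auto intro!: derivative_eq_intros DERIV_chain2[OF poly_DERIV] simp: power2_eq_square)
    also have "poly p (1/t) * (exp (-1/t) * (1 / t^2)) + poly (pderiv p) (1/t) * (- 1 / t^2) * exp (-1/t)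
        = exp_bump (bump_deriv p) t"
      using 1 by (simp add: exp_bump_def bump_deriv_def field_simps power2_eq_square)
    finally have *: "((\<lambda>t. poly p (1 / t) * exp (- 1 / t)) has_real_derivative exp_bump (bump_deriv p) t) (at t)" .
    show ?thesis
      by (rule has_field_derivative_transform_within_open[OF *, where S = "{0<..}"])
        (use 1 in \<open>auto simp: exp_bump_def\<close>)
  next
    case 2
    then have e: "exp_bump (bump_deriv p) t = 0" by (simp add: exp_bump_def)
    show ?thesis unfolding e
      by (rule has_field_derivative_transform_within_open[OF DERIV_const[of "0::real"], where S = "{..<0}"])
        (use 2 in \<open>auto simp: exp_bump_def\<close>)
  next
    case 3
    \<comment> \<open>Dividing by \<open>h\<close> multiplies the polynomial by \<open>X\<close>, so
      the difference quotient is again a member of the family and tends to zero.\<close>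
    have "((\<lambda>h. exp_bump p h / h) \<longlongrightarrow> 0) (at_right 0)"
      by (rule Lim_transform_eventually[OF exp_bump_tendsto_0[of "[:0,1:] * p"]])
        (simp add: exp_bump_def eventually_at_filter)
    moreover have "((\<lambda>h. exp_bump p h / h) \<longlongrightarrow> 0) (at_left 0)"
      by (rule Lim_transform_eventually[OF tendsto_const])
        (simp add: exp_bump_def eventually_at_filter)
    ultimately have "((\<lambda>h. exp_bump p h / h) \<longlongrightarrow> 0) (at 0)"
      using filterlim_split_at by blast
    then show ?thesis
      using 3 by (simp add: has_field_derivative_iff exp_bump_def)
  qed
qed

lemma exp_bump_zero: "t \<le> 0 \<Longrightarrow> exp_bump p t = 0"
  by (simp add: exp_bump_def)

abbreviation bump :: "real \<Rightarrow> real" where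
  "bump \<equiv> exp_bump 1"

lemma bump_nonneg: "bump t \<ge> 0" and bump_pos: "t > 0 \<Longrightarrow> bump t > 0"
  and bump_le_1: "bump t \<le> 1"
  by (auto simp: exp_bump_def)

lemma bump_mono: "s \<le> t \<Longrightarrow> bump s \<le> bump t"
  by (auto simp: exp_bump_def frac_le)

text \<open>The polynomial is \<open>X^2\<close> here. This is the monotonicity of
  \<open>bump\<close> in the derivative form that later decides the sign of the radial
  slope.\<close>

lemma exp_bump_bump_deriv_1_nonneg: "exp_bump (bump_deriv 1) t \<ge> 0"
  by (simp add: exp_bump_def bump_deriv_def)

lemma continuous_on_exp_bump [continuous_intros]:
  "continuous_on S f \<Longrightarrow> continuous_on S (\<lambda>x. exp_bump p (f x))"
  by (rule continuous_on_compose2[of UNIV "exp_bump p"])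
    (auto intro!: continuous_at_imp_continuous_on DERIV_isCont exp_bump_DERIV)

section \<open>Calculus of the classes \<open>C_k\<close>\<close>

lemma C_k_Suc_imp: "C_k (Suc k) f \<Longrightarrow> C_k k f"
proof (induction k arbitrary: f)
  case 0
  then obtain D :: "real^2 \<Rightarrow> real^2" where "\<And>x. (f has_derivative (\<lambda>h. D x \<bullet> h)) (at x)" by auto
  then have "isCont f x" for x by (rule has_derivative_continuous)
  then show ?case by (simp add: continuous_at_imp_continuous_on)
next
  case (Suc k)
  then obtain D where "\<forall>x. (f has_derivative (\<lambda>h. D x \<bullet> h)) (at x)" "\<forall>i. C_k (Suc k) (\<lambda>x. D x $ i)"
    by auto
  then show ?case using Suc.IH by auto
qed

lemma C_k_const: "C_k k (\<lambda>x. c)"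
proof (induction k arbitrary: c)
  case (Suc k)
  then show ?case by (auto intro!: exI[of _ "\<lambda>x. 0"])
qed auto

lemma C_k_add: "C_k k f \<Longrightarrow> C_k k g \<Longrightarrow> C_k k (\<lambda>x. f x + g x)"
proof (induction k arbitrary: f g)
  case (Suc k)
  from Suc.prems obtain D D' where
    "\<forall>x. (f has_derivative (\<lambda>h. D x \<bullet> h)) (at x)" "\<forall>i. C_k k (\<lambda>x. D x $ i)"
    "\<forall>x. (g has_derivative (\<lambda>h. D' x \<bullet> h)) (at x)" "\<forall>i. C_k k (\<lambda>x. D' x $ i)" by auto
  then show ?case
    by (auto intro!: exI[of _ "\<lambda>x. D x + D' x"] derivative_eq_intros Suc.IH simp: inner_add_left)
qed (auto intro!: continuous_intros)

lemma C_k_mult: "C_k k f \<Longrightarrow> C_k k g \<Longrightarrow> C_k k (\<lambda>x. f x * g x)"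
proof (induction k arbitrary: f g)
  case (Suc k)
  from Suc.prems obtain D D' where D:
    "\<forall>x. (f has_derivative (\<lambda>h. D x \<bullet> h)) (at x)" "\<forall>i. C_k k (\<lambda>x. D x $ i)"
    "\<forall>x. (g has_derivative (\<lambda>h. D' x \<bullet> h)) (at x)" "\<forall>i. C_k k (\<lambda>x. D' x $ i)" by auto
  have "C_k k f" "C_k k g" using Suc.prems C_k_Suc_imp by blast+
  with D show ?case
    by (auto intro!: exI[of _ "\<lambda>x. f x *\<^sub>R D' x + g x *\<^sub>R D x"] derivative_eq_intros Suc.IH C_k_add
        simp: inner_add_left)
qed (auto intro!: continuous_intros)

lemma C_k_minus: "C_k k f \<Longrightarrow> C_k k g \<Longrightarrow> C_k k (\<lambda>x. f x - g x)"
  using C_k_add[OF _ C_k_mult[OF C_k_const[of k "-1"]], of f g] by simp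

lemma C_k_component: "C_k k (\<lambda>x. x $ i)"
proof (cases k)
  case (Suc n)
  have "((\<lambda>x. x $ i) has_derivative (\<lambda>h. axis i 1 \<bullet> h)) (at x)" for x :: "real^2"
    by (simp add: inner_axis' bounded_linear_imp_has_derivative bounded_linear_vec_nth)
  then show ?thesis unfolding Suc
    by (auto intro!: exI[of _ "\<lambda>x. axis i 1"] C_k_const)
qed (auto intro!: continuous_intros)

text \<open>The induction runs over all polynomials at once, because the derivative replaces
  \<open>p\<close> by \<open>bump_deriv p\<close>.\<close>

lemma C_k_exp_bump: "C_k k f \<Longrightarrow> C_k k (\<lambda>x. exp_bump p (f x))"
proof (induction k arbitrary: f p)
  case (Suc k)
  from Suc.prems obtain D where D:
    "\<forall>x. (f has_derivative (\<lambda>h. D x \<bullet> h)) (at x)" "\<forall>i. C_k k (\<lambda>x. D x $ i)" by auto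
  have "C_k k f" using Suc.prems C_k_Suc_imp by blast
  moreover have "((\<lambda>x. exp_bump p (f x)) has_derivative
      (\<lambda>h. (exp_bump (bump_deriv p) (f x) *\<^sub>R D x) \<bullet> h)) (at x)" for x
    using has_derivative_compose[OF D(1)[rule_format, of x]
        exp_bump_DERIV[of p "f x", THEN has_field_derivative_imp_has_derivative]]
    by (simp add: mult.commute)
  ultimately show ?case using D
    by (auto intro!: exI[of _ "\<lambda>x. exp_bump (bump_deriv p) (f x) *\<^sub>R D x"] Suc.IH C_k_mult)
qed (auto intro!: continuous_intros)

lemma partial_deriv_eq:
  assumes "(f has_derivative (\<lambda>h. D \<bullet> h)) (at x)"
  shows "partial_deriv j f x = D $ j"
  using frechet_derivative_at[OF assms, symmetric]
  by (simp add: partial_deriv_def inner_axis)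

lemma smooth_has_derivative:
  assumes "\<And>k. C_k k f"
  shows "(f has_derivative (\<lambda>h. (\<chi> j. partial_deriv j f x) \<bullet> h)) (at x)"
proof -
  obtain D where D: "(f has_derivative (\<lambda>h. D x \<bullet> h)) (at x)"
    using assms[of "Suc 0"] by auto
  have "(\<chi> j. partial_deriv j f x) = D x"
    using partial_deriv_eq[OF D] by (simp add: vec_eq_iff)
  with D show ?thesis by simp
qed

lemma smooth_continuous:
  assumes "\<And>k. C_k k f"
  shows "continuous_on S f" "continuous_on S (partial_deriv j f)"
proof -
  show "continuous_on S f" using assms[of 0] continuous_on_subset by fastforce
  obtain D where D: "\<And>x. (f has_derivative (\<lambda>h. D x \<bullet> h)) (at x)" "\<And>i. continuous_on UNIV (\<lambda>x. D x $ i)"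
    using assms[of "Suc 0"] by auto
  have "partial_deriv j f = (\<lambda>x. D x $ j)" using partial_deriv_eq[OF D(1)] by auto
  with D(2) show "continuous_on S (partial_deriv j f)" using continuous_on_subset by force
qed

lemma partial_deriv_mult:
  assumes "\<And>k. C_k k f" "\<And>k. C_k k g"
  shows "partial_deriv j (\<lambda>x. f x * g x) x = f x * partial_deriv j g x + partial_deriv j f x * g x"
proof -
  let ?F = "\<chi> j. partial_deriv j f x" and ?G = "\<chi> j. partial_deriv j g x"
  have "((\<lambda>x. f x * g x) has_derivative (\<lambda>h. f x * (?G \<bullet> h) + (?F \<bullet> h) * g x)) (at x)"
    by (intro derivative_intros smooth_has_derivative assms)
  then have "((\<lambda>x. f x * g x) has_derivative (\<lambda>h. (f x *\<^sub>R ?G + g x *\<^sub>R ?F) \<bullet> h)) (at x)"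
    by (simp add: inner_add_left mult.commute)
  from partial_deriv_eq[OF this] show ?thesis by (simp add: mult.commute)
qed

section \<open>Test functions\<close>

lemma test_functionD:
  assumes "test_function \<Omega> \<phi>"
  obtains K where "compact K" "K \<subseteq> \<Omega>" "\<And>x. x \<notin> K \<Longrightarrow> \<phi> x = 0" "\<And>x j. x \<notin> K \<Longrightarrow> partial_deriv j \<phi> x = 0"
    "\<And>k. C_k k \<phi>"
proof
  let ?K = "closure {x. \<phi> x \<noteq> 0}"
  show "compact ?K" "?K \<subseteq> \<Omega>" and s: "\<And>k. C_k k \<phi>"
    using assms by (auto simp: test_function_def compactly_contained_def)
  show *: "\<phi> x = 0" if "x \<notin> ?K" for x
    using that closure_subset[of "{x. \<phi> x \<noteq> 0}"] by auto
  show "partial_deriv j \<phi> x = 0" if "x \<notin> ?K" for x j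
  proof -
    have "open (- ?K)" by (intro open_Compl closed_closure)
    moreover have "x \<in> - ?K" using that by (rule Compl_iff[THEN iffD2])
    moreover have "0 = \<phi> h" if "h \<in> - ?K" for h using *[of h] that by (metis ComplD)
    ultimately have "(\<phi> has_derivative (\<lambda>h. 0)) (at x)"
      by (rule has_derivative_transform_within_open[OF has_derivative_const[where c = "0::real"]])
    then have "(\<phi> has_derivative (\<lambda>h. 0 \<bullet> h)) (at x)" by simp
    from partial_deriv_eq[OF this] show ?thesis by simp
  qed
qed

lemma test_functionI:
  assumes "\<And>k. C_k k \<phi>" "compact K" "K \<subseteq> \<Omega>" "\<And>x. x \<notin> K \<Longrightarrow> \<phi> x = 0"
  shows "test_function \<Omega> \<phi>"
proof -
  have "closure {x. \<phi> x \<noteq> 0} \<subseteq> K"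
    using assms(2,4) by (intro closure_minimal) (auto simp: compact_imp_closed)
  then show ?thesis using assms
    by (auto simp: test_function_def compactly_contained_def compact_eq_bounded_closed intro: bounded_subset)
qed

lemma test_function_mult:
  assumes "test_function \<Omega> \<phi>" "\<And>k. C_k k c"
  shows "test_function \<Omega> (\<lambda>x. \<phi> x * c x)"
proof -
  obtain K where "compact K" "K \<subseteq> \<Omega>" "\<And>x. x \<notin> K \<Longrightarrow> \<phi> x = 0" "\<And>k. C_k k \<phi>"
    using test_functionD[OF assms(1)] by metis
  then show ?thesis by (intro test_functionI[of _ K] C_k_mult assms) auto
qed

lemma continuous_vanishing_bounded:
  fixes f :: "'a::t2_space \<Rightarrow> real"
  assumes "continuous_on UNIV f" "compact K" "\<And>x. x \<notin> K \<Longrightarrow> f x = 0"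
  obtains M where "M > 0" "\<And>x. \<bar>f x\<bar> \<le> M"
proof -
  have "bounded (f ` K)" using assms compact_continuous_image continuous_on_subset compact_imp_bounded by blast
  then obtain M where "M > 0" "\<forall>x\<in>K. \<bar>f x\<bar> \<le> M" by (auto simp: bounded_pos)
  then have "\<bar>f x\<bar> \<le> M" for x using assms(3)[of x] by (cases "x \<in> K") auto
  with \<open>M > 0\<close> show ?thesis by (rule that)
qed

lemma test_function_bounded:
  assumes "test_function \<Omega> \<phi>"
  obtains M where "M > 0" "\<And>x. \<bar>\<phi> x\<bar> \<le> M" "\<And>x. \<bar>partial_deriv j \<phi> x\<bar> \<le> M"
proof -
  obtain K where K: "compact K" "\<And>x. x \<notin> K \<Longrightarrow> \<phi> x = 0" "\<And>x j. x \<notin> K \<Longrightarrow> partial_deriv j \<phi> x = 0"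
    "\<And>k. C_k k \<phi>" using test_functionD[OF assms] by metis
  obtain M where M: "M > 0" "\<And>x. \<bar>\<phi> x\<bar> \<le> M"
    using continuous_vanishing_bounded[of \<phi> K] K smooth_continuous by metis
  obtain M' where M': "M' > 0" "\<And>x. \<bar>partial_deriv j \<phi> x\<bar> \<le> M'"
    using continuous_vanishing_bounded[of "partial_deriv j \<phi>" K] K smooth_continuous by metis
  show ?thesis using M M' by (intro that[of "max M M'"]) (auto simp: le_max_iff_disj)
qed

text \<open>The profile equals \<open>bump (bump 1)\<close> on the ball of radius \<open>\<rho>\<close>, so that the gradient lives on an
  annulus, as needed for hole filling.\<close>

definition radial_cutoff :: "real^2 \<Rightarrow> real \<Rightarrow> real^2 \<Rightarrow> real" where
  "radial_cutoff p \<rho> x = bump (bump 1 - bump ((x - p) \<bullet> (x - p) / \<rho>\<^sup>2 - 1))"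

text \<open>The gradient of the cutoff at \<open>x\<close> is
  \<open>- radial_slope p \<rho> x\<close> times \<open>x - p\<close>. Splitting off this
  nonnegative factor is what lets the sign of the twist pass to the determinant of the
  variation.\<close>

definition radial_slope :: "real^2 \<Rightarrow> real \<Rightarrow> real^2 \<Rightarrow> real" where
  "radial_slope p \<rho> x = exp_bump (bump_deriv 1) (bump 1 - bump ((x - p) \<bullet> (x - p) / \<rho>\<^sup>2 - 1)) *
     exp_bump (bump_deriv 1) ((x - p) \<bullet> (x - p) / \<rho>\<^sup>2 - 1) * (2 / \<rho>\<^sup>2)"

lemma radial_cutoff_smooth: "C_k k (radial_cutoff p \<rho>)"
proof -
  have "radial_cutoff p \<rho> = (\<lambda>x. bump (bump 1 - bump (((x$1 - p$1) * (x$1 - p$1) + (x$2 - p$2) * (x$2 - p$2)) * (1 / \<rho>\<^sup>2) - 1)))"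
    by (simp add: radial_cutoff_def inner_vec_def sum_2 fun_eq_iff)
  then show ?thesis
    by (simp only:) (intro C_k_exp_bump C_k_minus C_k_mult C_k_add C_k_const C_k_component)
qed

lemma radial_cutoff_has_derivative:
  "(radial_cutoff p \<rho> has_derivative (\<lambda>h. (- radial_slope p \<rho> x *\<^sub>R (x - p)) \<bullet> h)) (at x)"
proof -
  let ?q = "\<lambda>x. (x - p) \<bullet> (x - p) / \<rho>\<^sup>2 - 1"
  have 1: "(?q has_derivative (\<lambda>h. 2 / \<rho>\<^sup>2 * ((x - p) \<bullet> h))) (at x)"
    unfolding divide_inverse by (auto intro!: derivative_eq_intros simp: inner_commute algebra_simps)
  have 2: "((\<lambda>x. bump 1 - bump (?q x)) has_derivative
      (\<lambda>h. - (exp_bump (bump_deriv 1) (?q x) * (2 / \<rho>\<^sup>2 * ((x - p) \<bullet> h))))) (at x)"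
    using has_derivative_diff[OF has_derivative_const[of "bump 1"] has_derivative_compose[OF 1 exp_bump_DERIV[of 1, THEN has_field_derivative_imp_has_derivative]]]
    by simp
  show ?thesis unfolding radial_cutoff_def[abs_def]
    by (rule has_derivative_eq_rhs[OF has_derivative_compose[OF 2 exp_bump_DERIV[THEN has_field_derivative_imp_has_derivative]]])
      (auto simp: radial_slope_def fun_eq_iff)
qed

lemma partial_deriv_radial_cutoff:
  "partial_deriv j (radial_cutoff p \<rho>) x = - radial_slope p \<rho> x * (x - p) $ j"
  using partial_deriv_eq[OF radial_cutoff_has_derivative] by simp

lemma radial_cutoff_bounds: "0 \<le> radial_cutoff p \<rho> x" "radial_cutoff p \<rho> x \<le> 1"
  by (simp_all add: radial_cutoff_def bump_nonneg bump_le_1)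

lemma radial_slope_nonneg: "0 \<le> radial_slope p \<rho> x"
  by (simp add: radial_slope_def exp_bump_bump_deriv_1_nonneg)

lemma radial_cutoff_inside:
  assumes "\<rho> > 0" "dist x p \<le> \<rho>"
  shows "radial_cutoff p \<rho> x = bump (bump 1)" "radial_slope p \<rho> x = 0"
proof -
  have "(x - p) \<bullet> (x - p) \<le> \<rho>\<^sup>2"
    using assms by (simp add: dist_norm flip: power2_norm_eq_inner)
  then have "(x - p) \<bullet> (x - p) / \<rho>\<^sup>2 - 1 \<le> 0" using assms by (simp add: field_simps)
  then show "radial_cutoff p \<rho> x = bump (bump 1)" "radial_slope p \<rho> x = 0"
    by (simp_all add: radial_cutoff_def radial_slope_def exp_bump_zero)
qed

lemma radial_cutoff_outside:
  assumes "\<rho> > 0" "dist x p \<ge> 2 * \<rho>"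
  shows "radial_cutoff p \<rho> x = 0" "radial_slope p \<rho> x = 0"
proof -
  have "(2 * \<rho>)\<^sup>2 \<le> (x - p) \<bullet> (x - p)"
    unfolding power2_norm_eq_inner[symmetric] using assms by (intro power_mono) (auto simp: dist_norm)
  then have "4 * \<rho>\<^sup>2 \<le> (x - p) \<bullet> (x - p)" by simp
  moreover have "\<rho>\<^sup>2 > 0" using assms by simp
  \<comment> \<open>The inner argument is at least one from distance \<open>sqrt 2 * \<rho>\<close>
    on, so twice the radius is more than enough.\<close>
  ultimately have "2 * \<rho>\<^sup>2 \<le> (x - p) \<bullet> (x - p)" by linarith
  with \<open>\<rho>\<^sup>2 > 0\<close> have "1 \<le> (x - p) \<bullet> (x - p) / \<rho>\<^sup>2 - 1" by (simp add: field_simps)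
  then have "bump 1 - bump ((x - p) \<bullet> (x - p) / \<rho>\<^sup>2 - 1) \<le> 0" using bump_mono by force
  then show "radial_cutoff p \<rho> x = 0" "radial_slope p \<rho> x = 0"
    by (simp_all add: radial_cutoff_def radial_slope_def exp_bump_zero)
qed

lemma exp_bump_bounded_Icc: "\<exists>M>0. \<forall>t\<in>{a..b}. \<bar>exp_bump p t\<bar> \<le> M"
proof -
  have "compact (exp_bump p ` {a..b})"
    by (intro compact_continuous_image continuous_intros) auto
  then have "bounded (exp_bump p ` {a..b})" by (rule compact_imp_bounded)
  then show ?thesis by (auto simp: bounded_pos)
qed

text \<open>Only the annulus between \<open>\<rho>\<close> and \<open>2 * \<rho>\<close> matters.
  There both profile derivatives are bounded independently of the radius, and
  \<open>2 / \<rho>^2\<close> against a distance below \<open>2 * \<rho>\<close> leaves the scaling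
  \<open>1 / \<rho>\<close> of a gradient. One constant for all centres and radii is what allows the
  decay to be iterated.\<close>

lemma radial_slope_bound:
  obtains M where "M > 0" "\<And>p \<rho> x. \<rho> > 0 \<Longrightarrow> radial_slope p \<rho> x * norm (x - p) \<le> M / \<rho>"
proof -
  let ?b = "exp_bump (bump_deriv 1)"
  obtain M where M: "M > 0" "\<And>t. t \<in> {0..3} \<Longrightarrow> \<bar>?b t\<bar> \<le> M" using exp_bump_bounded_Icc by metis
  have "radial_slope p \<rho> x * norm (x - p) \<le> (4 * M * M) / \<rho>" if "\<rho> > 0" for p \<rho> x
  proof (cases "dist x p \<le> \<rho> \<or> dist x p \<ge> 2 * \<rho>")
    case True
    then have "radial_slope p \<rho> x = 0"
      using radial_cutoff_inside radial_cutoff_outside that by blast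
    then show ?thesis using M that by simp
  next
    case False
    then have n: "\<rho> < norm (x - p)" "norm (x - p) < 2 * \<rho>" by (auto simp: dist_norm)
    have "\<rho>\<^sup>2 \<le> (norm (x - p))\<^sup>2" "(norm (x - p))\<^sup>2 \<le> (2 * \<rho>)\<^sup>2"
      using n that by (intro power_mono; simp)+
    then have q: "(x - p) \<bullet> (x - p) / \<rho>\<^sup>2 - 1 \<in> {0..3}"
      using that by (simp add: power2_norm_eq_inner field_simps)
    then have "bump 1 - bump ((x - p) \<bullet> (x - p) / \<rho>\<^sup>2 - 1) \<in> {..1}"
      using bump_nonneg[of "(x - p) \<bullet> (x - p) / \<rho>\<^sup>2 - 1"] bump_le_1[of 1] by simp
    \<comment> \<open>The outer argument is at most one but may be negative, where the profile
      derivative is zero.\<close>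
    then have "\<bar>?b (bump 1 - bump ((x - p) \<bullet> (x - p) / \<rho>\<^sup>2 - 1))\<bar> \<le> M"
      using M by (cases "bump 1 - bump ((x - p) \<bullet> (x - p) / \<rho>\<^sup>2 - 1) \<ge> 0") (auto simp: exp_bump_zero)
    moreover have "\<bar>?b ((x - p) \<bullet> (x - p) / \<rho>\<^sup>2 - 1)\<bar> \<le> M" using M q by blast
    ultimately have "radial_slope p \<rho> x \<le> M * M * (2 / \<rho>\<^sup>2)"
      unfolding radial_slope_def using that exp_bump_bump_deriv_1_nonneg M(1)
      by (intro mult_mono) auto
    then have "radial_slope p \<rho> x * norm (x - p) \<le> M * M * (2 / \<rho>\<^sup>2) * (2 * \<rho>)"
      using n that radial_slope_nonneg M by (intro mult_mono) auto
    also have "\<dots> = (4 * M * M) / \<rho>" using that by (simp add: power2_eq_square)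
    finally show ?thesis .
  qed
  then show ?thesis using M(1) by (intro that[of "4 * M * M"]) auto
qed

lemma radial_cutoff_test_function:
  assumes "\<rho> > 0" "cball p (2 * \<rho>) \<subseteq> \<Omega>"
  shows "test_function \<Omega> (radial_cutoff p \<rho>)"
  by (rule test_functionI[of _ "cball p (2 * \<rho>)"])
    (use assms in \<open>auto simp: radial_cutoff_smooth dist_commute intro!: radial_cutoff_outside\<close>)

subsection \<open>Continuity of translations in the space of square-integrable functions\<close>

definition clamp1 :: "real \<Rightarrow> real \<Rightarrow> real" where
  "clamp1 c t = max (- c) (min c t)"

lemma clamp1_bound: "c \<ge> 0 \<Longrightarrow> \<bar>clamp1 c t\<bar> \<le> c" "c \<ge> 0 \<Longrightarrow> \<bar>t - clamp1 c t\<bar> \<le> \<bar>t\<bar>"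
  and clamp1_id: "\<bar>t\<bar> \<le> c \<Longrightarrow> clamp1 c t = t"
  by (auto simp: clamp1_def)

lemma clamp1_continuous [continuous_intros]:
  "continuous_on S f \<Longrightarrow> continuous_on S (\<lambda>x. clamp1 c (f x))"
  unfolding clamp1_def by (intro continuous_intros)

lemma clamp1_measurable [measurable]: "clamp1 c \<in> borel_measurable borel"
  unfolding clamp1_def[abs_def] by measurable

lemma cball_measurable_pred [measurable]: "Measurable.pred borel (\<lambda>x. x \<in> cball a r)"
  by (auto simp del: mem_ball mem_cball simp: pred_def intro!: borel_closed borel_open)

lemma square_sum3: "((a::real) + b + c)\<^sup>2 \<le> 3 * a\<^sup>2 + 3 * b\<^sup>2 + 3 * c\<^sup>2"
proof -
  have "0 \<le> (a - b)\<^sup>2 + (b - c)\<^sup>2 + (a - c)\<^sup>2" by simp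
  then show ?thesis by (simp add: power2_eq_square algebra_simps)
qed

lemma abs_le_1_plus_square: "\<bar>x\<bar> \<le> 1 + x\<^sup>2" for x :: real
proof -
  have "0 \<le> (\<bar>x\<bar> - 1)\<^sup>2" by simp
  then have "2 * \<bar>x\<bar> \<le> 1 + x\<^sup>2" by (simp add: power2_eq_square algebra_simps)
  then show ?thesis using abs_ge_zero[of x] by linarith
qed

lemma square_sum2: "((a::real) + b)\<^sup>2 \<le> 2 * a\<^sup>2 + 2 * b\<^sup>2"
proof -
  have "0 \<le> (a - b)\<^sup>2" by simp
  then show ?thesis by (simp add: power2_eq_square algebra_simps)
qed

text \<open>Values and support are truncated at the same level \<open>n\<close>. The truncated
  function agrees with \<open>f\<close> at each point eventually, and \<open>f^2\<close> dominates
  the squared error.\<close>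

lemma L2_cutoff:
  fixes f :: "'a::euclidean_space \<Rightarrow> real"
  assumes [measurable]: "f \<in> borel_measurable borel" and fin: "integrable lborel (\<lambda>x. (f x)\<^sup>2)" and e: "e > 0"
  obtains n :: nat where "(\<integral>x. (f x - clamp1 n (f x) * indicator (cball 0 n) x)\<^sup>2 \<partial>lborel) < e"
proof -
  let ?g = "\<lambda>n x. clamp1 (real n) (f x) * indicator (cball 0 (real n)) x"
  have "(\<lambda>n. \<integral>x. (f x - ?g n x)\<^sup>2 \<partial>lborel) \<longlonglongrightarrow> (\<integral>x. 0 \<partial>(lborel :: 'a measure))"
  proof (rule integral_dominated_convergence)
    show "integrable lborel (\<lambda>x. (f x)\<^sup>2)" by fact
    have "(f x - ?g n x)\<^sup>2 \<le> (f x)\<^sup>2" for n x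
      using clamp1_bound(2)[of "real n" "f x"] by (cases "x \<in> cball 0 (real n)") (auto simp: abs_le_square_iff)
    then show "AE x in lborel. norm ((f x - ?g n x)\<^sup>2) \<le> (f x)\<^sup>2" for n by simp
    show "AE x in lborel. (\<lambda>n. (f x - ?g n x)\<^sup>2) \<longlonglongrightarrow> 0"
    proof (rule AE_I2)
      fix x
      obtain N where N: "\<bar>f x\<bar> + norm x \<le> real N" using real_arch_simple by blast
      have "eventually (\<lambda>n. 0 = (f x - ?g n x)\<^sup>2) sequentially"
        using eventually_ge_at_top[of N]
      proof eventually_elim
        case (elim n)
        then have "real N \<le> real n" by simp
        then have "\<bar>f x\<bar> \<le> n" "norm x \<le> n" using N norm_ge_zero[of x] abs_ge_zero[of "f x"] by linarith+
        then show ?case by (simp add: clamp1_id)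
      qed
      then show "(\<lambda>n. (f x - ?g n x)\<^sup>2) \<longlonglongrightarrow> 0"
        by (rule Lim_transform_eventually[OF tendsto_const])
    qed
  qed measurable
  then have "eventually (\<lambda>n. (\<integral>x. (f x - ?g n x)\<^sup>2 \<partial>lborel) < e) sequentially"
    using e by (auto dest: order_tendstoD)
  then show ?thesis using that by (auto simp: eventually_sequentially)
qed

text \<open>Measurability enters as an almost everywhere limit of continuous functions. Clamping
  these to \<open>[-c, c]\<close> and multiplying by a continuous plateau function supported in the
  ball of radius \<open>R + 1\<close> supplies a dominating function, so pointwise convergence
  becomes convergence in mean square.\<close>

lemma L2_dense_continuous_bounded:
  fixes f :: "'a::euclidean_space \<Rightarrow> real"
  assumes [measurable]: "f \<in> borel_measurable borel" and R: "R \<ge> 0" "c \<ge> 0"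
    and f: "\<And>x. \<bar>f x\<bar> \<le> c" "\<And>x. x \<notin> cball 0 R \<Longrightarrow> f x = 0" and e: "e > 0"
  obtains g where "continuous_on UNIV g" "\<And>x. x \<notin> cball 0 (R + 1) \<Longrightarrow> g x = 0"
    "\<And>x. \<bar>g x\<bar> \<le> c" "(\<integral>x. (f x - g x)\<^sup>2 \<partial>lborel) < e"
proof -
  have "f measurable_on UNIV"
    by (intro lebesgue_measurable_imp_measurable_on_real)
      (auto intro: measurable_completion simp: lebesgue_on_UNIV_eq)
  then obtain N g where N: "negligible N" and g: "\<And>n. continuous_on UNIV (g n)"
     "\<And>x. x \<notin> N \<Longrightarrow> (\<lambda>n. g n x) \<longlonglongrightarrow> f x"
    unfolding measurable_on_def by auto
  let ?\<eta> = "\<lambda>x::'a. max 0 (min 1 (R + 1 - norm x))"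
  let ?h = "\<lambda>n x. clamp1 c (g n x) * ?\<eta> x"
  have hc: "continuous_on UNIV (?h n)" for n by (intro continuous_intros g)
  have [measurable]: "?h n \<in> borel_measurable borel" for n by (rule borel_measurable_continuous_onI[OF hc])
  have hb: "\<bar>?h n x\<bar> \<le> c" for n x
    using mult_mono[OF clamp1_bound(1)[OF \<open>c \<ge> 0\<close>, of "g n x"], of "?\<eta> x" 1] R by (simp add: abs_mult)
  have h0: "?h n x = 0" if "x \<notin> cball 0 (R + 1)" for n x using that by auto
  have "(\<lambda>n. \<integral>x. (f x - ?h n x)\<^sup>2 \<partial>lborel) \<longlonglongrightarrow> (\<integral>x. 0 \<partial>(lborel :: 'a measure))"
  proof (rule integral_dominated_convergence)
    show "integrable lborel (\<lambda>x::'a. (2 * c)\<^sup>2 * indicator (cball 0 (R + 1)) x)"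
      using emeasure_lborel_cball_finite by (intro integrable_mult_right integrable_real_indicator) auto
    have "(f x - ?h n x)\<^sup>2 \<le> (2 * c)\<^sup>2 * indicator (cball 0 (R + 1)) x" for n x
    proof (cases "x \<in> cball 0 (R + 1)")
      case True
      have "\<bar>f x - ?h n x\<bar> \<le> 2 * c" using f(1)[of x] hb[of n x] by linarith
      then have "(f x - ?h n x)\<^sup>2 \<le> (2 * c)\<^sup>2" using R by (subst abs_le_square_iff[symmetric]) auto
      then show ?thesis using True by simp
    next
      case False
      then have "x \<notin> cball 0 R" by auto
      then show ?thesis using False h0[OF False] f(2) by simp
    qed
    then show "AE x in lborel. norm ((f x - ?h n x)\<^sup>2) \<le> (2 * c)\<^sup>2 * indicator (cball 0 (R + 1)) x" for n by simp
    have "AE x in lebesgue. x \<notin> N"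
      using N by (intro AE_not_in) (simp add: negligible_iff_null_sets)
    then have "AE x in lborel. x \<notin> N" unfolding AE_completion_iff .
    then show "AE x in lborel. (\<lambda>n. (f x - ?h n x)\<^sup>2) \<longlonglongrightarrow> 0"
    proof eventually_elim
      case (elim x)
      have "(\<lambda>n. (f x - ?h n x)\<^sup>2) \<longlonglongrightarrow> (f x - clamp1 c (f x) * ?\<eta> x)\<^sup>2"
        unfolding clamp1_def by (intro tendsto_intros g(2)[OF elim])
      moreover have "clamp1 c (f x) * ?\<eta> x = f x"
        using f(2)[of x] by (cases "x \<in> cball 0 R") (auto simp: clamp1_id f(1) R)
      ultimately show ?case by simp
    qed
  qed auto
  then have "eventually (\<lambda>n. (\<integral>x. (f x - ?h n x)\<^sup>2 \<partial>lborel) < e) sequentially"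
    using e by (auto dest: order_tendstoD)
  then obtain n where "(\<integral>x. (f x - ?h n x)\<^sup>2 \<partial>lborel) < e" by (auto simp: eventually_sequentially)
  then show ?thesis using that[of "?h n"] hc hb h0 by blast
qed

lemma L2_diff:
  fixes f g :: "'a \<Rightarrow> real"
  assumes [measurable]: "f \<in> borel_measurable M" "g \<in> borel_measurable M"
    and "integrable M (\<lambda>x. (f x)\<^sup>2)" "integrable M (\<lambda>x. (g x)\<^sup>2)"
  shows "integrable M (\<lambda>x. (f x - g x)\<^sup>2)"
proof (rule Bochner_Integration.integrable_bound)
  show "integrable M (\<lambda>x. 2 * (f x)\<^sup>2 + 2 * (g x)\<^sup>2)" using assms by simp
  show "AE x in M. norm ((f x - g x)\<^sup>2) \<le> norm (2 * (f x)\<^sup>2 + 2 * (g x)\<^sup>2)"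
    using square_sum2[of "f _" "- g _"] by simp
qed simp

lemma L2_dense_continuous:
  fixes f :: "'a::euclidean_space \<Rightarrow> real"
  assumes [measurable]: "f \<in> borel_measurable borel" and fin: "integrable lborel (\<lambda>x. (f x)\<^sup>2)" and e: "e > 0"
  obtains g K where "continuous_on UNIV g" "compact K" "\<And>x. x \<notin> K \<Longrightarrow> g x = 0"
    "integrable lborel (\<lambda>x. (g x)\<^sup>2)" "(\<integral>x. (f x - g x)\<^sup>2 \<partial>lborel) < e"
proof -
  \<comment> \<open>Two approximations, each within \<open>e / 4\<close>: the inequality
    \<open>(a + b)^2 \<le> 2 * a^2 + 2 * b^2\<close> doubles both errors.\<close>
  obtain n :: nat where n: "(\<integral>x. (f x - clamp1 n (f x) * indicator (cball 0 n) x)\<^sup>2 \<partial>lborel) < e / 4"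
    using L2_cutoff[OF assms(1,2), of "e / 4"] e by auto
  let ?f = "\<lambda>x. clamp1 n (f x) * indicator (cball 0 n) x"
  have [measurable]: "?f \<in> borel_measurable borel" by measurable
  obtain g :: "'a \<Rightarrow> real" where g: "continuous_on UNIV g" "\<And>x. x \<notin> cball 0 (real n + 1) \<Longrightarrow> g x = 0"
     "\<And>x. \<bar>g x\<bar> \<le> n" "(\<integral>x. (?f x - g x)\<^sup>2 \<partial>lborel) < e / 4"
  proof (rule L2_dense_continuous_bounded[of ?f "real n" "real n" "e / 4"])
    show "\<bar>?f x\<bar> \<le> n" for x by (auto simp: clamp1_bound abs_mult indicator_def)
  qed (use e in auto)
  have [measurable]: "g \<in> borel_measurable borel" by (rule borel_measurable_continuous_onI[OF g(1)])
  have bdd: "integrable lborel (\<lambda>x. (h x)\<^sup>2)" if [measurable]: "h \<in> borel_measurable borel"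
    and "\<And>x. \<bar>h x\<bar> \<le> n" "\<And>x. x \<notin> cball 0 (real n + 1) \<Longrightarrow> h x = 0" for h :: "'a \<Rightarrow> real"
  proof (rule Bochner_Integration.integrable_bound)
    show "integrable lborel (\<lambda>x::'a. (real n)\<^sup>2 * indicator (cball 0 (real n + 1)) x)"
      using emeasure_lborel_cball_finite by (intro integrable_mult_right integrable_real_indicator) auto
    have "(h x)\<^sup>2 \<le> (real n)\<^sup>2" for x using that(2)[of x] by (simp add: abs_le_square_iff[symmetric])
    then show "AE x in lborel. norm ((h x)\<^sup>2) \<le> norm ((real n)\<^sup>2 * indicator (cball 0 (real n + 1)) x)"
      using that(3) by (auto simp: indicator_def)
  qed simp
  have ig: "integrable lborel (\<lambda>x. (g x)\<^sup>2)" using g by (intro bdd) auto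
  have if': "integrable lborel (\<lambda>x. (?f x)\<^sup>2)"
    by (intro bdd) (auto simp: clamp1_bound abs_mult indicator_def)
  have j: "integrable lborel (\<lambda>x. (f x - ?f x)\<^sup>2)" "integrable lborel (\<lambda>x. (?f x - g x)\<^sup>2)"
    by (intro L2_diff fin if' ig; measurable)+
  have "(\<integral>x. (f x - g x)\<^sup>2 \<partial>lborel) \<le> (\<integral>x. 2 * (f x - ?f x)\<^sup>2 + 2 * (?f x - g x)\<^sup>2 \<partial>lborel)"
  proof (intro integral_mono Bochner_Integration.integrable_add integrable_mult_right L2_diff fin if' ig)
    show "(f x - g x)\<^sup>2 \<le> 2 * (f x - ?f x)\<^sup>2 + 2 * (?f x - g x)\<^sup>2" for x
      using square_sum2[of "f x - ?f x" "?f x - g x"] by simp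
  qed auto
  also have "\<dots> = 2 * (\<integral>x. (f x - ?f x)\<^sup>2 \<partial>lborel) + 2 * (\<integral>x. (?f x - g x)\<^sup>2 \<partial>lborel)"
    by (subst Bochner_Integration.integral_add[OF integrable_mult_right[OF j(1)] integrable_mult_right[OF j(2)]])
      (simp only: integral_mult_right_zero)
  also have "\<dots> < e" using n g(4) by linarith
  finally have "(\<integral>x. (f x - g x)\<^sup>2 \<partial>lborel) < e" .
  then show ?thesis using g(2) by (intro that[OF g(1) compact_cball _ ig])
qed

lemma distr_lborel_shift: "distr lborel borel (\<lambda>x. x + y) = (lborel :: 'a::euclidean_space measure)"
proof -
  have "(\<lambda>x. x + y) = (+) y" by (simp add: fun_eq_iff add.commute)
  then show ?thesis by (simp only: lborel_distr_plus)
qed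

lemma lborel_integral_shift:
  fixes f :: "'a::euclidean_space \<Rightarrow> real"
  assumes [measurable]: "f \<in> borel_measurable borel"
  shows "(\<integral>x. f (x + y) \<partial>lborel) = (\<integral>x. f x \<partial>lborel)"
  by (subst (2) distr_lborel_shift[symmetric, of y]) (simp add: integral_distr)

lemma lborel_integrable_shift:
  fixes f :: "'a::euclidean_space \<Rightarrow> real"
  assumes [measurable]: "f \<in> borel_measurable borel" and "integrable lborel f"
  shows "integrable lborel (\<lambda>x. f (x + y))"
proof -
  have "integrable (distr lborel borel (\<lambda>x. x + y)) f" using assms(2) by (simp add: distr_lborel_shift)
  then show ?thesis by (subst (asm) integrable_distr_eq) auto
qed

text \<open>Uniform continuity settles the case of a continuous function with compact support. A
  general \<open>f\<close> inherits the property, since shifting \<open>f\<close> and its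
  approximant together does not change their distance in mean square.\<close>

lemma L2_translation_continuous:
  fixes f :: "'a::euclidean_space \<Rightarrow> real"
  assumes [measurable]: "f \<in> borel_measurable borel" and fin: "integrable lborel (\<lambda>x. (f x)\<^sup>2)" and e: "e > 0"
  obtains d where "d > 0" "\<And>y. norm y \<le> d \<Longrightarrow> (\<integral>x. (f (x + y) - f x)\<^sup>2 \<partial>lborel) \<le> e"
proof -
  obtain g K where g: "continuous_on UNIV g" "compact K" "\<And>x. x \<notin> K \<Longrightarrow> g x = 0"
    "integrable lborel (\<lambda>x. (g x)\<^sup>2)" "(\<integral>x. (f x - g x)\<^sup>2 \<partial>lborel) < e / 9"
    using L2_dense_continuous[OF assms(1,2), of "e / 9"] e by auto
  have [measurable]: "g \<in> borel_measurable borel" by (rule borel_measurable_continuous_onI[OF g(1)])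
  obtain R where R: "R > 0" "\<And>x. x \<in> K \<Longrightarrow> norm x \<le> R" using compact_imp_bounded[OF g(2)] by (auto simp: bounded_pos)
  define V where "V = measure lborel (cball (0::'a) (R + 1))"
  have "V \<ge> 0" by (simp add: V_def)
  \<comment> \<open>Chosen so that \<open>s^2 * V\<close> is at most \<open>e / 9\<close>. Squaring
    a sum of three terms costs a factor 3, and three errors of \<open>e / 9\<close> then add up to
    \<open>e\<close>.\<close>
  define s where "s = sqrt (e / (9 * (V + 1)))"
  have s: "s > 0" "s\<^sup>2 = e / (9 * (V + 1))" using e \<open>V \<ge> 0\<close> by (simp_all add: s_def)
  have "uniformly_continuous_on (cball 0 (R + 2)) g"
    using g(1) by (intro compact_uniformly_continuous) (auto intro: continuous_on_subset)
  then obtain d0 where d0: "d0 > 0" "\<And>x x'. x \<in> cball 0 (R + 2) \<Longrightarrow> x' \<in> cball 0 (R + 2) \<Longrightarrow> dist x' x < d0 \<Longrightarrow> dist (g x') (g x) < s"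
    using s(1) unfolding uniformly_continuous_on_def by metis
  \<comment> \<open>Shifts of length at most one keep the shifted points in the ball of radius
    \<open>R + 2\<close> and make the difference vanish outside the ball of radius
    \<open>R + 1\<close>.\<close>
  define d where "d = min 1 (d0 / 2)"
  have "d > 0" using d0 by (simp add: d_def)
  moreover have "(\<integral>x. (f (x + y) - f x)\<^sup>2 \<partial>lborel) \<le> e" if y: "norm y \<le> d" for y
  proof -
    have gb: "(g (x + y) - g x)\<^sup>2 \<le> s\<^sup>2 * indicator (cball 0 (R + 1)) x" for x
    proof (cases "x \<in> cball 0 (R + 1)")
      case True
      have "norm (x + y) \<le> R + 2" using True y norm_triangle_ineq[of x y] by (auto simp: d_def)
      then have m: "x + y \<in> cball 0 (R + 2)" "x \<in> cball 0 (R + 2)" using True by auto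
      then have "dist (g (x + y)) (g x) < s" using y d0(1) by (intro d0(2) m) (auto simp: d_def dist_norm)
      then show ?thesis using True by (simp add: dist_real_def abs_le_square_iff[symmetric])
    next
      case False
      have "norm x \<le> norm (x + y) + norm y" using norm_triangle_ineq4[of "x + y" y] by simp
      then have "x + y \<notin> K" using False y R(2)[of "x + y"] by (auto simp: d_def)
      moreover have "x \<notin> K" using False R(2)[of x] by auto
      ultimately show ?thesis using g(3) by simp
    qed
    have fs: "integrable lborel (\<lambda>x. (f (x + y))\<^sup>2)" "integrable lborel (\<lambda>x. (g (x + y))\<^sup>2)"
      using lborel_integrable_shift[OF _ fin] lborel_integrable_shift[OF _ g(4)] by auto
    have i1: "integrable lborel (\<lambda>x. (f (x + y) - g (x + y))\<^sup>2)"
      by (intro L2_diff fs) auto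
    have i2: "integrable lborel (\<lambda>x::'a. s\<^sup>2 * indicator (cball 0 (R + 1)) x)"
      using emeasure_lborel_cball_finite by (intro integrable_mult_right integrable_real_indicator) auto
    have i3: "integrable lborel (\<lambda>x. (f x - g x)\<^sup>2)" by (intro L2_diff fin g) auto
    have "(\<integral>x. (f (x + y) - f x)\<^sup>2 \<partial>lborel) \<le>
        (\<integral>x. 3 * (f (x + y) - g (x + y))\<^sup>2 + 3 * (s\<^sup>2 * indicator (cball 0 (R + 1)) x) + 3 * (f x - g x)\<^sup>2 \<partial>lborel)"
    proof (intro integral_mono Bochner_Integration.integrable_add integrable_mult_right[OF i1] integrable_mult_right[OF i2] integrable_mult_right[OF i3] L2_diff fs fin)
      fix x
      have "(f (x + y) - f x)\<^sup>2 \<le> 3 * (f (x + y) - g (x + y))\<^sup>2 + 3 * (g (x + y) - g x)\<^sup>2 + 3 * (g x - f x)\<^sup>2"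
        using square_sum3[of "f (x + y) - g (x + y)" "g (x + y) - g x" "g x - f x"] by simp
      then show "(f (x + y) - f x)\<^sup>2 \<le> 3 * (f (x + y) - g (x + y))\<^sup>2 + 3 * (s\<^sup>2 * indicator (cball 0 (R + 1)) x) + 3 * (f x - g x)\<^sup>2"
        using gb[of x] by (simp add: power2_commute[of "g x" "f x"])
    qed auto
    also have "\<dots> = 3 * (\<integral>x. (f (x + y) - g (x + y))\<^sup>2 \<partial>lborel) + 3 * (s\<^sup>2 * V) + 3 * (\<integral>x. (f x - g x)\<^sup>2 \<partial>lborel)"
      using i1 i2 i3 by (simp add: V_def)
    also have "(\<integral>x. (f (x + y) - g (x + y))\<^sup>2 \<partial>lborel) = (\<integral>x. (f x - g x)\<^sup>2 \<partial>lborel)"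
      using lborel_integral_shift[of "\<lambda>x. (f x - g x)\<^sup>2" y] by simp
    also have "s\<^sup>2 * V \<le> e / 9" using \<open>V \<ge> 0\<close> e unfolding s(2) by (simp add: field_simps)
    finally show ?thesis using g(5) by simp
  qed
  ultimately show ?thesis by (rule that)
qed

subsection \<open>Mollification\<close>

text \<open>A one-dimensional profile, followed by its first two derivatives in closed form.
  Products of profiles in the two coordinates replace a radial mollifier, since a partial derivative
  then changes just one factor.\<close>

definition prof0 :: "real \<Rightarrow> real \<Rightarrow> real" where
  "prof0 r s = bump (r\<^sup>2 - s\<^sup>2)"

definition prof1 :: "real \<Rightarrow> real \<Rightarrow> real" where
  "prof1 r s = - 2 * s * exp_bump (bump_deriv 1) (r\<^sup>2 - s\<^sup>2)"

definition prof2 :: "real \<Rightarrow> real \<Rightarrow> real" where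
  "prof2 r s = - 2 * exp_bump (bump_deriv 1) (r\<^sup>2 - s\<^sup>2)
     + 4 * s\<^sup>2 * exp_bump (bump_deriv (bump_deriv 1)) (r\<^sup>2 - s\<^sup>2)"

lemma prof0_DERIV: "(prof0 r has_real_derivative prof1 r s) (at s)"
proof -
  have "((\<lambda>s. r\<^sup>2 - s\<^sup>2) has_real_derivative - 2 * s) (at s)" by (auto intro!: derivative_eq_intros)
  from DERIV_chain2[OF exp_bump_DERIV[of 1] this] show ?thesis
    unfolding prof0_def[abs_def] prof1_def by (simp add: mult.commute)
qed

lemma prof1_DERIV: "(prof1 r has_real_derivative prof2 r s) (at s)"
  unfolding prof1_def[abs_def] prof2_def
  by (auto intro!: derivative_eq_intros DERIV_chain2[OF exp_bump_DERIV] simp: power2_eq_square)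

lemma prof_zero:
  assumes "0 < r" "r \<le> \<bar>s\<bar>"
  shows "prof0 r s = 0" "prof1 r s = 0" "prof2 r s = 0"
proof -
  have "r\<^sup>2 \<le> s\<^sup>2" using assms by (simp add: abs_le_square_iff[symmetric])
  then show "prof0 r s = 0" "prof1 r s = 0" "prof2 r s = 0"
    by (simp_all add: prof0_def prof1_def prof2_def exp_bump_zero)
qed

lemma prof_continuous:
  "continuous_on S (prof0 r)" "continuous_on S (prof1 r)" "continuous_on S (prof2 r)"
  unfolding prof0_def[abs_def] prof1_def[abs_def] prof2_def[abs_def] by (intro continuous_intros)+

lemma prof_bounded:
  assumes "r > 0"
  obtains M where "M > 0" "\<And>s. \<bar>prof0 r s\<bar> \<le> M" "\<And>s. \<bar>prof1 r s\<bar> \<le> M" "\<And>s. \<bar>prof2 r s\<bar> \<le> M"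
proof -
  have z: "r \<le> \<bar>s\<bar>" if "s \<notin> {-r..r}" for s using that by auto
  obtain M0 where M0: "M0 > 0" "\<And>s. \<bar>prof0 r s\<bar> \<le> M0"
    using continuous_vanishing_bounded[of "prof0 r" "{-r..r}"] prof_continuous prof_zero assms z by (metis compact_Icc)
  obtain M1 where M1: "M1 > 0" "\<And>s. \<bar>prof1 r s\<bar> \<le> M1"
    using continuous_vanishing_bounded[of "prof1 r" "{-r..r}"] prof_continuous prof_zero assms z by (metis compact_Icc)
  obtain M2 where M2: "M2 > 0" "\<And>s. \<bar>prof2 r s\<bar> \<le> M2"
    using continuous_vanishing_bounded[of "prof2 r" "{-r..r}"] prof_continuous prof_zero assms z by (metis compact_Icc)
  show ?thesis
  proof
    show "M0 + M1 + M2 > 0" using M0 M1 M2 by linarith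
    show "\<bar>prof0 r s\<bar> \<le> M0 + M1 + M2" for s using M0(2)[of s] M1 M2 by linarith
    show "\<bar>prof1 r s\<bar> \<le> M0 + M1 + M2" for s using M0 M1(2)[of s] M2 by linarith
    show "\<bar>prof2 r s\<bar> \<le> M0 + M1 + M2" for s using M0 M1 M2(2)[of s] by linarith
  qed
qed

lemma DERIV_bounded_imp_lipschitz:
  fixes f :: "real \<Rightarrow> real"
  assumes "\<And>s. (f has_real_derivative f' s) (at s)" "\<And>s. \<bar>f' s\<bar> \<le> M"
  shows "\<bar>f s - f t\<bar> \<le> M * \<bar>s - t\<bar>"
  using field_differentiable_bound[of UNIV f f' M s t] assms
  by (auto simp: real_norm_def)

text \<open>The mean value inequality is applied to \<open>f x - x * f' s\<close> near
  \<open>s\<close>; the derivative \<open>f' x - f' s\<close> of this function is at most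
  \<open>M\<close> times the distance from \<open>s\<close>.\<close>

lemma DERIV2_bounded_imp_quadratic:
  fixes f :: "real \<Rightarrow> real"
  assumes "\<And>s. (f has_real_derivative f' s) (at s)" "\<And>s. (f' has_real_derivative f'' s) (at s)"
    "\<And>s. \<bar>f'' s\<bar> \<le> M"
  shows "\<bar>f (s + t) - f s - t * f' s\<bar> \<le> M * t\<^sup>2"
proof -
  let ?S = "cball s \<bar>t\<bar>"
  have "norm ((f (s + t) - (s + t) * f' s) - (f s - s * f' s)) \<le> M * \<bar>t\<bar> * norm (s + t - s)"
  proof (rule field_differentiable_bound[of ?S])
    show "((\<lambda>x. f x - x * f' s) has_field_derivative f' x - f' s) (at x within ?S)" for x
      by (auto intro!: derivative_eq_intros assms(1)[THEN has_field_derivative_at_within])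
    show "norm (f' x - f' s) \<le> M * \<bar>t\<bar>" if "x \<in> ?S" for x
    proof -
      have "M \<ge> 0" using assms(3)[of 0] by linarith
      have "\<bar>f' x - f' s\<bar> \<le> M * \<bar>x - s\<bar>" by (rule DERIV_bounded_imp_lipschitz[OF assms(2,3)])
      also have "\<dots> \<le> M * \<bar>t\<bar>" using that \<open>M \<ge> 0\<close> by (intro mult_left_mono) (auto simp: dist_real_def)
      finally show ?thesis by simp
    qed
  qed (auto simp: dist_real_def)
  then show ?thesis by (simp add: algebra_simps power2_eq_square abs_mult[symmetric] mult.assoc)
qed

section \<open>Convolution with product kernels\<close>

definition kern :: "(real \<Rightarrow> real) \<Rightarrow> (real \<Rightarrow> real) \<Rightarrow> real^2 \<Rightarrow> real" where
  "kern f g z = f (z $ 1) * g (z $ 2)"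

lemma kern_continuous:
  assumes "continuous_on UNIV f" "continuous_on UNIV g"
  shows "continuous_on S (kern f g)"
  unfolding kern_def[abs_def]
  by (intro continuous_on_mult continuous_on_compose2[OF assms(1)] continuous_on_compose2[OF assms(2)] continuous_intros) auto

lemma kern_lipschitz:
  assumes "\<And>s t. \<bar>f s - f t\<bar> \<le> M * \<bar>s - t\<bar>" "\<And>s t. \<bar>g s - g t\<bar> \<le> M * \<bar>s - t\<bar>" "\<And>s. \<bar>f s\<bar> \<le> M" "\<And>s. \<bar>g s\<bar> \<le> M"
  shows "\<bar>kern f g z - kern f g w\<bar> \<le> (2 * M * M) * norm (z - w)"
proof -
  have M: "M \<ge> 0" using assms(3)[of 0] by linarith
  have n: "\<bar>z $ i - w $ i\<bar> \<le> norm (z - w)" for i using component_le_norm_cart[of "z - w" i] by simp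
  have "kern f g z - kern f g w = (f (z $ 1) - f (w $ 1)) * g (z $ 2) + f (w $ 1) * (g (z $ 2) - g (w $ 2))"
    by (simp add: kern_def algebra_simps)
  also have "\<bar>\<dots>\<bar> \<le> \<bar>f (z $ 1) - f (w $ 1)\<bar> * \<bar>g (z $ 2)\<bar> + \<bar>f (w $ 1)\<bar> * \<bar>g (z $ 2) - g (w $ 2)\<bar>"
    using abs_triangle_ineq abs_mult by (metis (no_types))
  also have "\<dots> \<le> (M * norm (z - w)) * M + M * (M * norm (z - w))"
    using M n by (intro add_mono mult_mono assms order_trans[OF assms(1)] order_trans[OF assms(2)] mult_left_mono) auto
  finally show ?thesis by (simp add: algebra_simps)
qed

text \<open>The kernel is evaluated at \<open>y - x\<close>, not \<open>x - y\<close>, so that it is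
  literally the test function in \<open>y\<close> with which a weak gradient is tested. The price is
  a minus sign at each differentiation in \<open>x\<close>.\<close>

definition conv :: "(real^2 \<Rightarrow> real) \<Rightarrow> (real^2 \<Rightarrow> real) \<Rightarrow> real^2 \<Rightarrow> real" where
  "conv k a x = (\<integral>y. a y * k (y - x) \<partial>lborel)"

lemma integrable_mult_bounded:
  fixes a k :: "'a \<Rightarrow> real"
  assumes "integrable M a" and [measurable]: "k \<in> borel_measurable M" and "\<And>x. \<bar>k x\<bar> \<le> c"
  shows "integrable M (\<lambda>x. a x * k x)"
proof (rule Bochner_Integration.integrable_bound)
  show "integrable M (\<lambda>x. c * a x)" using assms by simp
  have [measurable]: "a \<in> borel_measurable M" using assms by simp
  show "(\<lambda>x. a x * k x) \<in> borel_measurable M" by measurable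
  have "\<bar>a x\<bar> * \<bar>k x\<bar> \<le> \<bar>c\<bar> * \<bar>a x\<bar>" for x
    using mult_left_mono[OF assms(3)[of x], of "\<bar>a x\<bar>"] mult_right_mono[OF abs_ge_self[of c], of "\<bar>a x\<bar>"]
    by (simp add: mult.commute)
  then show "AE x in M. norm (a x * k x) \<le> norm (c * a x)" by (simp add: abs_mult)
qed

lemma conv_integrable:
  fixes a k :: "real^2 \<Rightarrow> real"
  assumes "integrable lborel a" "k \<in> borel_measurable borel" "\<And>z. \<bar>k z\<bar> \<le> M"
  shows "integrable lborel (\<lambda>y. a y * k (y - x))"
  using assms by (intro integrable_mult_bounded[where c = M]) auto

text \<open>A second-order remainder bound for the kernel, uniform in \<open>z\<close>, integrates
  to the error \<open>M * h^2\<close> times the integral of the absolute value of \<open>a\<close>.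
  This justifies differentiation under the integral sign directly.\<close>

lemma conv_directional_derivative:
  assumes a: "integrable lborel a"
    and [measurable]: "k \<in> borel_measurable borel" "k' \<in> borel_measurable borel"
    and bd: "\<And>z. \<bar>k z\<bar> \<le> M" "\<And>z. \<bar>k' z\<bar> \<le> M"
    and quad: "\<And>z t. \<bar>k (z + t *\<^sub>R e) - k z - t * k' z\<bar> \<le> M * t\<^sup>2"
  shows "((\<lambda>t. conv k a (x + t *\<^sub>R e)) has_real_derivative - conv k' a x) (at 0)"
proof -
  have [measurable]: "a \<in> borel_measurable borel" using a by auto
  let ?I = "\<integral>y. \<bar>a y\<bar> \<partial>lborel"
  have *: "\<bar>conv k a (x + h *\<^sub>R e) - conv k a x + h * conv k' a x\<bar> \<le> M * h\<^sup>2 * ?I" for h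
  proof -
    have i: "integrable lborel (\<lambda>y. a y * k (y - (x + h *\<^sub>R e)))" "integrable lborel (\<lambda>y. a y * k (y - x))"
      "integrable lborel (\<lambda>y. a y * k' (y - x))"
      using a bd by (auto intro!: conv_integrable)
    have "conv k a (x + h *\<^sub>R e) - conv k a x + h * conv k' a x
        = (\<integral>y. a y * k (y - (x + h *\<^sub>R e)) - a y * k (y - x) + h * (a y * k' (y - x)) \<partial>lborel)"
      unfolding conv_def using i by simp
    also have "\<bar>\<dots>\<bar> \<le> (\<integral>y. M * h\<^sup>2 * \<bar>a y\<bar> \<partial>lborel)"
    proof (rule integral_abs_bound_integral)
      show "integrable lborel (\<lambda>y. a y * k (y - (x + h *\<^sub>R e)) - a y * k (y - x) + h * (a y * k' (y - x)))"
        using i by simp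
      show "integrable lborel (\<lambda>y. M * h\<^sup>2 * \<bar>a y\<bar>)" using a by simp
      fix y
      have "\<bar>k (y - (x + h *\<^sub>R e)) - k (y - x) + h * k' (y - x)\<bar> \<le> M * h\<^sup>2"
        using quad[of "y - x" "- h"] by (simp add: algebra_simps)
      then have "\<bar>a y\<bar> * \<bar>k (y - (x + h *\<^sub>R e)) - k (y - x) + h * k' (y - x)\<bar> \<le> \<bar>a y\<bar> * (M * h\<^sup>2)"
        by (rule mult_left_mono) simp
      then show "\<bar>a y * k (y - (x + h *\<^sub>R e)) - a y * k (y - x) + h * (a y * k' (y - x))\<bar> \<le> M * h\<^sup>2 * \<bar>a y\<bar>"
        by (simp add: abs_mult[symmetric] algebra_simps)
    qed
    finally show ?thesis by simp
  qed
  have "((\<lambda>h. (conv k a (x + h *\<^sub>R e) - conv k a x) / h - - conv k' a x) \<longlongrightarrow> 0) (at 0)"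
  proof (rule Lim_null_comparison)
    show "((\<lambda>h. M * \<bar>h\<bar> * ?I) \<longlongrightarrow> 0) (at 0)" by (auto intro!: tendsto_eq_intros)
    have "norm ((conv k a (x + h *\<^sub>R e) - conv k a x) / h - - conv k' a x) \<le> M * \<bar>h\<bar> * ?I" if "h \<noteq> 0" for h
    proof -
      have "(conv k a (x + h *\<^sub>R e) - conv k a x) / h - - conv k' a x
          = (conv k a (x + h *\<^sub>R e) - conv k a x + h * conv k' a x) / h"
        using that by (simp add: field_simps)
      moreover have "M * h\<^sup>2 * ?I = M * \<bar>h\<bar> * ?I * \<bar>h\<bar>" by (simp add: power2_eq_square)
      ultimately show ?thesis using *[of h] that by (simp only: real_norm_def abs_divide) (simp add: pos_divide_le_eq)
    qed
    then show "\<forall>\<^sub>F h in at 0. norm ((conv k a (x + h *\<^sub>R e) - conv k a x) / h - - conv k' a x) \<le> M * \<bar>h\<bar> * ?I"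
      by (simp add: eventually_at_filter)
  qed
  from LIM_zero_cancel[OF this] show ?thesis by (simp add: has_field_derivative_iff)
qed

lemma conv_continuous:
  assumes a: "integrable lborel a" and [measurable]: "k \<in> borel_measurable borel"
    and bd: "\<And>z. \<bar>k z\<bar> \<le> M" and lip: "\<And>z w. \<bar>k z - k w\<bar> \<le> L * norm (z - w)"
  shows "continuous_on UNIV (conv k a)"
proof -
  have [measurable]: "a \<in> borel_measurable borel" using a by auto
  let ?I = "\<integral>y. \<bar>a y\<bar> \<partial>lborel"
  have *: "\<bar>conv k a x - conv k a x'\<bar> \<le> L * norm (x - x') * ?I" for x x'
  proof -
    have i: "integrable lborel (\<lambda>y. a y * k (y - x))" "integrable lborel (\<lambda>y. a y * k (y - x'))"
      using a bd by (auto intro!: conv_integrable)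
    have "conv k a x - conv k a x' = (\<integral>y. a y * k (y - x) - a y * k (y - x') \<partial>lborel)"
      unfolding conv_def using i by simp
    also have "\<bar>\<dots>\<bar> \<le> (\<integral>y. L * norm (x - x') * \<bar>a y\<bar> \<partial>lborel)"
    proof (rule integral_abs_bound_integral)
      fix y
      have "\<bar>k (y - x) - k (y - x')\<bar> \<le> L * norm (x - x')"
        using lip[of "y - x" "y - x'"] by (simp add: norm_minus_commute)
      then have "\<bar>a y\<bar> * \<bar>k (y - x) - k (y - x')\<bar> \<le> \<bar>a y\<bar> * (L * norm (x - x'))"
        by (rule mult_left_mono) simp
      then show "\<bar>a y * k (y - x) - a y * k (y - x')\<bar> \<le> L * norm (x - x') * \<bar>a y\<bar>"
        by (simp add: abs_mult[symmetric] algebra_simps)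
    qed (use i a in auto)
    finally show ?thesis by simp
  qed
  show ?thesis
  proof (intro continuous_at_imp_continuous_on ballI)
    fix x
    have "((\<lambda>x'. conv k a x' - conv k a x) \<longlongrightarrow> 0) (at x)"
    proof (rule Lim_null_comparison)
      show "((\<lambda>x'. L * norm (x' - x) * ?I) \<longlongrightarrow> 0) (at x)" by (auto intro!: tendsto_eq_intros)
    qed (use * in auto)
    then show "isCont (conv k a) x" by (simp add: isCont_def LIM_zero_iff)
  qed
qed

text \<open>Jensen's inequality for the square, read off from the nonnegative variance of
  \<open>h\<close> under the weight \<open>w\<close>. An infinite right-hand side is trivial, and a
  finite one makes \<open>h * w\<close> integrable.\<close>

lemma weighted_square_of_mean_le:
  fixes h w :: "'a \<Rightarrow> real"
  assumes [measurable]: "h \<in> borel_measurable M" and w: "integrable M w" "\<And>x. w x \<ge> 0" "(\<integral>x. w x \<partial>M) = 1"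
  shows "ennreal ((\<integral>x. h x * w x \<partial>M)\<^sup>2) \<le> (\<integral>\<^sup>+x. ennreal ((h x)\<^sup>2 * w x) \<partial>M)"
proof (cases "(\<integral>\<^sup>+x. ennreal ((h x)\<^sup>2 * w x) \<partial>M) = \<infinity>")
  case False
  have [measurable]: "w \<in> borel_measurable M" using w by auto
  have i2: "integrable M (\<lambda>x. (h x)\<^sup>2 * w x)"
    using False w(2) by (intro integrableI_nonneg) (auto simp: top.not_eq_extremum)
  have i1: "integrable M (\<lambda>x. h x * w x)"
  proof (rule Bochner_Integration.integrable_bound)
    show "integrable M (\<lambda>x. w x + (h x)\<^sup>2 * w x)" using w i2 by simp
    have "\<bar>h x * w x\<bar> \<le> w x + (h x)\<^sup>2 * w x" for x
    proof -
      from mult_right_mono[OF abs_le_1_plus_square w(2)[of x], of "h x"] show ?thesis using w(2)[of x] by (simp add: abs_mult algebra_simps)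
    qed
    then show "AE x in M. norm (h x * w x) \<le> norm (w x + (h x)\<^sup>2 * w x)"
      using w(2) by (auto intro: order_trans)
  qed simp
  let ?m = "\<integral>x. h x * w x \<partial>M"
  have "0 \<le> (\<integral>x. (h x - ?m)\<^sup>2 * w x \<partial>M)" using w(2) by simp
  also have "\<dots> = (\<integral>x. (h x)\<^sup>2 * w x - 2 * ?m * (h x * w x) + ?m\<^sup>2 * w x \<partial>M)"
    by (simp add: power2_eq_square algebra_simps)
  also have "\<dots> = (\<integral>x. (h x)\<^sup>2 * w x \<partial>M) - 2 * ?m * ?m + ?m\<^sup>2"
    using i1 i2 w by simp
  finally have "?m\<^sup>2 \<le> (\<integral>x. (h x)\<^sup>2 * w x \<partial>M)" by (simp add: power2_eq_square)
  then show ?thesis using i2 w(2) by (subst nn_integral_eq_integral) (auto intro: ennreal_leI)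
qed simp

section \<open>The normalised mollifier\<close>

definition mol_mass :: "real \<Rightarrow> real" where
  "mol_mass r = (\<integral>z. kern (prof0 r) (prof0 r) z \<partial>lborel)"

definition mol :: "real \<Rightarrow> real^2 \<Rightarrow> real" where
  "mol r z = kern (prof0 r) (prof0 r) z / mol_mass r"

lemma kern_prof_measurable [measurable]:
  "kern (prof0 r) (prof0 r) \<in> borel_measurable borel" "kern (prof1 r) (prof0 r) \<in> borel_measurable borel"
  "kern (prof0 r) (prof1 r) \<in> borel_measurable borel" "kern (prof1 r) (prof1 r) \<in> borel_measurable borel"
  by (intro borel_measurable_continuous_onI kern_continuous prof_continuous)+

lemma norm_le_two_component:
  fixes z :: "real^2"
  assumes "\<bar>z $ 1\<bar> \<le> r" "\<bar>z $ 2\<bar> \<le> r"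
  shows "norm z \<le> 2 * r"
  using norm_le_l1_cart[of z] assms by (simp add: sum_2)

text \<open>The kernel lives on the square of half-side \<open>r\<close>, which lies in the disc of
  radius \<open>2 * r\<close>. This is the origin of the radius \<open>2 * r\<close> wherever the
  mollifier is used.\<close>

lemma kern_prof_zero:
  assumes "0 < r" "2 * r < norm z"
  shows "kern (prof0 r) (prof0 r) z = 0"
proof -
  have "r < \<bar>z $ 1\<bar> \<or> r < \<bar>z $ 2\<bar>" using norm_le_two_component[of z r] assms(2) by linarith
  then show ?thesis using prof_zero(1)[OF assms(1)] unfolding kern_def by (metis less_imp_le mult_eq_0_iff)
qed

lemma kern_prof_integrable: "0 < r \<Longrightarrow> integrable lborel (kern (prof0 r) (prof0 r))"
proof (rule Bochner_Integration.integrable_bound)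
  assume r: "0 < r"
  show "integrable lborel (\<lambda>x::real^2. 1 * indicator (cball 0 (2 * r)) x :: real)"
    using emeasure_lborel_cball_finite by (intro integrable_mult_right integrable_real_indicator) auto
  have "\<bar>kern (prof0 r) (prof0 r) z\<bar> \<le> 1" for z
    unfolding kern_def prof0_def abs_mult by (intro mult_le_one) (auto simp: bump_nonneg bump_le_1)
  then show "AE x in lborel. norm (kern (prof0 r) (prof0 r) x) \<le> norm (1 * indicator (cball 0 (2 * r)) x :: real)"
    using kern_prof_zero[OF r] by (auto simp: indicator_def)
qed auto

text \<open>A vanishing integral would force the nonnegative kernel to vanish almost everywhere,
  hence, being continuous, everywhere and in particular at the origin, where it is positive.\<close>

lemma mol_mass_pos: assumes "0 < r" shows "mol_mass r > 0"
proof -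
  let ?k = "kern (prof0 r) (prof0 r)"
  have nn: "?k z \<ge> 0" for z by (simp add: kern_def prof0_def bump_nonneg)
  have "mol_mass r \<noteq> 0"
  proof
    assume "mol_mass r = 0"
    then have "AE z in lborel. ?k z = 0"
      using integral_nonneg_eq_0_iff_AE[OF kern_prof_integrable[OF assms]] nn by (simp add: mol_mass_def)
    then have "AE z in lebesgue. z \<in> {z. ?k z = 0}" unfolding AE_completion_iff by simp
    moreover have "closed {z. ?k z = 0}"
      by (intro closed_Collect_eq kern_continuous prof_continuous continuous_intros)
    ultimately have "(0::real^2) \<in> {z. ?k z = 0}" by (intro mem_closed_if_AE_lebesgue)
    then show False using bump_pos[of "r\<^sup>2"] assms by (simp add: kern_def prof0_def)
  qed
  moreover have "mol_mass r \<ge> 0" unfolding mol_mass_def using nn by simp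
  ultimately show ?thesis by simp
qed

lemma mol_measurable [measurable]: "mol r \<in> borel_measurable borel"
  unfolding mol_def[abs_def] by measurable

lemma mol_props:
  assumes "0 < r"
  shows "mol r z \<ge> 0" "integrable lborel (mol r)" "(\<integral>z. mol r z \<partial>lborel) = 1"
    "2 * r < norm z \<Longrightarrow> mol r z = 0" "mol r z \<le> 1 / mol_mass r"
proof -
  show "mol r z \<ge> 0" using mol_mass_pos[OF assms] by (simp add: mol_def kern_def prof0_def bump_nonneg)
  show "integrable lborel (mol r)" using kern_prof_integrable[OF assms] by (simp add: mol_def[abs_def])
  show "(\<integral>z. mol r z \<partial>lborel) = 1" using mol_mass_pos[OF assms] by (simp add: mol_def[abs_def] mol_mass_def)
  show "2 * r < norm z \<Longrightarrow> mol r z = 0" using kern_prof_zero[OF assms] by (simp add: mol_def)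
  have "kern (prof0 r) (prof0 r) z \<le> 1"
    unfolding kern_def prof0_def by (intro mult_le_one) (auto simp: bump_nonneg bump_le_1)
  then show "mol r z \<le> 1 / mol_mass r" using mol_mass_pos[OF assms] by (simp add: mol_def divide_right_mono)
qed

lemma conv_shift:
  assumes [measurable]: "f \<in> borel_measurable borel" "k \<in> borel_measurable borel"
  shows "conv k f x = (\<integral>y. f (y + x) * k y \<partial>lborel)"
  unfolding conv_def using lborel_integral_shift[of "\<lambda>y. f y * k (y - x)" x] by simp

lemma mol_mult_integrable:
  assumes [measurable]: "f \<in> borel_measurable borel" and f: "integrable lborel (\<lambda>x. (f x)\<^sup>2)" and r: "0 < r"
  shows "integrable lborel (\<lambda>y. f (y + x) * mol r y)"
proof (rule Bochner_Integration.integrable_bound)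
  have "integrable lborel (\<lambda>y. (f (y + x))\<^sup>2)" by (rule lborel_integrable_shift[OF _ f]) measurable
  then show "integrable lborel (\<lambda>y. mol r y + (f (y + x))\<^sup>2 * (1 / mol_mass r))" using mol_props(2)[OF r] by simp
  have "\<bar>f y * mol r z\<bar> \<le> mol r z + (f y)\<^sup>2 * (1 / mol_mass r)" for y z
  proof -
    from mult_right_mono[OF abs_le_1_plus_square mol_props(1)[OF r, of z], of "f y"]
    have "\<bar>f y * mol r z\<bar> \<le> mol r z + (f y)\<^sup>2 * mol r z" using mol_props(1)[OF r, of z] by (simp add: abs_mult algebra_simps)
    also have "\<dots> \<le> mol r z + (f y)\<^sup>2 * (1 / mol_mass r)" using mol_props(5)[OF r] by (intro add_left_mono mult_left_mono) auto
    finally show ?thesis .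
  qed
  then show "AE y in lborel. norm (f (y + x) * mol r y) \<le> norm (mol r y + (f (y + x))\<^sup>2 * (1 / mol_mass r))"
    using mol_props(1)[OF r] mol_mass_pos[OF r] by (auto intro!: AE_I2 order_trans[OF _ abs_ge_self] simp del: abs_mult)
qed measurable

text \<open>Jensen's inequality at each point and an exchange of integrals bound the error by an
  average of translation errors over shifts of length at most \<open>2 * r\<close>.\<close>

lemma conv_mol_L2_estimate:
  assumes [measurable]: "f \<in> borel_measurable borel" and f: "integrable lborel (\<lambda>x. (f x)\<^sup>2)" and r: "0 < r"
    and d: "\<And>y. norm y \<le> 2 * r \<Longrightarrow> (\<integral>x. (f (x + y) - f x)\<^sup>2 \<partial>lborel) \<le> e"
  shows "(\<integral>\<^sup>+x. ennreal ((conv (mol r) f x - f x)\<^sup>2) \<partial>lborel) \<le> ennreal e"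
proof -
  have "ennreal ((conv (mol r) f x - f x)\<^sup>2) \<le> (\<integral>\<^sup>+y. ennreal ((f (y + x) - f x)\<^sup>2 * mol r y) \<partial>lborel)" for x
  proof -
    have "conv (mol r) f x - f x = (\<integral>y. f (y + x) * mol r y - f x * mol r y \<partial>lborel)"
      using mol_props(2,3)[OF r] mol_mult_integrable[OF assms(1) f r] by (simp add: conv_shift)
    also have "\<dots> = (\<integral>y. (f (y + x) - f x) * mol r y \<partial>lborel)" by (simp add: algebra_simps)
    finally show ?thesis using weighted_square_of_mean_le[of "\<lambda>y. f (y + x) - f x" lborel "mol r"] mol_props[OF r] by simp
  qed
  then have "(\<integral>\<^sup>+x. ennreal ((conv (mol r) f x - f x)\<^sup>2) \<partial>lborel)
      \<le> (\<integral>\<^sup>+x. (\<integral>\<^sup>+y. ennreal ((f (y + x) - f x)\<^sup>2 * mol r y) \<partial>lborel) \<partial>lborel)"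
    by (intro nn_integral_mono)
  also have "\<dots> = (\<integral>\<^sup>+y. (\<integral>\<^sup>+x. ennreal ((f (y + x) - f x)\<^sup>2 * mol r y) \<partial>lborel) \<partial>lborel)"
    by (rule lborel_pair.Fubini') measurable
  also have "\<dots> \<le> (\<integral>\<^sup>+y. ennreal e * ennreal (mol r y) \<partial>lborel)"
  proof (intro nn_integral_mono)
    fix y
    have i: "integrable lborel (\<lambda>x. (f (x + y) - f x)\<^sup>2)"
      by (intro L2_diff f lborel_integrable_shift[of "\<lambda>x. (f x)\<^sup>2"]) measurable
    have "(\<integral>\<^sup>+x. ennreal ((f (y + x) - f x)\<^sup>2 * mol r y) \<partial>lborel) = (\<integral>\<^sup>+x. ennreal ((f (x + y) - f x)\<^sup>2) \<partial>lborel) * ennreal (mol r y)"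
      using mol_props(1)[OF r] by (subst nn_integral_multc[symmetric]) (auto simp: ennreal_mult add.commute)
    also have "\<dots> = ennreal (\<integral>x. (f (x + y) - f x)\<^sup>2 \<partial>lborel) * ennreal (mol r y)"
      by (subst nn_integral_eq_integral[OF i]) auto
    also have "\<dots> \<le> ennreal e * ennreal (mol r y)"
      using d[of y] mol_props(4)[OF r, of y] by (cases "norm y \<le> 2 * r") (auto intro!: mult_right_mono ennreal_leI)
    finally show "(\<integral>\<^sup>+x. ennreal ((f (y + x) - f x)\<^sup>2 * mol r y) \<partial>lborel) \<le> ennreal e * ennreal (mol r y)" .
  qed
  also have "\<dots> = ennreal e * ennreal (\<integral>y. mol r y \<partial>lborel)"
    using mol_props[OF r] by (subst nn_integral_cmult) (auto simp: nn_integral_eq_integral)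
  finally show ?thesis using mol_props[OF r] by simp
qed

lemma conv_mol_L2_small:
  assumes [measurable]: "f \<in> borel_measurable borel" and f: "integrable lborel (\<lambda>x. (f x)\<^sup>2)" and e: "0 < e"
  obtains d where "d > 0" "\<And>r. 0 < r \<Longrightarrow> r \<le> d \<Longrightarrow> (\<integral>\<^sup>+x. ennreal ((conv (mol r) f x - f x)\<^sup>2) \<partial>lborel) \<le> ennreal e"
proof -
  obtain d where d: "d > 0" "\<And>y. norm y \<le> d \<Longrightarrow> (\<integral>x. (f (x + y) - f x)\<^sup>2 \<partial>lborel) \<le> e"
    using L2_translation_continuous[OF assms] by metis
  show ?thesis
    by (rule that[of "d / 2"]) (use d in \<open>auto intro!: conv_mol_L2_estimate f\<close>)
qed

lemma kern_has_derivative: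
  assumes "\<And>s. (f has_real_derivative f' s) (at s)" "\<And>s. (g has_real_derivative g' s) (at s)"
  shows "((\<lambda>y. kern f g (y - x)) has_derivative
    (\<lambda>h. vector [kern f' g (y - x), kern f g' (y - x)] \<bullet> h)) (at y)"
proof -
  have 1: "((\<lambda>y. (y - x) $ i) has_derivative (\<lambda>h. h $ i)) (at y)" for i
    by (intro bounded_linear.has_derivative[OF bounded_linear_vec_nth] has_derivative_eq_rhs[OF has_derivative_diff[OF has_derivative_ident has_derivative_const]]) simp
  show ?thesis unfolding kern_def
    by (rule has_derivative_eq_rhs[OF has_derivative_mult[OF
        has_derivative_compose[OF 1 assms(1)[THEN has_field_derivative_imp_has_derivative]]
        has_derivative_compose[OF 1 assms(2)[THEN has_field_derivative_imp_has_derivative]]]])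
      (auto simp: fun_eq_iff inner_vec_def sum_2 algebra_simps)
qed

lemma prof_kern_smooth: "C_k k (\<lambda>y. kern (prof0 r) (prof0 r) (y - x) * c)"
proof -
  have "(\<lambda>y. kern (prof0 r) (prof0 r) (y - x) * c) =
    (\<lambda>y. bump (r * r - (y $ 1 - x $ 1) * (y $ 1 - x $ 1)) * bump (r * r - (y $ 2 - x $ 2) * (y $ 2 - x $ 2)) * c)"
    by (simp add: kern_def prof0_def power2_eq_square)
  then show ?thesis
    by (simp only:) (intro C_k_exp_bump C_k_minus C_k_mult C_k_add C_k_const C_k_component)
qed

lemma mol_test_function:
  assumes "0 < r" "cball x (2 * r) \<subseteq> \<Omega>"
  shows "test_function \<Omega> (\<lambda>y. mol r (y - x))"
proof (rule test_functionI[of _ "cball x (2 * r)"])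
  show "C_k k (\<lambda>y. mol r (y - x))" for k
    using prof_kern_smooth[of k r x "1 / mol_mass r"] by (simp add: mol_def)
  show "mol r (y - x) = 0" if "y \<notin> cball x (2 * r)" for y
    using that mol_props(4)[OF assms(1), of "y - x"] by (simp add: dist_norm norm_minus_commute)
qed (use assms in auto)

lemma partial_deriv_mol:
  "partial_deriv 1 (\<lambda>y. mol r (y - x)) y = kern (prof1 r) (prof0 r) (y - x) / mol_mass r"
  "partial_deriv 2 (\<lambda>y. mol r (y - x)) y = kern (prof0 r) (prof1 r) (y - x) / mol_mass r"
proof -
  let ?D = "vector [kern (prof1 r) (prof0 r) (y - x), kern (prof0 r) (prof1 r) (y - x)] :: real^2"
  have "((\<lambda>y. mol r (y - x)) has_derivative (\<lambda>h. ((1 / mol_mass r) *\<^sub>R ?D) \<bullet> h)) (at y)"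
    using has_derivative_mult_right[OF kern_has_derivative[OF prof0_DERIV prof0_DERIV], of "1 / mol_mass r" r r x y]
    unfolding mol_def by simp
  note partial_deriv_eq[OF this]
  from this[of 1] this[of 2] show
    "partial_deriv 1 (\<lambda>y. mol r (y - x)) y = kern (prof1 r) (prof0 r) (y - x) / mol_mass r"
    "partial_deriv 2 (\<lambda>y. mol r (y - x)) y = kern (prof0 r) (prof1 r) (y - x) / mol_mass r"
    by simp_all
qed

text \<open>A scalar Borel version of \<^const>\<open>weak_gradient\<close>, so that Tonelli's theorem applies.\<close>

definition scalar_wgrad :: "(real^2) set \<Rightarrow> (real^2 \<Rightarrow> real) \<Rightarrow> (real^2 \<Rightarrow> real^2) \<Rightarrow> bool" where
  "scalar_wgrad \<Omega> a A \<longleftrightarrow> integrable lborel a \<and> A \<in> borel_measurable borel \<and>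
     integrable lborel (\<lambda>x. (norm (A x))\<^sup>2) \<and>
     (\<forall>\<phi> j. test_function \<Omega> \<phi> \<longrightarrow>
        (\<integral>x. a x * partial_deriv j \<phi> x \<partial>lborel) = - (\<integral>x. A x $ j * \<phi> x \<partial>lborel))"

lemma scalar_wgradD:
  assumes "scalar_wgrad \<Omega> a A"
  shows "integrable lborel a" "a \<in> borel_measurable borel" "A \<in> borel_measurable borel"
    "(\<lambda>x. A x $ j) \<in> borel_measurable borel"
    "integrable lborel (\<lambda>x. (norm (A x))\<^sup>2)" "integrable lborel (\<lambda>x. (A x $ j)\<^sup>2)"
    "test_function \<Omega> \<phi> \<Longrightarrow> (\<integral>x. a x * partial_deriv j \<phi> x \<partial>lborel) = - (\<integral>x. A x $ j * \<phi> x \<partial>lborel)"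
proof -
  show "integrable lborel a" "A \<in> borel_measurable borel" and i: "integrable lborel (\<lambda>x. (norm (A x))\<^sup>2)"
    and "test_function \<Omega> \<phi> \<Longrightarrow> (\<integral>x. a x * partial_deriv j \<phi> x \<partial>lborel) = - (\<integral>x. A x $ j * \<phi> x \<partial>lborel)"
    using assms by (auto simp: scalar_wgrad_def)
  then show "a \<in> borel_measurable borel" by auto
  show m: "(\<lambda>x. A x $ j) \<in> borel_measurable borel"
    using measurable_compose[OF \<open>A \<in> borel_measurable borel\<close> borel_measurable_continuous_onI[of "\<lambda>x. x $ j"]]
    by (simp add: continuous_on_component continuous_on_id)
  show "integrable lborel (\<lambda>x. (A x $ j)\<^sup>2)"
  proof (rule Bochner_Integration.integrable_bound[OF i])
    show "AE x in lborel. norm ((A x $ j)\<^sup>2) \<le> norm ((norm (A x))\<^sup>2)"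
    proof (rule AE_I2)
      fix x
      have "\<bar>A x $ j\<bar>\<^sup>2 \<le> (norm (A x))\<^sup>2" by (intro power_mono component_le_norm_cart) simp
      then show "norm ((A x $ j)\<^sup>2) \<le> norm ((norm (A x))\<^sup>2)" by simp
    qed
    show "(\<lambda>x. (A x $ j)\<^sup>2) \<in> borel_measurable lborel" using m by simp
  qed
qed

lemma conv_mol_eq: "conv (mol r) a x = conv (kern (prof0 r) (prof0 r)) a x / mol_mass r"
  by (simp add: conv_def mol_def)

text \<open>Testing the weak gradient with the shifted mollifier moves the derivative to the kernel.
  Hence mollifying the weak gradient and differentiating the mollified function agree wherever the
  disc of radius \<open>2 * r\<close> stays in \<open>\<Omega>\<close>.\<close>

lemma conv_mol_gradient:
  assumes w: "scalar_wgrad \<Omega> a A" and r: "0 < r" "cball x (2 * r) \<subseteq> \<Omega>"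
  shows "conv (mol r) (\<lambda>y. A y $ 1) x = - conv (kern (prof1 r) (prof0 r)) a x / mol_mass r"
    "conv (mol r) (\<lambda>y. A y $ 2) x = - conv (kern (prof0 r) (prof1 r)) a x / mol_mass r"
proof -
  have "conv (mol r) (\<lambda>y. A y $ j) x = - (\<integral>y. a y * partial_deriv j (\<lambda>y. mol r (y - x)) y \<partial>lborel)" for j
    using scalar_wgradD(7)[OF w mol_test_function[OF r], of j] by (simp add: conv_def)
  from this[of 1] this[of 2] show
    "conv (mol r) (\<lambda>y. A y $ 1) x = - conv (kern (prof1 r) (prof0 r)) a x / mol_mass r"
    "conv (mol r) (\<lambda>y. A y $ 2) x = - conv (kern (prof0 r) (prof1 r)) a x / mol_mass r"
    by (simp_all add: partial_deriv_mol conv_def)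
qed

lemma compact_continuous_uniform_nbhd:
  fixes a :: "'a::euclidean_space \<Rightarrow> real"
  assumes "compact K" "open \<Omega>" "K \<subseteq> \<Omega>" "continuous_on \<Omega> a" "e > 0"
  obtains d where "d > 0" "\<And>x. x \<in> K \<Longrightarrow> cball x d \<subseteq> \<Omega>"
    "\<And>x y. x \<in> K \<Longrightarrow> dist x y \<le> d \<Longrightarrow> \<bar>a y - a x\<bar> \<le> e"
proof -
  obtain d1 where d1: "d1 > 0" "(\<Union>x\<in>K. cball x d1) \<subseteq> \<Omega>"
    using compact_subset_open_imp_cball_epsilon_subset[OF assms(1-3)] by metis
  \<comment> \<open>The estimate concerns pairs with only the first point in \<open>K\<close>, so
    uniform continuity is taken on a compact neighbourhood of \<open>K\<close>.\<close>
  define K' where "K' = {x + y | x y. x \<in> K \<and> y \<in> cball 0 d1}"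
  have sub: "K' \<subseteq> \<Omega>" using d1(2) unfolding K'_def by (fastforce simp: dist_norm)
  have "compact K'" unfolding K'_def by (intro compact_sums assms compact_cball)
  then have "uniformly_continuous_on K' a"
    using assms(4) sub by (intro compact_uniformly_continuous) (auto intro: continuous_on_subset)
  then obtain d2 where d2: "d2 > 0" "\<And>x x'. x \<in> K' \<Longrightarrow> x' \<in> K' \<Longrightarrow> dist x' x < d2 \<Longrightarrow> dist (a x') (a x) < e"
    using uniformly_continuous_onE[OF _ assms(5)] by metis
  have inK: "y \<in> K'" if "x \<in> K" "dist x y \<le> d1" for x y
    using that unfolding K'_def
    by (intro CollectI exI[of _ x] exI[of _ "y - x"]) (auto simp: dist_norm norm_minus_commute)
  show ?thesis
  proof (rule that[of "min d1 (d2 / 2)"])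
    show "min d1 (d2 / 2) > 0" using d1 d2 by simp
    show "cball x (min d1 (d2 / 2)) \<subseteq> \<Omega>" if "x \<in> K" for x using d1(2) that by fastforce
    show "\<bar>a y - a x\<bar> \<le> e" if "x \<in> K" "dist x y \<le> min d1 (d2 / 2)" for x y
    proof -
      have "dist (a y) (a x) < e"
        using that d1 d2(1) inK[of x x] inK[of x y] by (intro d2(2)) (auto simp: dist_commute)
      then show ?thesis by (simp add: dist_real_def)
    qed
  qed
qed

lemma conv_mol_uniform:
  assumes a: "integrable lborel a" and r: "0 < r"
    and bd: "\<And>y. dist x y \<le> 2 * r \<Longrightarrow> \<bar>a y - a x\<bar> \<le> e"
  shows "\<bar>conv (mol r) a x - a x\<bar> \<le> e"
proof -
  have [measurable]: "a \<in> borel_measurable borel" using a by auto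
  have i: "integrable lborel (\<lambda>y. a (y + x) * mol r y)"
    using a mol_props[OF r] by (intro integrable_mult_bounded[where c = "1 / mol_mass r"] lborel_integrable_shift) auto
  have "conv (mol r) a x - a x = (\<integral>y. a (y + x) * mol r y - a x * mol r y \<partial>lborel)"
    using mol_props(2,3)[OF r] i by (simp add: conv_shift)
  also have "\<bar>\<dots>\<bar> \<le> (\<integral>y. e * mol r y \<partial>lborel)"
  proof (rule integral_abs_bound_integral)
    fix y
    have "\<bar>a (y + x) - a x\<bar> * mol r y \<le> e * mol r y"
    proof (cases "2 * r < norm y")
      case False
      then show ?thesis using mol_props(1)[OF r] by (intro mult_right_mono bd) (auto simp: dist_norm)
    qed (simp add: mol_props(4)[OF r])
    then show "\<bar>a (y + x) * mol r y - a x * mol r y\<bar> \<le> e * mol r y"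
      using mol_props(1)[OF r] by (simp add: left_diff_distrib[symmetric] abs_mult)
  qed (use i mol_props(2)[OF r] in auto)
  also have "\<dots> = e" using mol_props(3)[OF r] by simp
  finally show ?thesis .
qed

text \<open>\<open>B\<close> is the gradient of \<open>b\<close> and \<open>C\<close> its mixed
  second derivative, the one that the divergence form of the Jacobian contains; that both components
  of \<open>B\<close> lead to the same \<open>C\<close> is the symmetry of second derivatives.
  Values are close uniformly on \<open>K\<close>, gradients only in mean square, which suits a
  Jacobian that is quadratic in gradients.\<close>

lemma smooth_approximation:
  assumes \<Omega>: "open \<Omega>" and w: "scalar_wgrad \<Omega> a A" and c: "continuous_on \<Omega> a"
    and K: "compact K" "K \<subseteq> \<Omega>" and e: "e > 0"
  obtains b B C where "continuous_on UNIV b" "\<And>j. continuous_on UNIV (\<lambda>x. B x $ j)" "continuous_on UNIV C"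
    "\<And>x j. ((\<lambda>t. b (x + t *\<^sub>R axis j 1)) has_real_derivative B x $ j) (at 0)"
    "\<And>x. ((\<lambda>t. B (x + t *\<^sub>R axis 1 1) $ 2) has_real_derivative C x) (at 0)"
    "\<And>x. ((\<lambda>t. B (x + t *\<^sub>R axis 2 1) $ 1) has_real_derivative C x) (at 0)"
    "\<And>x. x \<in> K \<Longrightarrow> \<bar>b x - a x\<bar> \<le> e"
    "\<And>j. (\<integral>\<^sup>+x\<in>K. ennreal ((B x $ j - A x $ j)\<^sup>2) \<partial>lborel) \<le> ennreal e"
proof -
  note [measurable] = scalar_wgradD(2,3,4)[OF w]
  note a = scalar_wgradD(1)[OF w]
  obtain d where d: "d > 0" "\<And>x. x \<in> K \<Longrightarrow> cball x d \<subseteq> \<Omega>"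
    "\<And>x y. x \<in> K \<Longrightarrow> dist x y \<le> d \<Longrightarrow> \<bar>a y - a x\<bar> \<le> e"
    using compact_continuous_uniform_nbhd[OF K(1) \<Omega> K(2) c e] by metis
  obtain d1 where d1: "d1 > 0" "\<And>r. 0 < r \<Longrightarrow> r \<le> d1 \<Longrightarrow> (\<integral>\<^sup>+x. ennreal ((conv (mol r) (\<lambda>y. A y $ 1) x - A x $ 1)\<^sup>2) \<partial>lborel) \<le> ennreal e"
    by (rule conv_mol_L2_small[OF scalar_wgradD(4)[OF w, of 1] scalar_wgradD(6)[OF w, of 1] e]) (rule that)
  obtain d2 where d2: "d2 > 0" "\<And>r. 0 < r \<Longrightarrow> r \<le> d2 \<Longrightarrow> (\<integral>\<^sup>+x. ennreal ((conv (mol r) (\<lambda>y. A y $ 2) x - A x $ 2)\<^sup>2) \<partial>lborel) \<le> ennreal e"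
    by (rule conv_mol_L2_small[OF scalar_wgradD(4)[OF w, of 2] scalar_wgradD(6)[OF w, of 2] e]) (rule that)
  \<comment> \<open>The bound \<open>2 * r \<le> d\<close> serves both purposes of \<open>d\<close>:
    the mollifier centred in \<open>K\<close> stays in \<open>\<Omega>\<close>, and \<open>a\<close>
    varies by at most \<open>e\<close> over its support.\<close>
  define r where "r = min (d / 2) (min d1 d2)"
  have r: "0 < r" "2 * r \<le> d" "r \<le> d1" "r \<le> d2" using d d1 d2 by (auto simp: r_def)
  obtain M where M: "M > 0" "\<And>s. \<bar>prof0 r s\<bar> \<le> M" "\<And>s. \<bar>prof1 r s\<bar> \<le> M" "\<And>s. \<bar>prof2 r s\<bar> \<le> M"
    using prof_bounded[OF r(1)] by metis
  have bdd: "\<bar>kern f g z\<bar> \<le> M * M" if "\<And>s. \<bar>f s\<bar> \<le> M" "\<And>s. \<bar>g s\<bar> \<le> M" for f g z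
    unfolding kern_def abs_mult using that M(1) by (intro mult_mono) auto
  have quad: "\<bar>prof0 r (s + t) - prof0 r s - t * prof1 r s\<bar> \<le> M * t\<^sup>2" for s t
    by (rule DERIV2_bounded_imp_quadratic[OF prof0_DERIV prof1_DERIV M(4)])
  have q1: "\<bar>kern (prof0 r) g (z + t *\<^sub>R axis 1 1) - kern (prof0 r) g z - t * kern (prof1 r) g z\<bar> \<le> M * M * t\<^sup>2"
    if "\<And>s. \<bar>g s\<bar> \<le> M" for g z t
  proof -
    have "kern (prof0 r) g (z + t *\<^sub>R axis 1 1) - kern (prof0 r) g z - t * kern (prof1 r) g z
        = (prof0 r (z $ 1 + t) - prof0 r (z $ 1) - t * prof1 r (z $ 1)) * g (z $ 2)"
      by (simp add: kern_def axis_def algebra_simps)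
    also have "\<bar>\<dots>\<bar> \<le> M * t\<^sup>2 * M" unfolding abs_mult using quad that M(1) by (intro mult_mono) auto
    finally show ?thesis by (simp add: mult_ac)
  qed
  have q2: "\<bar>kern g (prof0 r) (z + t *\<^sub>R axis 2 1) - kern g (prof0 r) z - t * kern g (prof1 r) z\<bar> \<le> M * M * t\<^sup>2"
    if "\<And>s. \<bar>g s\<bar> \<le> M" for g z t
  proof -
    have "kern g (prof0 r) (z + t *\<^sub>R axis 2 1) - kern g (prof0 r) z - t * kern g (prof1 r) z
        = (prof0 r (z $ 2 + t) - prof0 r (z $ 2) - t * prof1 r (z $ 2)) * g (z $ 1)"
      by (simp add: kern_def axis_def algebra_simps)
    also have "\<bar>\<dots>\<bar> \<le> M * t\<^sup>2 * M" unfolding abs_mult using quad that M(1) by (intro mult_mono) auto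
    finally show ?thesis by (simp add: mult_ac)
  qed
  have l0: "\<bar>prof0 r s - prof0 r t\<bar> \<le> M * \<bar>s - t\<bar>" for s t
    by (rule DERIV_bounded_imp_lipschitz[OF prof0_DERIV M(3)])
  have l1: "\<bar>prof1 r s - prof1 r t\<bar> \<le> M * \<bar>s - t\<bar>" for s t
    by (rule DERIV_bounded_imp_lipschitz[OF prof1_DERIV M(4)])
  let ?m = "mol_mass r"
  \<comment> \<open>Each differentiation of \<open>conv\<close> contributes a minus sign, so
    \<open>B\<close> has one and \<open>C\<close> has none.\<close>
  define b where "b = (\<lambda>x. conv (kern (prof0 r) (prof0 r)) a x / ?m)"
  define B :: "real^2 \<Rightarrow> real^2" where "B = (\<lambda>x. vector [- conv (kern (prof1 r) (prof0 r)) a x / ?m, - conv (kern (prof0 r) (prof1 r)) a x / ?m])"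
  define C where "C = (\<lambda>x. conv (kern (prof1 r) (prof1 r)) a x / ?m)"
  have cont: "continuous_on UNIV (conv (kern f g) a)"
    if "kern f g \<in> borel_measurable borel" "\<And>s t. \<bar>f s - f t\<bar> \<le> M * \<bar>s - t\<bar>" "\<And>s t. \<bar>g s - g t\<bar> \<le> M * \<bar>s - t\<bar>"
       "\<And>s. \<bar>f s\<bar> \<le> M" "\<And>s. \<bar>g s\<bar> \<le> M" for f g
    by (rule conv_continuous[OF a that(1) bdd[OF that(4,5)] kern_lipschitz[OF that(2-5)]])
  have m: "\<forall>x\<in>UNIV :: (real^2) set. ?m \<noteq> 0" using mol_mass_pos[OF r(1)] by simp
  note D1 = conv_directional_derivative[OF a _ _ bdd bdd q1]
  note D2 = conv_directional_derivative[OF a _ _ bdd bdd q2]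
  show ?thesis
  proof (rule that[of b B C])
    show "continuous_on UNIV b" unfolding b_def
      by (intro continuous_intros cont l0 M m kern_prof_measurable)
    show "continuous_on UNIV C" unfolding C_def
      by (intro continuous_intros cont l1 M m kern_prof_measurable)
    have "\<forall>j. continuous_on UNIV (\<lambda>x. B x $ j)" unfolding B_def forall_2 vector_2
      by (intro conjI continuous_intros cont l0 l1 M m kern_prof_measurable)
    then show "continuous_on UNIV (\<lambda>x. B x $ j)" for j by blast
    have "\<forall>j. ((\<lambda>t. b (x + t *\<^sub>R axis j 1)) has_real_derivative B x $ j) (at 0)" for x
      unfolding B_def b_def forall_2 vector_2
      by (intro conjI DERIV_cdivide D1 D2 M kern_prof_measurable)
    then show "((\<lambda>t. b (x + t *\<^sub>R axis j 1)) has_real_derivative B x $ j) (at 0)" for x j by blast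
    have "((\<lambda>t. - conv (kern (prof0 r) (prof1 r)) a (x + t *\<^sub>R axis 1 1) / ?m) has_real_derivative - (- conv (kern (prof1 r) (prof1 r)) a x) / ?m) (at 0)" for x
      by (intro DERIV_cdivide DERIV_minus D1 M kern_prof_measurable)
    then show "((\<lambda>t. B (x + t *\<^sub>R axis 1 1) $ 2) has_real_derivative C x) (at 0)" for x
      unfolding B_def C_def vector_2 by simp
    have "((\<lambda>t. - conv (kern (prof1 r) (prof0 r)) a (x + t *\<^sub>R axis 2 1) / ?m) has_real_derivative - (- conv (kern (prof1 r) (prof1 r)) a x) / ?m) (at 0)" for x
      by (intro DERIV_cdivide DERIV_minus D2 M kern_prof_measurable)
    then show "((\<lambda>t. B (x + t *\<^sub>R axis 2 1) $ 1) has_real_derivative C x) (at 0)" for x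
      unfolding B_def C_def vector_2 by simp
    show "\<bar>b x - a x\<bar> \<le> e" if "x \<in> K" for x
      using conv_mol_uniform[OF a r(1), of x e] d(3)[OF that] r(2) by (simp add: b_def conv_mol_eq)
    have *: "(\<integral>\<^sup>+x\<in>K. ennreal ((f x - A x $ j)\<^sup>2) \<partial>lborel) \<le> ennreal e"
      if "\<And>x. x \<in> K \<Longrightarrow> f x = conv (mol r) (\<lambda>y. A y $ j) x"
        "(\<integral>\<^sup>+x. ennreal ((conv (mol r) (\<lambda>y. A y $ j) x - A x $ j)\<^sup>2) \<partial>lborel) \<le> ennreal e" for f j
      using that by (intro order_trans[OF nn_integral_mono that(2)]) (auto simp: indicator_def)
    have sub: "cball x (2 * r) \<subseteq> \<Omega>" if "x \<in> K" for x using d(2)[OF that] r(2) by auto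
    have "\<forall>j. (\<integral>\<^sup>+x\<in>K. ennreal ((B x $ j - A x $ j)\<^sup>2) \<partial>lborel) \<le> ennreal e"
      unfolding forall_2 B_def vector_2
      using conv_mol_gradient[OF w r(1) sub] d1(2)[OF r(1,3)] d2(2)[OF r(1,4)] by (intro conjI *) auto
    then show "(\<integral>\<^sup>+x\<in>K. ennreal ((B x $ j - A x $ j)\<^sup>2) \<partial>lborel) \<le> ennreal e" for j by blast
  qed
qed

text \<open>The fundamental lemma of the calculus of variations. Pairing with shifted mollifiers
  shows that the mollification of \<open>f\<close> vanishes on a compact set once the radius is
  small, while it is as close to \<open>f\<close> in mean square as desired.\<close>

lemma AE_zero_if_orthogonal_to_test_functions:
  fixes f :: "real^2 \<Rightarrow> real"
  assumes \<Omega>: "open \<Omega>" and [measurable]: "f \<in> borel_measurable borel" and f: "integrable lborel (\<lambda>x. (f x)\<^sup>2)"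
    and orth: "\<And>\<phi>. test_function \<Omega> \<phi> \<Longrightarrow> (\<integral>x. f x * \<phi> x \<partial>lborel) = 0"
  shows "AE x in lborel. x \<in> \<Omega> \<longrightarrow> f x = 0"
proof -
  obtain C :: "nat \<Rightarrow> (real^2) set" where
    C: "\<And>n. compact (C n)" "\<And>n. C n \<subseteq> \<Omega>" "\<Union>(range C) = \<Omega>"
  proof (rule open_Union_compact_subsets[OF \<Omega>])
    fix C :: "nat \<Rightarrow> (real^2) set"
    assume "\<And>n. compact (C n)" "\<And>n. C n \<subseteq> \<Omega>" "\<Union>(range C) = \<Omega>"
    then show thesis by (rule that)
  qed
  have "AE x in lborel. x \<in> C n \<longrightarrow> f x = 0" for n
  proof -
    obtain d0 where d0: "d0 > 0" "(\<Union>x\<in>C n. cball x d0) \<subseteq> \<Omega>"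
      using compact_subset_open_imp_cball_epsilon_subset[OF C(1) \<Omega> C(2)] by metis
    have [measurable]: "C n \<in> sets borel" using C(1) by (simp add: borel_compact)
    have *: "(\<integral>\<^sup>+x\<in>C n. ennreal ((f x)\<^sup>2) \<partial>lborel) \<le> ennreal e" if "e > 0" for e
    proof -
      obtain d where d: "d > 0" "\<And>r. 0 < r \<Longrightarrow> r \<le> d \<Longrightarrow> (\<integral>\<^sup>+x. ennreal ((conv (mol r) f x - f x)\<^sup>2) \<partial>lborel) \<le> ennreal e"
        by (rule conv_mol_L2_small[OF assms(2) f \<open>e > 0\<close>]) (rule that)
      define r where "r = min d (d0 / 2)"
      have r: "0 < r" "r \<le> d" "2 * r \<le> d0" using d d0 by (auto simp: r_def)
      have "conv (mol r) f x = 0" if "x \<in> C n" for x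
      proof -
        have "cball x (2 * r) \<subseteq> \<Omega>" using d0(2) r that by fastforce
        from orth[OF mol_test_function[OF r(1) this]] show ?thesis by (simp add: conv_def)
      qed
      then show ?thesis by (intro order_trans[OF nn_integral_mono d(2)[OF r(1,2)]]) (auto simp: indicator_def)
    qed
    have "(\<integral>\<^sup>+x\<in>C n. ennreal ((f x)\<^sup>2) \<partial>lborel) \<le> 0"
    proof (rule ennreal_le_epsilon)
      fix e :: real assume "0 < e"
      from *[OF this] show "(\<integral>\<^sup>+x\<in>C n. ennreal ((f x)\<^sup>2) \<partial>lborel) \<le> 0 + ennreal e" by (simp only: add_0)
    qed
    then have "(\<integral>\<^sup>+x\<in>C n. ennreal ((f x)\<^sup>2) \<partial>lborel) = 0" by simp
    then have "AE x in lborel. ennreal ((f x)\<^sup>2) * indicator (C n) x = 0"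
      by (subst (asm) nn_integral_0_iff_AE) auto
    then show ?thesis by eventually_elim (auto simp: indicator_def)
  qed
  then have "AE x in lborel. \<forall>n. x \<in> C n \<longrightarrow> f x = 0" by (subst AE_all_countable) simp
  then show ?thesis by eventually_elim (use C(3) in auto)
qed

subsection \<open>The maximum principle\<close>

text \<open>Derivatives are known at parameter zero for every base point; moving the base point
  along the line gives the derivative at every parameter.\<close>

lemma directional_derivative_shift:
  fixes \<psi> \<psi>' :: "'a::real_vector \<Rightarrow> real"
  assumes "\<And>x. ((\<lambda>t. \<psi> (x + t *\<^sub>R e)) has_real_derivative \<psi>' x) (at 0)"
  shows "((\<lambda>t. \<psi> (x + t *\<^sub>R e)) has_real_derivative \<psi>' (x + t *\<^sub>R e)) (at t)"
proof -
  have "x + (s + t) *\<^sub>R e = (x + t *\<^sub>R e) + s *\<^sub>R e" for s by (simp add: algebra_simps)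
  then have "((\<lambda>s. \<psi> (x + (s + t) *\<^sub>R e)) has_real_derivative \<psi>' (x + t *\<^sub>R e)) (at 0)"
    using assms[of "x + t *\<^sub>R e"] by (simp only:)
  then show ?thesis using DERIV_shift[of "\<lambda>t. \<psi> (x + t *\<^sub>R e)" "\<psi>' (x + t *\<^sub>R e)" 0 t] by simp
qed

text \<open>By translation invariance every difference quotient integrates to zero. The bound
  \<open>M\<close> on the derivative bounds the quotients too, so dominated convergence passes to
  the limit.\<close>

lemma integral_directional_derivative_eq_0:
  fixes \<psi> \<psi>' :: "'a::euclidean_space \<Rightarrow> real"
  assumes [measurable]: "\<psi> \<in> borel_measurable borel" "\<psi>' \<in> borel_measurable borel"
    and d: "\<And>x. ((\<lambda>t. \<psi> (x + t *\<^sub>R e)) has_real_derivative \<psi>' x) (at 0)"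
    and bd: "\<And>x. \<bar>\<psi> x\<bar> \<le> M" "\<And>x. \<bar>\<psi>' x\<bar> \<le> M" and K: "compact K" "\<And>x. x \<notin> K \<Longrightarrow> \<psi> x = 0"
  shows "(\<integral>x. \<psi>' x \<partial>lborel) = 0"
proof -
  obtain R where R: "R > 0" "\<And>x. x \<in> K \<Longrightarrow> norm x \<le> R"
    using compact_imp_bounded[OF K(1)] by (auto simp: bounded_pos)
  have lip: "\<bar>\<psi> (x + t *\<^sub>R e) - \<psi> x\<bar> \<le> M * \<bar>t\<bar>" for x t
    using DERIV_bounded_imp_lipschitz[of "\<lambda>t. \<psi> (x + t *\<^sub>R e)" "\<lambda>t. \<psi>' (x + t *\<^sub>R e)" M t 0]
      directional_derivative_shift[OF d] bd(2) by simp
  \<comment> \<open>Steps of length at most one keep the supports of all difference quotients in a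
    single ball of radius \<open>R + norm e\<close>.\<close>
  let ?t = "\<lambda>n. inverse (real (Suc n))"
  let ?q = "\<lambda>n x. (\<psi> (x + ?t n *\<^sub>R e) - \<psi> x) / ?t n"
  have tpos: "?t n > 0" "?t n \<le> 1" for n by (auto simp: field_simps)
  have i: "integrable lborel \<psi>"
  proof (rule Bochner_Integration.integrable_bound)
    show "integrable lborel (\<lambda>x::'a. M * indicator (cball 0 R) x)"
      using emeasure_lborel_cball_finite by (intro integrable_mult_right integrable_real_indicator) auto
    show "AE x in lborel. norm (\<psi> x) \<le> norm (M * indicator (cball 0 R) x)"
    proof (rule AE_I2)
      fix x show "norm (\<psi> x) \<le> norm (M * indicator (cball 0 R) x)"
      proof (cases "x \<in> K")
        case True
        then have "indicator (cball 0 R) x = (1::real)" using R(2) by (simp add: indicator_def)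
        then show ?thesis using bd(1)[of x] by simp
      qed (simp add: K(2))
    qed
  qed simp
  have "(\<lambda>n. \<integral>x. ?q n x \<partial>lborel) \<longlonglongrightarrow> (\<integral>x. \<psi>' x \<partial>lborel)"
  proof (rule integral_dominated_convergence)
    show "integrable lborel (\<lambda>x::'a. M * indicator (cball 0 (R + norm e)) x)"
      using emeasure_lborel_cball_finite by (intro integrable_mult_right integrable_real_indicator) auto
    show "AE x in lborel. (\<lambda>n. ?q n x) \<longlonglongrightarrow> \<psi>' x"
    proof (rule AE_I2)
      fix x
      have "(\<lambda>h. (\<psi> (x + h *\<^sub>R e) - \<psi> x) / h) \<midarrow>0\<rightarrow> \<psi>' x"
        using d[of x] by (simp add: has_field_derivative_iff)
      moreover have "filterlim ?t (at 0) sequentially"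
        using LIMSEQ_inverse_real_of_nat tpos(1) by (simp add: filterlim_at)
      ultimately show "(\<lambda>n. ?q n x) \<longlonglongrightarrow> \<psi>' x" by (rule filterlim_compose)
    qed
    show "AE x in lborel. norm (?q n x) \<le> M * indicator (cball 0 (R + norm e)) x" for n
    proof (rule AE_I2)
      fix x
      show "norm (?q n x) \<le> M * indicator (cball 0 (R + norm e)) x"
      proof (cases "x \<in> cball 0 (R + norm e)")
        case True
        have "\<bar>?q n x\<bar> \<le> M" using lip[of x "?t n"] tpos(1)[of n] by (simp only: abs_divide pos_divide_le_eq abs_of_pos)
        then show ?thesis using True by (simp only: real_norm_def indicator_simps mult_1_right)
      next
        case False
        have "norm (?t n *\<^sub>R e) \<le> norm e" using tpos[of n] by (simp only: norm_scaleR abs_of_pos mult_left_le_one_le norm_ge_zero less_imp_le)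
        moreover have "norm x \<le> norm (x + ?t n *\<^sub>R e) + norm (?t n *\<^sub>R e)" using norm_triangle_ineq4[of "x + ?t n *\<^sub>R e" "?t n *\<^sub>R e"] by simp
        moreover have "norm x > R + norm e" using False by simp
        ultimately have "\<not> norm (x + ?t n *\<^sub>R e) \<le> R" "\<not> norm x \<le> R" using norm_ge_zero[of e] by linarith+
        then have "x + ?t n *\<^sub>R e \<notin> K" "x \<notin> K" using R(2) by blast+
        then show ?thesis using False K(2) by simp
      qed
    qed
  qed measurable
  moreover have "(\<integral>x. ?q n x \<partial>lborel) = 0" for n
  proof -
    have "(\<integral>x. ?q n x \<partial>lborel) = ((\<integral>x. \<psi> (x + ?t n *\<^sub>R e) \<partial>lborel) - (\<integral>x. \<psi> x \<partial>lborel)) / ?t n"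
      using lborel_integrable_shift[OF _ i, of "?t n *\<^sub>R e"] i by (simp del: of_nat_Suc)
    then show ?thesis using lborel_integral_shift[of \<psi> "?t n *\<^sub>R e"] by simp
  qed
  ultimately have "(\<lambda>n. 0) \<longlonglongrightarrow> (\<integral>x. \<psi>' x \<partial>lborel)" by (simp only:)
  then show ?thesis by (simp add: LIMSEQ_const_iff)
qed

lemma exp_bump_bounded_below: "\<exists>M>0. \<forall>t\<le>c. \<bar>exp_bump p t\<bar> \<le> M"
proof -
  obtain M where "M > 0" "\<forall>t\<in>{0..c}. \<bar>exp_bump p t\<bar> \<le> M" using exp_bump_bounded_Icc by blast
  then have "\<bar>exp_bump p t\<bar> \<le> M" if "t \<le> c" for t using that exp_bump_zero[of t p] by (cases "t \<le> 0") auto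
  with \<open>M > 0\<close> show ?thesis by blast
qed

lemma exp_bump_lipschitz_below: "\<exists>L>0. \<forall>s\<le>c. \<forall>t\<le>c. \<bar>exp_bump p s - exp_bump p t\<bar> \<le> L * \<bar>s - t\<bar>"
proof -
  obtain L where L: "L > 0" "\<And>t. t \<le> c \<Longrightarrow> \<bar>exp_bump (bump_deriv p) t\<bar> \<le> L" using exp_bump_bounded_below by blast
  have "\<bar>exp_bump p s - exp_bump p t\<bar> \<le> L * \<bar>s - t\<bar>" if "s \<le> c" "t \<le> c" for s t
    using field_differentiable_bound[of "{..c}" "exp_bump p" "exp_bump (bump_deriv p)" L s t] L(2) that
    by (auto intro!: exp_bump_DERIV[THEN has_field_derivative_at_within])
  with L(1) show ?thesis by blast
qed

lemma abs_mult_le_scaled_squares: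
  fixes x y s :: real
  assumes "s > 0"
  shows "\<bar>x * y\<bar> \<le> s * x\<^sup>2 + y\<^sup>2 / s"
proof -
  have "0 \<le> (s * \<bar>x\<bar> - \<bar>y\<bar>)\<^sup>2" by simp
  then have "2 * (s * (\<bar>x\<bar> * \<bar>y\<bar>)) \<le> s * (s * x\<^sup>2) + y\<^sup>2" by (simp add: power2_eq_square algebra_simps)
  moreover have "0 \<le> s * (\<bar>x\<bar> * \<bar>y\<bar>)" using assms by simp
  ultimately have "s * (\<bar>x\<bar> * \<bar>y\<bar>) \<le> s * (s * x\<^sup>2) + y\<^sup>2" by linarith
  then have "\<bar>x\<bar> * \<bar>y\<bar> \<le> (s * (s * x\<^sup>2) + y\<^sup>2) / s" using assms by (simp add: pos_le_divide_eq mult.commute)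
  also have "\<dots> = s * x\<^sup>2 + y\<^sup>2 / s" using assms by (simp add: add_divide_distrib)
  finally show ?thesis by (simp add: abs_mult)
qed

text \<open>Young's inequality with a small weight: the given factors are charged \<open>s\<close>
  and their disturbances \<open>1 / s\<close>. If the squared disturbances are of order
  \<open>s^2\<close>, everything is of order \<open>s\<close>.\<close>

lemma product_difference_bound:
  fixes x y x' y' s :: real
  assumes "s > 0"
  shows "\<bar>x * y - x' * y'\<bar> \<le> s * (x\<^sup>2 + y\<^sup>2) + (1 / s + 1) * ((x' - x)\<^sup>2 + (y' - y)\<^sup>2)"
proof -
  have "x * y - x' * y' = - (x * (y' - y)) - y * (x' - x) - (x' - x) * (y' - y)" by (simp add: algebra_simps)
  then have "\<bar>x * y - x' * y'\<bar> \<le> \<bar>x * (y' - y)\<bar> + \<bar>y * (x' - x)\<bar> + \<bar>(x' - x) * (y' - y)\<bar>" by linarith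
  also have "\<dots> \<le> (s * x\<^sup>2 + (y' - y)\<^sup>2 / s) + (s * y\<^sup>2 + (x' - x)\<^sup>2 / s) + (1 * (x' - x)\<^sup>2 + (y' - y)\<^sup>2 / 1)"
    by (intro add_mono abs_mult_le_scaled_squares assms) simp
  also have "\<dots> = s * (x\<^sup>2 + y\<^sup>2) + (1 / s + 1) * ((x' - x)\<^sup>2 + (y' - y)\<^sup>2)"
    by (simp add: algebra_simps add_divide_distrib)
  finally show ?thesis .
qed

text \<open>For smooth \<open>p\<close> and \<open>q\<close> with \<open>p < M\<close> on the frontier of \<open>K\<close>, the integrand is the divergence
  of \<open>bump (p - M) (\<partial>\<^sub>2 q, - \<partial>\<^sub>1 q)\<close> cut off outside \<open>K\<close>.\<close>

lemma smooth_jacobian_integral_eq_0: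
  fixes p q C :: "real^2 \<Rightarrow> real" and P Q :: "real^2 \<Rightarrow> real^2"
  assumes K: "compact K" and fr: "\<And>x. x \<in> frontier K \<Longrightarrow> p x < M"
    and cont: "continuous_on UNIV p" "\<And>j. continuous_on UNIV (\<lambda>x. P x $ j)" "\<And>j. continuous_on UNIV (\<lambda>x. Q x $ j)" "continuous_on UNIV C"
    and p: "\<And>x j. ((\<lambda>t. p (x + t *\<^sub>R axis j 1)) has_real_derivative P x $ j) (at 0)"
    and C: "\<And>x. ((\<lambda>t. Q (x + t *\<^sub>R axis 1 1) $ 2) has_real_derivative C x) (at 0)"
      "\<And>x. ((\<lambda>t. Q (x + t *\<^sub>R axis 2 1) $ 1) has_real_derivative C x) (at 0)"
  shows "(\<integral>x. indicator K x * (exp_bump (bump_deriv 1) (p x - M) * (P x $ 1 * Q x $ 2 - P x $ 2 * Q x $ 1)) \<partial>lborel) = 0"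
    "integrable lborel (\<lambda>x. indicator K x * (exp_bump (bump_deriv 1) (p x - M) * (P x $ 1 * Q x $ 2 - P x $ 2 * Q x $ 1)))"
proof -
  let ?f' = "exp_bump (bump_deriv 1)"
  have [measurable]: "p \<in> borel_measurable borel" "(\<lambda>x. P x $ j) \<in> borel_measurable borel"
    "(\<lambda>x. Q x $ j) \<in> borel_measurable borel" "C \<in> borel_measurable borel"
    "bump \<in> borel_measurable borel" "?f' \<in> borel_measurable borel" "K \<in> sets borel" for j
    using cont K by (auto intro!: borel_measurable_continuous_onI continuous_on_exp_bump borel_compact continuous_on_id)
  define w where "w = (\<lambda>x. indicator K x * bump (p x - M))"
  define w' where "w' = (\<lambda>j x. indicator K x * (?f' (p x - M) * P x $ j))"
  have [measurable]: "w \<in> borel_measurable borel" "w' j \<in> borel_measurable borel" for j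
    unfolding w_def w'_def by measurable
  have wd: "((\<lambda>t. w (x + t *\<^sub>R axis j 1)) has_real_derivative w' j x) (at 0)" for x j
  proof -
    let ?l = "\<lambda>t. x + t *\<^sub>R axis j 1"
    have lc: "continuous_on UNIV ?l" by (intro continuous_intros)
    show ?thesis
    proof (cases "x \<in> interior K")
      case True
      have "((\<lambda>t. bump (p (?l t) - M)) has_real_derivative ?f' (p x - M) * P x $ j) (at 0)"
        using DERIV_chain2[OF exp_bump_DERIV[of 1] DERIV_diff[OF p DERIV_const]] by simp
      then have 1: "((\<lambda>t. bump (p (?l t) - M)) has_real_derivative w' j x) (at 0)"
        using True interior_subset[of K] by (auto simp: w'_def)
      show ?thesis
      proof (rule has_field_derivative_transform_within_open[OF 1])
        show "open (?l -` interior K)" by (rule open_vimage[OF open_interior lc])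
        show "0 \<in> ?l -` interior K" using True by simp
        show "bump (p (?l t) - M) = w (?l t)" if "t \<in> ?l -` interior K" for t
          using that interior_subset[of K] by (auto simp: w_def)
      qed
    next
      case False
      \<comment> \<open>Off the interior, \<open>x\<close> is outside \<open>K\<close> or on its
        frontier, where \<open>p < M\<close>. In a whole neighbourhood one of the two factors of
        \<open>w\<close> is therefore zero at each point, and cutting off at \<open>K\<close>
        creates no jump.\<close>
      have o: "open (- K \<union> {y. p y < M})"
        using cont(1) K by (intro open_Un open_Compl compact_imp_closed open_Collect_less continuous_intros) auto
      have x: "x \<in> - K \<union> {y. p y < M}" using False fr[of x] closure_closed[OF compact_imp_closed[OF K]] by (auto simp: frontier_def)
      have 0: "w' j x = 0" using x by (auto simp: w'_def exp_bump_zero)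
      have 1: "((\<lambda>t. 0) has_real_derivative w' j x) (at 0)" unfolding 0 by (rule DERIV_const)
      show ?thesis
      proof (rule has_field_derivative_transform_within_open[OF 1])
        show "open (?l -` (- K \<union> {y. p y < M}))" by (rule open_vimage[OF o lc])
        show "0 \<in> ?l -` (- K \<union> {y. p y < M})" using x by simp
        show "0 = w (?l t)" if "t \<in> ?l -` (- K \<union> {y. p y < M})" for t
          using that by (auto simp: w_def exp_bump_zero)
      qed
    qed
  qed
  have bdK: "\<exists>c. \<forall>x. \<bar>indicator K x * g x\<bar> \<le> c" if "continuous_on UNIV g" for g :: "real^2 \<Rightarrow> real"
  proof -
    have "bounded (g ` K)" using that K by (intro compact_imp_bounded compact_continuous_image) (auto intro: continuous_on_subset)
    then obtain c where c: "c > 0" "\<And>x. x \<in> K \<Longrightarrow> \<bar>g x\<bar> \<le> c" by (auto simp: bounded_pos)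
    then have "\<bar>indicator K x * g x\<bar> \<le> c" for x by (cases "x \<in> K") auto
    then show ?thesis by blast
  qed
  have int: "integrable lborel (\<lambda>x. indicator K x * g x)" if g: "continuous_on UNIV g" for g :: "real^2 \<Rightarrow> real"
  proof -
    obtain c where c: "\<And>x. \<bar>indicator K x * g x\<bar> \<le> c" using bdK[OF g] by blast
    have [measurable]: "g \<in> borel_measurable borel" using g by (rule borel_measurable_continuous_onI)
    have "integrable lborel (\<lambda>x. indicator K x * (indicator K x * g x))"
    proof (rule integrable_mult_bounded[OF _ _ c])
      show "integrable lborel (indicator K :: real^2 \<Rightarrow> real)"
        using emeasure_compact_finite[OF K] by (intro integrable_real_indicator) auto
    qed measurable
    then show ?thesis by (simp add: mult.assoc[symmetric] indicator_inter_arith[symmetric])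
  qed
  have zero: "(\<integral>x. indicator K x * (?f' (p x - M) * P x $ j * Q x $ i + bump (p x - M) * C x) \<partial>lborel) = 0"
    if Cd: "\<And>x. ((\<lambda>t. Q (x + t *\<^sub>R axis j 1) $ i) has_real_derivative C x) (at 0)" for i j
  proof -
    have c: "continuous_on UNIV (\<lambda>x. bump (p x - M) * Q x $ i)"
      "continuous_on UNIV (\<lambda>x. ?f' (p x - M) * P x $ j * Q x $ i + bump (p x - M) * C x)"
      by (intro continuous_intros cont)+
    obtain c1 where c1: "\<And>x. \<bar>indicator K x * (bump (p x - M) * Q x $ i)\<bar> \<le> c1" using bdK[OF c(1)] by blast
    obtain c2 where c2: "\<And>x. \<bar>indicator K x * (?f' (p x - M) * P x $ j * Q x $ i + bump (p x - M) * C x)\<bar> \<le> c2" using bdK[OF c(2)] by blast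
    show ?thesis
    proof (rule integral_directional_derivative_eq_0[where \<psi> = "\<lambda>x. w x * Q x $ i" and e = "axis j 1" and M = "max c1 c2" and K = K])
      show "((\<lambda>t. w (x + t *\<^sub>R axis j 1) * Q (x + t *\<^sub>R axis j 1) $ i) has_real_derivative
          indicator K x * (?f' (p x - M) * P x $ j * Q x $ i + bump (p x - M) * C x)) (at 0)" for x
        by (rule DERIV_cong[OF DERIV_mult[OF wd Cd]]) (simp add: w_def w'_def algebra_simps)
      show "\<bar>w x * Q x $ i\<bar> \<le> max c1 c2" for x using c1[of x] by (simp add: w_def mult.assoc le_max_iff_disj)
      show "\<bar>indicator K x * (?f' (p x - M) * P x $ j * Q x $ i + bump (p x - M) * C x)\<bar> \<le> max c1 c2" for x
        using c2[of x] by (simp add: le_max_iff_disj)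
      show "w x * Q x $ i = 0" if "x \<notin> K" for x using that by (simp add: w_def)
    qed (use K in \<open>measurable\<close>)
  qed
  have i: "integrable lborel (\<lambda>x. indicator K x * (?f' (p x - M) * P x $ j * Q x $ i + bump (p x - M) * C x))" for i j
    by (intro int continuous_intros cont)
  \<comment> \<open>Both expressions contain the same term with the mixed derivative
    \<open>C\<close>; it cancels in the difference.\<close>
  have eq: "indicator K x * (?f' (p x - M) * (P x $ 1 * Q x $ 2 - P x $ 2 * Q x $ 1))
     = indicator K x * (?f' (p x - M) * P x $ 1 * Q x $ 2 + bump (p x - M) * C x)
       - indicator K x * (?f' (p x - M) * P x $ 2 * Q x $ 1 + bump (p x - M) * C x)" for x
    by (simp add: algebra_simps)
  show "integrable lborel (\<lambda>x. indicator K x * (?f' (p x - M) * (P x $ 1 * Q x $ 2 - P x $ 2 * Q x $ 1)))"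
    unfolding eq using i by simp
  show "(\<integral>x. indicator K x * (?f' (p x - M) * (P x $ 1 * Q x $ 2 - P x $ 2 * Q x $ 1)) \<partial>lborel) = 0"
    unfolding eq using i zero[OF C(1)] zero[OF C(2)] by simp
qed

text \<open>If \<open>a\<close> exceeded some \<open>M > m\<close>, the integral over
  \<open>K\<close> of \<open>?f' (a - M)\<close> times the Jacobian of \<open>a\<close> and
  \<open>v\<close> would be positive, as both factors are nonnegative and positive where
  \<open>a > M\<close>. But the integral is zero for smooth approximants that stay below
  \<open>M\<close> on the frontier, and it depends continuously on them. Apart from the frontier
  bound, only the sign of the Jacobian is used.\<close>

lemma maximum_principle:
  assumes \<Omega>: "open \<Omega>" and a: "scalar_wgrad \<Omega> a A" "continuous_on \<Omega> a" and v: "scalar_wgrad \<Omega> v V" "continuous_on \<Omega> v"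
    and pos: "AE x in lborel. x \<in> \<Omega> \<longrightarrow> A x $ 1 * V x $ 2 - A x $ 2 * V x $ 1 > 0"
    and K: "compact K" "K \<subseteq> \<Omega>" and fr: "\<And>x. x \<in> frontier K \<Longrightarrow> a x \<le> m" and x0: "x0 \<in> K"
  shows "a x0 \<le> m"
proof (rule ccontr)
  assume "\<not> a x0 \<le> m"
  \<comment> \<open>Strictly between the two levels: approximants within \<open>(M - m) / 2\<close>
    of \<open>a\<close> still lie below \<open>M\<close> on the frontier, while \<open>x0\<close>
    lies above \<open>M\<close>.\<close>
  define M where "M = (m + a x0) / 2"
  have M: "m < M" "M < a x0" using \<open>\<not> a x0 \<le> m\<close> by (auto simp: M_def)
  let ?f' = "exp_bump (bump_deriv 1)"
  let ?D = "\<lambda>x. A x $ 1 * V x $ 2 - A x $ 2 * V x $ 1"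
  note [measurable] = scalar_wgradD(2,4)[OF a(1)] scalar_wgradD(2,4)[OF v(1)]
  have [measurable]: "?f' \<in> borel_measurable borel" "K \<in> sets borel"
    using K by (auto intro!: borel_measurable_continuous_onI continuous_on_exp_bump borel_compact continuous_on_id)
  have "bounded (a ` K)" using K a(2) by (intro compact_imp_bounded compact_continuous_image) (auto intro: continuous_on_subset)
  then obtain c0 where c0: "\<And>x. x \<in> K \<Longrightarrow> \<bar>a x\<bar> \<le> c0" by (auto simp: bounded_iff)
  \<comment> \<open>A common upper bound for \<open>a - M\<close> and \<open>p - M\<close> on
    \<open>K\<close>, since the approximant \<open>p\<close> will be within one of
    \<open>a\<close>.\<close>
  define c where "c = c0 + 1 - M"
  obtain B where B: "B > 0" "\<And>t. t \<le> c \<Longrightarrow> \<bar>?f' t\<bar> \<le> B" using exp_bump_bounded_below[of c "bump_deriv 1"] by blast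
  obtain L where L: "L > 0" "\<And>s t. s \<le> c \<Longrightarrow> t \<le> c \<Longrightarrow> \<bar>?f' s - ?f' t\<bar> \<le> L * \<bar>s - t\<bar>" using exp_bump_lipschitz_below[of c "bump_deriv 1"] by blast
  define N where "N = (\<lambda>x. (A x $ 1)\<^sup>2 + (V x $ 2)\<^sup>2 + (A x $ 2)\<^sup>2 + (V x $ 1)\<^sup>2)"
  have N0: "N x \<ge> 0" for x by (simp add: N_def)
  have iN: "integrable lborel N" unfolding N_def
    by (intro Bochner_Integration.integrable_add scalar_wgradD(6)[OF a(1)] scalar_wgradD(6)[OF v(1)])
  have [measurable]: "N \<in> borel_measurable borel" unfolding N_def by measurable
  have DN: "\<bar>?D x\<bar> \<le> N x" for x
    using abs_mult_le_scaled_squares[of 1 "A x $ 1" "V x $ 2"] abs_mult_le_scaled_squares[of 1 "A x $ 2" "V x $ 1"]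
    by (simp add: N_def)
  let ?g = "\<lambda>x. indicator K x * (?f' (a x - M) * ?D x)"
  have gN: "\<bar>?g x\<bar> \<le> B * N x" for x
  proof (cases "x \<in> K")
    case True
    have "\<bar>?f' (a x - M)\<bar> \<le> B" using c0[OF True] by (intro B) (simp add: c_def)
    then show ?thesis using True DN[of x] B(1) by (simp add: abs_mult mult_mono)
  qed (use B N0[of x] in simp)
  have ig: "integrable lborel ?g"
  proof (rule Bochner_Integration.integrable_bound)
    show "integrable lborel (\<lambda>x. B * N x)" using iN by simp
    show "AE x in lborel. norm (?g x) \<le> norm (B * N x)" using gN by (auto intro!: AE_I2 order_trans[OF _ abs_ge_self])
  qed measurable
  \<comment> \<open>The three error terms, divided by \<open>s\<close>: the change of
    \<open>?f'\<close>, the change of the Jacobian charged to the gradients of \<open>a\<close> and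
    \<open>v\<close>, and four squared gradient errors of size \<open>s^2\<close>, which contribute
    \<open>4 * s + 4 * s^2 \<le> 8 * s\<close> times \<open>B\<close>.\<close>
  define Z where "Z = L * (\<integral>x. N x \<partial>lborel) + B * (\<integral>x. N x \<partial>lborel) + 8 * B"
  have small: "\<bar>\<integral>x. ?g x \<partial>lborel\<bar> \<le> s * Z" if s: "0 < s" "s \<le> 1" "s \<le> (M - m) / 2" for s
  proof -
    have ss: "s\<^sup>2 > 0" "s\<^sup>2 \<le> s" using s by (auto simp: power2_eq_square mult_left_le_one_le)
    obtain p P where p: "continuous_on UNIV p" "\<And>j. continuous_on UNIV (\<lambda>x. P x $ j)"
      "\<And>x j. ((\<lambda>t. p (x + t *\<^sub>R axis j 1)) has_real_derivative P x $ j) (at 0)"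
      "\<And>x. x \<in> K \<Longrightarrow> \<bar>p x - a x\<bar> \<le> s\<^sup>2"
      "\<And>j. (\<integral>\<^sup>+x\<in>K. ennreal ((P x $ j - A x $ j)\<^sup>2) \<partial>lborel) \<le> ennreal (s\<^sup>2)"
      by (rule smooth_approximation[OF \<Omega> a K ss(1)]) (rule that)
    obtain Q C where q: "\<And>j. continuous_on UNIV (\<lambda>x. Q x $ j)" "continuous_on UNIV C"
      "\<And>x. ((\<lambda>t. Q (x + t *\<^sub>R axis 1 1) $ 2) has_real_derivative C x) (at 0)"
      "\<And>x. ((\<lambda>t. Q (x + t *\<^sub>R axis 2 1) $ 1) has_real_derivative C x) (at 0)"
      "\<And>j. (\<integral>\<^sup>+x\<in>K. ennreal ((Q x $ j - V x $ j)\<^sup>2) \<partial>lborel) \<le> ennreal (s\<^sup>2)"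
      by (rule smooth_approximation[OF \<Omega> v K ss(1)]) (rule that)
    have [measurable]: "(\<lambda>x. P x $ j) \<in> borel_measurable borel" "(\<lambda>x. Q x $ j) \<in> borel_measurable borel"
      "p \<in> borel_measurable borel" for j
      using p q by (auto intro!: borel_measurable_continuous_onI)
    have "frontier K \<subseteq> K" using K(1) by (simp add: compact_imp_closed frontier_subset_closed)
    then have frp: "p x < M" if "x \<in> frontier K" for x
      using p(4)[of x] fr[OF that] that ss(2) s(3) M(1) by (auto simp: abs_le_iff field_simps)
    let ?h = "\<lambda>x. indicator K x * (?f' (p x - M) * (P x $ 1 * Q x $ 2 - P x $ 2 * Q x $ 1))"
    note h = smooth_jacobian_integral_eq_0[OF K(1) frp p(1,2) q(1,2) p(3) q(3,4)]
    let ?E = "\<lambda>x. indicator K x * ((P x $ 1 - A x $ 1)\<^sup>2 + (Q x $ 2 - V x $ 2)\<^sup>2 + (P x $ 2 - A x $ 2)\<^sup>2 + (Q x $ 1 - V x $ 1)\<^sup>2)"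
    have iE1: "integrable lborel (\<lambda>x. indicator K x * (R x $ j - G x $ j)\<^sup>2)"
         "(\<integral>x. indicator K x * (R x $ j - G x $ j)\<^sup>2 \<partial>lborel) \<le> s\<^sup>2"
      if b: "(\<integral>\<^sup>+x\<in>K. ennreal ((R x $ j - G x $ j)\<^sup>2) \<partial>lborel) \<le> ennreal (s\<^sup>2)"
       and [measurable]: "(\<lambda>x. R x $ j) \<in> borel_measurable borel" "(\<lambda>x. G x $ j) \<in> borel_measurable borel"
      for R G :: "real^2 \<Rightarrow> real^2" and j
    proof -
      have eq: "(\<integral>\<^sup>+x. ennreal (indicator K x * (R x $ j - G x $ j)\<^sup>2) \<partial>lborel) = (\<integral>\<^sup>+x\<in>K. ennreal ((R x $ j - G x $ j)\<^sup>2) \<partial>lborel)"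
        by (intro nn_integral_cong) (auto simp: indicator_def)
      show i: "integrable lborel (\<lambda>x. indicator K x * (R x $ j - G x $ j)\<^sup>2)"
        using b by (intro integrableI_nonneg) (auto simp: eq intro: le_less_trans)
      have "ennreal (\<integral>x. indicator K x * (R x $ j - G x $ j)\<^sup>2 \<partial>lborel) \<le> ennreal (s\<^sup>2)"
        using b by (subst nn_integral_eq_integral[OF i, symmetric]) (auto simp: eq)
      then show "(\<integral>x. indicator K x * (R x $ j - G x $ j)\<^sup>2 \<partial>lborel) \<le> s\<^sup>2" by (subst (asm) ennreal_le_iff) auto
    qed
    note ip = iE1[OF p(5)] and iq = iE1[OF q(5)]
    have iE: "integrable lborel ?E" and E4: "(\<integral>x. ?E x \<partial>lborel) \<le> 4 * s\<^sup>2"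
      using ip(1)[of 1] ip(1)[of 2] iq(1)[of 1] iq(1)[of 2] ip(2)[of 1] ip(2)[of 2] iq(2)[of 1] iq(2)[of 2]
      by (simp_all add: distrib_left)
    have pw: "\<bar>?g x - ?h x\<bar> \<le> L * s * N x + B * (s * N x + (1 / s + 1) * ?E x)" for x
    proof (cases "x \<in> K")
      case True
      have c: "a x - M \<le> c" "p x - M \<le> c" using c0[OF True] p(4)[OF True] ss(2) s(2) by (auto simp: c_def)
      let ?D' = "P x $ 1 * Q x $ 2 - P x $ 2 * Q x $ 1"
      have eq: "?f' (a x - M) * ?D x - ?f' (p x - M) * ?D' = (?f' (a x - M) - ?f' (p x - M)) * ?D x + ?f' (p x - M) * (?D x - ?D')"
        by (simp add: algebra_simps)
      have "\<bar>?f' (a x - M) * ?D x - ?f' (p x - M) * ?D'\<bar> \<le> \<bar>?f' (a x - M) - ?f' (p x - M)\<bar> * \<bar>?D x\<bar> + \<bar>?f' (p x - M)\<bar> * \<bar>?D x - ?D'\<bar>"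
        unfolding eq abs_mult[symmetric] by (rule abs_triangle_ineq)
      also have "\<dots> \<le> (L * s) * N x + B * (s * N x + (1 / s + 1) * ?E x)"
      proof -
        have "\<bar>?f' (a x - M) - ?f' (p x - M)\<bar> \<le> L * \<bar>(a x - M) - (p x - M)\<bar>" by (rule L(2)[OF c])
        also have "\<dots> \<le> L * s" using p(4)[OF True] ss(2) L(1) by (intro mult_left_mono) auto
        finally have 1: "\<bar>?f' (a x - M) - ?f' (p x - M)\<bar> \<le> L * s" .
        have 2: "\<bar>?f' (p x - M)\<bar> \<le> B" by (rule B(2)[OF c(2)])
        have "\<bar>?D x - ?D'\<bar> \<le> \<bar>A x $ 1 * V x $ 2 - P x $ 1 * Q x $ 2\<bar> + \<bar>A x $ 2 * V x $ 1 - P x $ 2 * Q x $ 1\<bar>" by linarith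
        also have "\<dots> \<le> (s * ((A x $ 1)\<^sup>2 + (V x $ 2)\<^sup>2) + (1 / s + 1) * ((P x $ 1 - A x $ 1)\<^sup>2 + (Q x $ 2 - V x $ 2)\<^sup>2))
           + (s * ((A x $ 2)\<^sup>2 + (V x $ 1)\<^sup>2) + (1 / s + 1) * ((P x $ 2 - A x $ 2)\<^sup>2 + (Q x $ 1 - V x $ 1)\<^sup>2))"
          by (rule add_mono[OF product_difference_bound[OF s(1)] product_difference_bound[OF s(1)]])
        also have "\<dots> = s * N x + (1 / s + 1) * ?E x"
          unfolding N_def indicator_simps(1)[OF True] mult_1_left distrib_left[of s] distrib_left[of "1 / s + 1"] by simp
        finally have 3: "\<bar>?D x - ?D'\<bar> \<le> s * N x + (1 / s + 1) * ?E x" .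
        have "L * s \<ge> 0" using L(1) s(1) by simp
        show ?thesis
          by (rule add_mono[OF mult_mono[OF 1 DN] mult_mono[OF 2 3]]) (use \<open>L * s \<ge> 0\<close> B(1) in auto)
      qed
      finally show ?thesis using True by simp
    qed (use L B s N0[of x] in auto)
    define EE where "EE = ?E"
    have iEE: "integrable lborel EE" and EE4: "(\<integral>x. EE x \<partial>lborel) \<le> 4 * s\<^sup>2"
      using iE E4 by (simp_all only: EE_def)
    have pw': "\<bar>?g x - ?h x\<bar> \<le> L * s * N x + B * (s * N x + (1 / s + 1) * EE x)" for x
      using pw[of x] by (simp only: EE_def)
    have eq: "(\<integral>x. ?g x \<partial>lborel) = (\<integral>x. ?g x - ?h x \<partial>lborel)" using ig h by simp
    have "\<bar>\<integral>x. ?g x \<partial>lborel\<bar> \<le> (\<integral>x. L * s * N x + B * (s * N x + (1 / s + 1) * EE x) \<partial>lborel)"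
      unfolding eq
      by (rule integral_abs_bound_integral[OF Bochner_Integration.integrable_diff[OF ig h(2)] _ pw'])
        (assumption, intro Bochner_Integration.integrable_add integrable_mult_right iN iEE)
    also have "\<dots> = L * s * (\<integral>x. N x \<partial>lborel) + B * (s * (\<integral>x. N x \<partial>lborel) + (1 / s + 1) * (\<integral>x. EE x \<partial>lborel))"
      using iN iEE by simp
    also have "\<dots> \<le> L * s * (\<integral>x. N x \<partial>lborel) + B * (s * (\<integral>x. N x \<partial>lborel) + (1 / s + 1) * (4 * s\<^sup>2))"
      using EE4 B(1) s(1) by (intro add_left_mono mult_left_mono) auto
    also have "(1 / s + 1) * (4 * s\<^sup>2) = 4 * s + 4 * s\<^sup>2" using s(1) by (simp add: power2_eq_square field_simps)
    also have "L * s * (\<integral>x. N x \<partial>lborel) + B * (s * (\<integral>x. N x \<partial>lborel) + (4 * s + 4 * s\<^sup>2))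
        \<le> L * s * (\<integral>x. N x \<partial>lborel) + B * (s * (\<integral>x. N x \<partial>lborel) + (4 * s + 4 * s))"
      using ss(2) B(1) by (intro add_left_mono mult_left_mono) auto
    also have "\<dots> = s * Z" by (simp add: Z_def algebra_simps)
    finally show ?thesis .
  qed
  have nnK: "AE x in lborel. 0 \<le> ?g x"
    using pos by eventually_elim (use K(2) in \<open>auto simp: indicator_def exp_bump_bump_deriv_1_nonneg\<close>)
  have "Z \<ge> 0" unfolding Z_def using L(1) B(1) N0 by simp
  have "\<bar>\<integral>x. ?g x \<partial>lborel\<bar> \<le> 0"
  proof (rule field_le_epsilon)
    fix e :: real assume e: "0 < e"
    define s where "s = min (min 1 ((M - m) / 2)) (e / (Z + 1))"
    have s: "0 < s" "s \<le> 1" "s \<le> (M - m) / 2" "s \<le> e / (Z + 1)" using e M \<open>Z \<ge> 0\<close>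
      unfolding s_def by (simp, simp, blast intro: min.cobounded1 min.cobounded2 order_trans, blast intro: min.cobounded2)
    have "s * Z \<le> e / (Z + 1) * Z" using s(4) \<open>Z \<ge> 0\<close> by (rule mult_right_mono)
    also have "\<dots> \<le> e" using e \<open>Z \<ge> 0\<close> by (simp add: field_simps)
    finally show "\<bar>\<integral>x. ?g x \<partial>lborel\<bar> \<le> 0 + e" using small[OF s(1-3)] by simp
  qed
  then have "(\<integral>x. ?g x \<partial>lborel) = 0" by simp
  then have g0: "AE x in lborel. ?g x = 0" using integral_nonneg_eq_0_iff_AE[OF ig nnK] by simp
  let ?U = "interior K \<inter> a -` {M<..}"
  have "continuous_on (interior K) a" using a(2) K(2) interior_subset[of K] continuous_on_subset by blast
  then have "open ?U" by (intro continuous_open_preimage open_interior open_greaterThan)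
  moreover have "AE x in lborel. x \<notin> ?U"
    using pos g0
  proof eventually_elim
    case (elim x)
    show "x \<notin> ?U"
    proof
      assume x: "x \<in> ?U"
      then have "x \<in> K" using interior_subset by blast
      then have "?D x > 0" "?f' (a x - M) * ?D x = 0" using elim K(2) by auto
      moreover have "?f' (a x - M) > 0" using x by (simp add: exp_bump_def bump_deriv_def)
      ultimately show False by simp
    qed
  qed
  then have "AE x in lebesgue. x \<notin> ?U" unfolding AE_completion_iff .
  \<comment> \<open>A closed set that contains almost every point of an open set contains all of it.
    Here the closed set is empty, while \<open>x0\<close> lies in the open set.\<close>
  then have "AE x \<in> ?U in lebesgue. x \<in> {}" by eventually_elim auto
  ultimately have "x0 \<in> {}" if "x0 \<in> ?U" using mem_closed_if_AE_lebesgue_open[of ?U "{}" x0] that by auto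
  moreover have "x0 \<in> ?U"
    using x0 M fr[of x0] closure_subset[of K] by (auto simp: frontier_def)
  ultimately show False by blast
qed

subsection \<open>Oscillation on squares\<close>

text \<open>The Cauchy-Schwarz inequality for the fundamental theorem of calculus, obtained from the
  nonnegative integral of \<open>(g - m)^2\<close> with the mean slope \<open>m\<close>.\<close>

lemma increment_square_le_nn_integral:
  fixes f g :: "real \<Rightarrow> real"
  assumes f: "\<And>t. (f has_real_derivative g t) (at t)" and g: "continuous_on UNIV g" and ab: "a < b"
  shows "ennreal ((f b - f a)\<^sup>2) \<le> ennreal (b - a) * (\<integral>\<^sup>+t\<in>{a..b}. ennreal ((g t)\<^sup>2) \<partial>lborel)"
proof -
  have [measurable]: "g \<in> borel_measurable borel" using g by (rule borel_measurable_continuous_onI)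
  have I1: "(g has_integral (f b - f a)) {a..b}"
    using ab f by (intro fundamental_theorem_of_calculus) (auto simp: has_real_derivative_iff_has_vector_derivative[symmetric] intro: has_field_derivative_at_within)
  have "(\<lambda>t. (g t)\<^sup>2) integrable_on {a..b}"
    using g by (intro integrable_continuous_real continuous_intros) (auto intro: continuous_on_subset)
  then obtain I where I2: "((\<lambda>t. (g t)\<^sup>2) has_integral I) {a..b}" by blast
  define m where "m = (f b - f a) / (b - a)"
  have "((\<lambda>t. (g t)\<^sup>2 - 2 * m * g t + m\<^sup>2) has_integral (I - 2 * m * (f b - f a) + (b - a) * m\<^sup>2)) {a..b}"
    using has_integral_const_real[of "m\<^sup>2" a b] ab
    by (intro has_integral_add has_integral_diff has_integral_mult_right I1 I2) auto
  moreover have "(g t)\<^sup>2 - 2 * m * g t + m\<^sup>2 = (g t - m)\<^sup>2" for t by (simp add: power2_eq_square algebra_simps)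
  ultimately have "0 \<le> I - 2 * m * (f b - f a) + (b - a) * m\<^sup>2"
    by (metis (no_types, lifting) has_integral_nonneg zero_le_power2)
  moreover have "m * (b - a) = f b - f a" using ab by (simp add: m_def)
  then have "(b - a) * m\<^sup>2 = m * (f b - f a)" by (simp add: power2_eq_square mult_ac)
  ultimately have "m * (f b - f a) \<le> I" by (simp add: algebra_simps)
  then have le: "(f b - f a)\<^sup>2 \<le> (b - a) * I" using ab by (simp add: m_def field_simps power2_eq_square)
  have "(\<integral>\<^sup>+t. ennreal (indicator {a..b} t * (g t)\<^sup>2) \<partial>lborel) = ennreal I"
  proof (rule nn_integral_has_integral_lborel)
    have "(\<lambda>t. indicator {a..b} t * (g t)\<^sup>2) = (\<lambda>t. if t \<in> {a..b} then (g t)\<^sup>2 else 0)" by (auto simp: fun_eq_iff indicator_def)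
    then show "((\<lambda>t. indicator {a..b} t * (g t)\<^sup>2) has_integral I) UNIV"
      using I2 by (simp only: has_integral_restrict_UNIV)
  qed auto
  also have "(\<integral>\<^sup>+t. ennreal (indicator {a..b} t * (g t)\<^sup>2) \<partial>lborel) = (\<integral>\<^sup>+t\<in>{a..b}. ennreal ((g t)\<^sup>2) \<partial>lborel)"
    by (intro nn_integral_cong) (auto simp: indicator_def)
  finally show ?thesis using le ab by (simp add: ennreal_mult'[symmetric] ennreal_leI)
qed

text \<open>The line energies average to less than \<open>J / (b - a)\<close>, so some line does no
  worse, and on it increments are controlled by length times energy. Strictness of the hypothesis is
  what yields the contradiction.\<close>

lemma good_line_exists:
  fixes f g :: "real \<Rightarrow> real \<Rightarrow> real"
  assumes f: "\<And>s t. (f s has_real_derivative g s t) (at t)" and g: "\<And>s. continuous_on UNIV (g s)"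
    and ab: "a < b" and cd: "c < d" and J: "J > 0"
    and le: "(\<integral>\<^sup>+s\<in>{a..b}. (\<integral>\<^sup>+t\<in>{c..d}. ennreal ((g s t)\<^sup>2) \<partial>lborel) \<partial>lborel) < ennreal J"
  obtains s where "s \<in> {a..b}" "\<And>t t'. t \<in> {c..d} \<Longrightarrow> t' \<in> {c..d} \<Longrightarrow> \<bar>f s t - f s t'\<bar> \<le> sqrt ((d - c) / (b - a) * J)"
proof -
  let ?i = "\<lambda>s. \<integral>\<^sup>+t\<in>{c..d}. ennreal ((g s t)\<^sup>2) \<partial>lborel"
  have "\<exists>s\<in>{a..b}. ?i s \<le> ennreal (J / (b - a))"
  proof (rule ccontr)
    assume "\<not> ?thesis"
    then have "ennreal (J / (b - a)) \<le> ?i s" if "s \<in> {a..b}" for s using that by (meson linear)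
    then have "(\<integral>\<^sup>+s. ennreal (J / (b - a)) * indicator {a..b} s \<partial>lborel) \<le> (\<integral>\<^sup>+s\<in>{a..b}. ?i s \<partial>lborel)"
      by (intro nn_integral_mono) (auto simp: indicator_def)
    also have "(\<integral>\<^sup>+s. ennreal (J / (b - a)) * indicator {a..b} s \<partial>lborel) = ennreal J"
      using ab J by (simp add: nn_integral_cmult_indicator ennreal_mult[symmetric])
    finally show False using le by (simp add: not_less[symmetric])
  qed
  then obtain s where s: "s \<in> {a..b}" "?i s \<le> ennreal (J / (b - a))" by blast
  have *: "\<bar>f s t - f s t'\<bar> \<le> sqrt ((d - c) / (b - a) * J)" if "t \<in> {c..d}" "t' \<in> {c..d}" "t' < t" for t t'
  proof -
    have "ennreal ((f s t - f s t')\<^sup>2) \<le> ennreal (t - t') * (\<integral>\<^sup>+t\<in>{t'..t}. ennreal ((g s t)\<^sup>2) \<partial>lborel)"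
      by (rule increment_square_le_nn_integral[OF f g that(3)])
    also have "\<dots> \<le> ennreal (d - c) * ?i s"
      using that by (intro mult_mono nn_integral_mono ennreal_leI) (auto simp: indicator_def)
    also have "\<dots> \<le> ennreal (d - c) * ennreal (J / (b - a))" by (intro mult_left_mono s) simp
    also have "\<dots> = ennreal ((d - c) / (b - a) * J)" using cd ab J by (simp add: ennreal_mult[symmetric])
    finally have "(f s t - f s t')\<^sup>2 \<le> (d - c) / (b - a) * J" using cd ab J by (subst (asm) ennreal_le_iff) auto
    then show ?thesis using real_sqrt_le_mono by fastforce
  qed
  have "\<bar>f s t - f s t'\<bar> \<le> sqrt ((d - c) / (b - a) * J)" if "t \<in> {c..d}" "t' \<in> {c..d}" for t t'
  proof (cases t t' rule: linorder_cases)
    case less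
    then show ?thesis using *[OF that(2,1)] by (simp add: abs_minus_commute)
  next
    case equal
    then show ?thesis using cd ab J by simp
  next
    case greater
    then show ?thesis using *[OF that] by simp
  qed
  with s(1) show ?thesis by (rule that)
qed

section \<open>Lebesgue measure on the plane as a product measure\<close>

definition pt :: "real \<Rightarrow> real \<Rightarrow> real^2" where
  "pt s t = vector [s, t]"

lemma pt_simps [simp]: "pt s t $ 1 = s" "pt s t $ 2 = t" "pt (x $ 1) (x $ 2) = x"
  by (simp_all add: pt_def vec_eq_iff forall_2)

lemma prod_Basis_real2:
  fixes f :: "real^2 \<Rightarrow> real"
  shows "(\<Prod>b\<in>Basis. f b) = f (axis 1 1) * f (axis 2 1)"
proof -
  have B: "(Basis :: (real^2) set) = {axis 1 1, axis 2 1}"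
    by (auto simp: Basis_vec_def) (metis exhaust_2)
  have "axis 1 1 \<noteq> (axis 2 1 :: real^2)" by (simp add: axis_eq_axis)
  then show ?thesis unfolding B by simp
qed

lemma pt_eq: "pt s t = s *\<^sub>R axis 1 1 + t *\<^sub>R axis 2 1"
  by (simp add: vec_eq_iff forall_2 axis_def)

lemma pt_measurable [measurable (raw)]:
  "f \<in> borel_measurable M \<Longrightarrow> g \<in> borel_measurable M \<Longrightarrow> (\<lambda>z. pt (f z) (g z)) \<in> borel_measurable M"
  unfolding pt_eq by (intro borel_measurable_add borel_measurable_scaleR borel_measurable_const)

text \<open>Lebesgue measure is determined by its values on boxes, and the preimage of a box is a
  product of intervals.\<close>

lemma distr_pt: "distr (lborel \<Otimes>\<^sub>M lborel) borel (\<lambda>z. pt (fst z) (snd z)) = lborel"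
proof (rule lborel_eqI[symmetric])
  fix l u :: "real^2"
  assume "\<And>b. b \<in> Basis \<Longrightarrow> l \<bullet> b \<le> u \<bullet> b"
  have lu: "l $ 1 \<le> u $ 1" "l $ 2 \<le> u $ 2"
    using \<open>\<And>b. b \<in> Basis \<Longrightarrow> l \<bullet> b \<le> u \<bullet> b\<close>[of "axis 1 1"] \<open>\<And>b. b \<in> Basis \<Longrightarrow> l \<bullet> b \<le> u \<bullet> b\<close>[of "axis 2 1"]
    by (simp_all add: inner_axis)
  have "(\<lambda>z. pt (fst z) (snd z)) -` box l u \<inter> space (lborel \<Otimes>\<^sub>M lborel) = {l $ 1<..<u $ 1} \<times> {l $ 2<..<u $ 2}"
    by (auto simp: mem_box_cart forall_2 space_pair_measure)
  then have "emeasure (distr (lborel \<Otimes>\<^sub>M lborel) borel (\<lambda>z. pt (fst z) (snd z))) (box l u)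
      = emeasure (lborel \<Otimes>\<^sub>M lborel) ({l $ 1<..<u $ 1} \<times> {l $ 2<..<u $ 2})"
    by (subst emeasure_distr) (auto simp del: box_real)
  also have "\<dots> = ennreal ((u $ 1 - l $ 1) * (u $ 2 - l $ 2))"
    using lu by (subst lborel.emeasure_pair_measure_Times) (auto simp: ennreal_mult)
  finally show "emeasure (distr (lborel \<Otimes>\<^sub>M lborel) borel (\<lambda>z. pt (fst z) (snd z))) (box l u) = (\<Prod>b\<in>Basis. (u - l) \<bullet> b)"
    by (simp add: prod_Basis_real2 inner_axis)
qed simp

lemma nn_integral_real2:
  fixes f :: "real^2 \<Rightarrow> ennreal"
  assumes [measurable]: "f \<in> borel_measurable borel"
  shows "(\<integral>\<^sup>+x. f x \<partial>lborel) = (\<integral>\<^sup>+s. (\<integral>\<^sup>+t. f (pt s t) \<partial>lborel) \<partial>lborel)"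
    "(\<integral>\<^sup>+x. f x \<partial>lborel) = (\<integral>\<^sup>+t. (\<integral>\<^sup>+s. f (pt s t) \<partial>lborel) \<partial>lborel)"
proof -
  have "(\<integral>\<^sup>+x. f x \<partial>lborel) = (\<integral>\<^sup>+z. f (pt (fst z) (snd z)) \<partial>(lborel \<Otimes>\<^sub>M lborel))"
    by (subst distr_pt[symmetric], subst nn_integral_distr) measurable
  also have "\<dots> = (\<integral>\<^sup>+s. (\<integral>\<^sup>+t. f (pt s t) \<partial>lborel) \<partial>lborel)"
    by (subst lborel.nn_integral_fst[symmetric]) simp_all
  finally show 1: "(\<integral>\<^sup>+x. f x \<partial>lborel) = (\<integral>\<^sup>+s. (\<integral>\<^sup>+t. f (pt s t) \<partial>lborel) \<partial>lborel)" .
  also have "\<dots> = (\<integral>\<^sup>+t. (\<integral>\<^sup>+s. f (pt s t) \<partial>lborel) \<partial>lborel)"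
    by (rule lborel_pair.Fubini') measurable
  finally show "(\<integral>\<^sup>+x. f x \<partial>lborel) = (\<integral>\<^sup>+t. (\<integral>\<^sup>+s. f (pt s t) \<partial>lborel) \<partial>lborel)" .
qed

text \<open>Squares take the place of discs because good lines parallel to the axes come from
  iterated integration in Cartesian coordinates; good circles would call for polar
  coordinates.\<close>

definition square :: "real^2 \<Rightarrow> real \<Rightarrow> (real^2) set" where
  "square p r = {x. \<bar>x $ 1 - p $ 1\<bar> \<le> r \<and> \<bar>x $ 2 - p $ 2\<bar> \<le> r}"

definition open_square :: "real^2 \<Rightarrow> real \<Rightarrow> (real^2) set" where
  "open_square p r = {x. \<bar>x $ 1 - p $ 1\<bar> < r \<and> \<bar>x $ 2 - p $ 2\<bar> < r}"

lemma square_eq_cbox: "square p r = cbox (p - pt r r) (p + pt r r)"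
  by (auto simp: square_def mem_box_cart forall_2)

lemma open_square_eq_box: "open_square p r = box (p - pt r r) (p + pt r r)"
  by (auto simp: open_square_def mem_box_cart forall_2)

lemma square_borel [measurable]: "square p r \<in> sets borel" "open_square p r \<in> sets borel"
  by (simp_all add: square_eq_cbox open_square_eq_box)

lemma scalar_wgrad_uminus:
  "scalar_wgrad \<Omega> a A \<Longrightarrow> scalar_wgrad \<Omega> (\<lambda>x. - a x) (\<lambda>x. - A x)"
  unfolding scalar_wgrad_def by simp

lemma oscillation_le_boundary_lines:
  assumes \<Omega>: "open \<Omega>" and a: "scalar_wgrad \<Omega> a A" "continuous_on \<Omega> a" and v: "scalar_wgrad \<Omega> v V" "continuous_on \<Omega> v"
    and pos: "AE x in lborel. x \<in> \<Omega> \<longrightarrow> A x $ 1 * V x $ 2 - A x $ 2 * V x $ 1 > 0"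
    and K: "cbox (pt sL tB) (pt sR tT) \<subseteq> \<Omega>"
    and fr: "\<And>x. x \<in> cbox (pt sL tB) (pt sR tT) \<Longrightarrow> x $ 1 = sL \<or> x $ 1 = sR \<or> x $ 2 = tB \<or> x $ 2 = tT \<Longrightarrow> \<bar>a x - c\<bar> \<le> h"
    and x: "x \<in> cbox (pt sL tB) (pt sR tT)"
  shows "\<bar>a x - c\<bar> \<le> h"
proof -
  let ?K = "cbox (pt sL tB) (pt sR tT)"
  have f: "\<bar>a x - c\<bar> \<le> h" if "x \<in> frontier ?K" for x
  proof (rule fr)
    have "x \<in> ?K" "x \<notin> box (pt sL tB) (pt sR tT)" using that by (auto simp: frontier_def interior_cbox closure_closed)
    then show "x \<in> ?K" "x $ 1 = sL \<or> x $ 1 = sR \<or> x $ 2 = tB \<or> x $ 2 = tT" by (auto simp: mem_box_cart forall_2)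
  qed
  have "a x \<le> c + h"
    by (rule maximum_principle[OF \<Omega> a v pos compact_cbox K _ x]) (use f in force)
  \<comment> \<open>Both functions are negated, which leaves the Jacobian unchanged and hence
    positive.\<close>
  moreover have "- a x \<le> h - c"
    by (rule maximum_principle[OF \<Omega> scalar_wgrad_uminus[OF a(1)] continuous_on_minus[OF a(2)] scalar_wgrad_uminus[OF v(1)] continuous_on_minus[OF v(2)] _ compact_cbox K _ x])
      (use f pos in force)+
  ultimately show ?thesis by linarith
qed

text \<open>Four slabs of width \<open>2 * \<rho>\<close> cover the square annulus. Each contains a
  line of small oscillation, the four lines bound a rectangle between the two squares, and the
  maximum principle carries the boundary oscillation inside. The lines are chosen for a smooth
  approximant, whose restriction to a line has a gradient; uniform closeness carries the result over
  to \<open>a\<close>.\<close>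

lemma oscillation_on_square:
  assumes \<Omega>: "open \<Omega>" and a: "scalar_wgrad \<Omega> a A" "continuous_on \<Omega> a" and v: "scalar_wgrad \<Omega> v V" "continuous_on \<Omega> v"
    and pos: "AE x in lborel. x \<in> \<Omega> \<longrightarrow> A x $ 1 * V x $ 2 - A x $ 2 * V x $ 1 > 0"
    and \<rho>: "\<rho> > 0" and sub: "square p (4 * \<rho>) \<subseteq> \<Omega>" and J: "J > 0"
    and le: "(\<integral>\<^sup>+x\<in>square p (4 * \<rho>) - open_square p (2 * \<rho>). ennreal ((norm (A x))\<^sup>2) \<partial>lborel) \<le> ennreal J"
    and xy: "x \<in> square p (2 * \<rho>)" "y \<in> square p (2 * \<rho>)"
  shows "\<bar>a x - a y\<bar> \<le> 40 * sqrt J"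
proof -
  note [measurable] = scalar_wgradD(2,3,4)[OF a(1)]
  \<comment> \<open>With \<open>e \<le> J\<close> the slab energy of the approximant is at most
    \<open>2 * J + 2 * e\<close>, strictly below \<open>5 * J\<close> as the choice of lines
    demands; \<open>e \<le> sqrt J\<close> keeps the uniform error comparable to the
    oscillation.\<close>
  define e where "e = min J (sqrt J)"
  have e: "e > 0" "e \<le> J" "e \<le> sqrt J" using J by (auto simp: e_def)
  have K: "compact (square p (4 * \<rho>))" by (simp add: square_eq_cbox)
  obtain b B where b: "\<And>j. continuous_on UNIV (\<lambda>x. B x $ j)"
      "\<And>x j. ((\<lambda>t. b (x + t *\<^sub>R axis j 1)) has_real_derivative B x $ j) (at 0)"
      "\<And>x. x \<in> square p (4 * \<rho>) \<Longrightarrow> \<bar>b x - a x\<bar> \<le> e"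
      "\<And>j. (\<integral>\<^sup>+x\<in>square p (4 * \<rho>). ennreal ((B x $ j - A x $ j)\<^sup>2) \<partial>lborel) \<le> ennreal e"
    by (rule smooth_approximation[OF \<Omega> a K sub e(1)]) (rule that)
  have [measurable]: "(\<lambda>x. B x $ j) \<in> borel_measurable borel" for j
    using b(1) by (rule borel_measurable_continuous_onI)
  have slab: "(\<integral>\<^sup>+x\<in>S. ennreal ((B x $ j)\<^sup>2) \<partial>lborel) < ennreal (5 * J)"
    if S: "S \<subseteq> square p (4 * \<rho>) - open_square p (2 * \<rho>)" and [measurable]: "S \<in> sets borel" for S j
  proof -
    have "(\<integral>\<^sup>+x\<in>S. ennreal ((B x $ j)\<^sup>2) \<partial>lborel) \<le>
      (\<integral>\<^sup>+x. 2 * (ennreal ((norm (A x))\<^sup>2) * indicator (square p (4 * \<rho>) - open_square p (2 * \<rho>)) x)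
        + 2 * (ennreal ((B x $ j - A x $ j)\<^sup>2) * indicator (square p (4 * \<rho>)) x) \<partial>lborel)"
    proof (rule nn_integral_mono)
      fix x
      show "ennreal ((B x $ j)\<^sup>2) * indicator S x \<le> 2 * (ennreal ((norm (A x))\<^sup>2) * indicator (square p (4 * \<rho>) - open_square p (2 * \<rho>)) x)
        + 2 * (ennreal ((B x $ j - A x $ j)\<^sup>2) * indicator (square p (4 * \<rho>)) x)"
      proof (cases "x \<in> S")
        case True
        then have m: "x \<in> square p (4 * \<rho>) - open_square p (2 * \<rho>)" "x \<in> square p (4 * \<rho>)" using S by auto
        have "\<bar>A x $ j\<bar>\<^sup>2 \<le> (norm (A x))\<^sup>2" by (intro power_mono component_le_norm_cart) simp
        then have "(B x $ j)\<^sup>2 \<le> 2 * (norm (A x))\<^sup>2 + 2 * (B x $ j - A x $ j)\<^sup>2"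
          using square_sum2[of "A x $ j" "B x $ j - A x $ j"] by simp
        then have "ennreal ((B x $ j)\<^sup>2) \<le> ennreal (2 * (norm (A x))\<^sup>2 + 2 * (B x $ j - A x $ j)\<^sup>2)" by (rule ennreal_leI)
        then show ?thesis using m True by (simp add: ennreal_plus ennreal_mult)
      qed simp
    qed
    also have "\<dots> = 2 * (\<integral>\<^sup>+x\<in>square p (4 * \<rho>) - open_square p (2 * \<rho>). ennreal ((norm (A x))\<^sup>2) \<partial>lborel)
       + 2 * (\<integral>\<^sup>+x\<in>square p (4 * \<rho>). ennreal ((B x $ j - A x $ j)\<^sup>2) \<partial>lborel)"
      by (subst nn_integral_add) (auto simp: nn_integral_cmult)
    also have "\<dots> \<le> 2 * ennreal J + 2 * ennreal e" by (intro add_mono mult_left_mono le b) auto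
    also have "\<dots> = ennreal (2 * J + 2 * e)" using J e by (simp add: ennreal_plus ennreal_mult)
    also have "\<dots> < ennreal (5 * J)" using J e by (intro ennreal_lessI) auto
    finally show ?thesis .
  qed
  \<comment> \<open>Length \<open>8 * \<rho>\<close> over width \<open>2 * \<rho>\<close> gives the
    factor 4, so \<open>?g\<close> equals \<open>sqrt (20 * J)\<close> at every scale.\<close>
  let ?g = "sqrt ((8 * \<rho>) / (2 * \<rho>) * (5 * J))"
  have db: "((\<lambda>t. b (pt s t)) has_real_derivative B (pt s t) $ 2) (at t)"
      "((\<lambda>s. b (pt s t)) has_real_derivative B (pt s t) $ 1) (at s)" for s t
  proof -
    have eq: "pt s t = t *\<^sub>R axis 2 1 + s *\<^sub>R axis 1 1" for s t by (simp add: pt_eq)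
    show "((\<lambda>t. b (pt s t)) has_real_derivative B (pt s t) $ 2) (at t)"
      unfolding pt_eq by (rule directional_derivative_shift[OF b(2)])
    show "((\<lambda>s. b (pt s t)) has_real_derivative B (pt s t) $ 1) (at s)"
      unfolding eq by (rule directional_derivative_shift[OF b(2)])
  qed
  have cpt: "continuous_on UNIV (\<lambda>t. pt s t)" "continuous_on UNIV (\<lambda>s. pt s t)" for s t
    unfolding pt_eq by (intro continuous_intros)+
  have cB: "continuous_on UNIV (\<lambda>t. B (pt s t) $ j)" "continuous_on UNIV (\<lambda>s. B (pt s t) $ j)" for s t j
    by (rule continuous_on_compose2[OF b(1) cpt(1)], simp) (rule continuous_on_compose2[OF b(1) cpt(2)], simp)
  have vert: "\<exists>s\<in>{\<alpha>..\<alpha> + 2 * \<rho>}. \<forall>t\<in>{p $ 2 - 4 * \<rho>..p $ 2 + 4 * \<rho>}. \<forall>t'\<in>{p $ 2 - 4 * \<rho>..p $ 2 + 4 * \<rho>}. \<bar>b (pt s t) - b (pt s t')\<bar> \<le> ?g"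
    if \<alpha>: "\<alpha> = p $ 1 - 4 * \<rho> \<or> \<alpha> = p $ 1 + 2 * \<rho>" for \<alpha>
  proof -
    let ?S = "cbox (pt \<alpha> (p $ 2 - 4 * \<rho>)) (pt (\<alpha> + 2 * \<rho>) (p $ 2 + 4 * \<rho>))"
    have "(\<integral>\<^sup>+x\<in>?S. ennreal ((B x $ 2)\<^sup>2) \<partial>lborel) < ennreal (5 * J)"
      using \<alpha> \<rho> by (intro slab) (auto simp: square_def open_square_def mem_box_cart forall_2)
    also have "(\<integral>\<^sup>+x\<in>?S. ennreal ((B x $ 2)\<^sup>2) \<partial>lborel) =
      (\<integral>\<^sup>+s\<in>{\<alpha>..\<alpha> + 2 * \<rho>}. (\<integral>\<^sup>+t\<in>{p $ 2 - 4 * \<rho>..p $ 2 + 4 * \<rho>}. ennreal ((B (pt s t) $ 2)\<^sup>2) \<partial>lborel) \<partial>lborel)"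
      by (subst nn_integral_real2(1), measurable, intro nn_integral_cong, subst nn_integral_multc[symmetric])
        (use cB in \<open>auto intro!: nn_integral_cong borel_measurable_continuous_onI simp: indicator_def mem_box_cart forall_2\<close>)
    finally have *: "(\<integral>\<^sup>+s\<in>{\<alpha>..\<alpha> + 2 * \<rho>}. (\<integral>\<^sup>+t\<in>{p $ 2 - 4 * \<rho>..p $ 2 + 4 * \<rho>}. ennreal ((B (pt s t) $ 2)\<^sup>2) \<partial>lborel) \<partial>lborel) < ennreal (5 * J)" .
    show ?thesis
    proof (rule good_line_exists[OF db(1) cB(1) _ _ _ *])
      fix s assume "s \<in> {\<alpha>..\<alpha> + 2 * \<rho>}" "\<And>t t'. t \<in> {p $ 2 - 4 * \<rho>..p $ 2 + 4 * \<rho>} \<Longrightarrow> t' \<in> {p $ 2 - 4 * \<rho>..p $ 2 + 4 * \<rho>} \<Longrightarrow>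
        \<bar>b (pt s t) - b (pt s t')\<bar> \<le> sqrt ((p $ 2 + 4 * \<rho> - (p $ 2 - 4 * \<rho>)) / (\<alpha> + 2 * \<rho> - \<alpha>) * (5 * J))"
      then show ?thesis by (intro bexI[of _ s] ballI) simp_all
    qed (use \<rho> J in auto)
  qed
  have hori: "\<exists>t\<in>{\<alpha>..\<alpha> + 2 * \<rho>}. \<forall>s\<in>{p $ 1 - 4 * \<rho>..p $ 1 + 4 * \<rho>}. \<forall>s'\<in>{p $ 1 - 4 * \<rho>..p $ 1 + 4 * \<rho>}. \<bar>b (pt s t) - b (pt s' t)\<bar> \<le> ?g"
    if \<alpha>: "\<alpha> = p $ 2 - 4 * \<rho> \<or> \<alpha> = p $ 2 + 2 * \<rho>" for \<alpha>
  proof -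
    let ?S = "cbox (pt (p $ 1 - 4 * \<rho>) \<alpha>) (pt (p $ 1 + 4 * \<rho>) (\<alpha> + 2 * \<rho>))"
    have "(\<integral>\<^sup>+x\<in>?S. ennreal ((B x $ 1)\<^sup>2) \<partial>lborel) < ennreal (5 * J)"
      using \<alpha> \<rho> by (intro slab) (auto simp: square_def open_square_def mem_box_cart forall_2)
    also have "(\<integral>\<^sup>+x\<in>?S. ennreal ((B x $ 1)\<^sup>2) \<partial>lborel) =
      (\<integral>\<^sup>+t\<in>{\<alpha>..\<alpha> + 2 * \<rho>}. (\<integral>\<^sup>+s\<in>{p $ 1 - 4 * \<rho>..p $ 1 + 4 * \<rho>}. ennreal ((B (pt s t) $ 1)\<^sup>2) \<partial>lborel) \<partial>lborel)"
      by (subst nn_integral_real2(2), measurable, intro nn_integral_cong, subst nn_integral_multc[symmetric])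
        (use cB in \<open>auto intro!: nn_integral_cong borel_measurable_continuous_onI simp: indicator_def mem_box_cart forall_2\<close>)
    finally have *: "(\<integral>\<^sup>+t\<in>{\<alpha>..\<alpha> + 2 * \<rho>}. (\<integral>\<^sup>+s\<in>{p $ 1 - 4 * \<rho>..p $ 1 + 4 * \<rho>}. ennreal ((B (pt s t) $ 1)\<^sup>2) \<partial>lborel) \<partial>lborel) < ennreal (5 * J)" .
    show ?thesis
    proof (rule good_line_exists[of "\<lambda>t s. b (pt s t)" "\<lambda>t s. B (pt s t) $ 1", OF db(2) cB(2) _ _ _ *])
      fix t assume "t \<in> {\<alpha>..\<alpha> + 2 * \<rho>}" "\<And>s s'. s \<in> {p $ 1 - 4 * \<rho>..p $ 1 + 4 * \<rho>} \<Longrightarrow> s' \<in> {p $ 1 - 4 * \<rho>..p $ 1 + 4 * \<rho>} \<Longrightarrow>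
        \<bar>b (pt s t) - b (pt s' t)\<bar> \<le> sqrt ((p $ 1 + 4 * \<rho> - (p $ 1 - 4 * \<rho>)) / (\<alpha> + 2 * \<rho> - \<alpha>) * (5 * J))"
      then show ?thesis by (intro bexI[of _ t] ballI) simp_all
    qed (use \<rho> J in auto)
  qed
  obtain sL where sL: "sL \<in> {p $ 1 - 4 * \<rho>..p $ 1 - 4 * \<rho> + 2 * \<rho>}"
    "\<And>t t'. t\<in>{p $ 2 - 4 * \<rho>..p $ 2 + 4 * \<rho>} \<Longrightarrow> t'\<in>{p $ 2 - 4 * \<rho>..p $ 2 + 4 * \<rho>} \<Longrightarrow> \<bar>b (pt sL t) - b (pt sL t')\<bar> \<le> ?g"
    using vert[of "p $ 1 - 4 * \<rho>"] by blast
  obtain sR where sR: "sR \<in> {p $ 1 + 2 * \<rho>..p $ 1 + 2 * \<rho> + 2 * \<rho>}"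
    "\<And>t t'. t\<in>{p $ 2 - 4 * \<rho>..p $ 2 + 4 * \<rho>} \<Longrightarrow> t'\<in>{p $ 2 - 4 * \<rho>..p $ 2 + 4 * \<rho>} \<Longrightarrow> \<bar>b (pt sR t) - b (pt sR t')\<bar> \<le> ?g"
    using vert[of "p $ 1 + 2 * \<rho>"] by blast
  obtain tB where tB: "tB \<in> {p $ 2 - 4 * \<rho>..p $ 2 - 4 * \<rho> + 2 * \<rho>}"
    "\<And>s s'. s\<in>{p $ 1 - 4 * \<rho>..p $ 1 + 4 * \<rho>} \<Longrightarrow> s'\<in>{p $ 1 - 4 * \<rho>..p $ 1 + 4 * \<rho>} \<Longrightarrow> \<bar>b (pt s tB) - b (pt s' tB)\<bar> \<le> ?g"
    using hori[of "p $ 2 - 4 * \<rho>"] by blast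
  obtain tT where tT: "tT \<in> {p $ 2 + 2 * \<rho>..p $ 2 + 2 * \<rho> + 2 * \<rho>}"
    "\<And>s s'. s\<in>{p $ 1 - 4 * \<rho>..p $ 1 + 4 * \<rho>} \<Longrightarrow> s'\<in>{p $ 1 - 4 * \<rho>..p $ 1 + 4 * \<rho>} \<Longrightarrow> \<bar>b (pt s tT) - b (pt s' tT)\<bar> \<le> ?g"
    using hori[of "p $ 2 + 2 * \<rho>"] by blast
  let ?K = "cbox (pt sL tB) (pt sR tT)"
  \<comment> \<open>The reference value is taken at the lower left corner, which lies on two of the
    lines. The left and bottom sides are reached along one line, the right and top sides along
    two.\<close>
  let ?c = "b (pt sL tB)"
  have Ksub: "?K \<subseteq> square p (4 * \<rho>)" using sL(1) sR(1) tB(1) tT(1)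
    by (auto simp: square_def mem_box_cart forall_2)
  have inK: "square p (2 * \<rho>) \<subseteq> ?K" using sL(1) sR(1) tB(1) tT(1)
    by (auto simp: square_def mem_box_cart forall_2)
  have g0: "?g \<ge> 0" using J \<rho> by simp
  have mem: "sL \<in> {p $ 1 - 4 * \<rho>..p $ 1 + 4 * \<rho>}" "sR \<in> {p $ 1 - 4 * \<rho>..p $ 1 + 4 * \<rho>}"
    "tB \<in> {p $ 2 - 4 * \<rho>..p $ 2 + 4 * \<rho>}" "tT \<in> {p $ 2 - 4 * \<rho>..p $ 2 + 4 * \<rho>}"
    using sL(1) sR(1) tB(1) tT(1) \<rho> by auto
  have bd: "\<bar>a x - ?c\<bar> \<le> 2 * ?g + e"
    if x: "x \<in> ?K" and bdry: "x $ 1 = sL \<or> x $ 1 = sR \<or> x $ 2 = tB \<or> x $ 2 = tT" for x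
  proof -
    have x1: "x $ 1 \<in> {p $ 1 - 4 * \<rho>..p $ 1 + 4 * \<rho>}" and x2: "x $ 2 \<in> {p $ 2 - 4 * \<rho>..p $ 2 + 4 * \<rho>}"
      using x Ksub by (auto simp: square_def abs_le_iff)
    have "\<bar>b (pt (x $ 1) (x $ 2)) - ?c\<bar> \<le> 2 * ?g"
      using bdry
    proof (elim disjE)
      assume *: "x $ 1 = sL"
      show ?thesis unfolding * using sL(2)[OF x2 mem(3)] g0 by linarith
    next
      assume *: "x $ 2 = tB"
      show ?thesis unfolding * using tB(2)[OF x1 mem(1)] g0 by linarith
    next
      assume *: "x $ 1 = sR"
      show ?thesis unfolding * using sR(2)[OF x2 mem(3)] tB(2)[OF mem(2,1)] by linarith
    next
      assume *: "x $ 2 = tT"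
      show ?thesis unfolding * using tT(2)[OF x1 mem(1)] sL(2)[OF mem(4,3)] by linarith
    qed
    moreover have "\<bar>b x - a x\<bar> \<le> e" using x Ksub by (intro b(3)) auto
    ultimately show ?thesis by simp
  qed
  have osc: "\<bar>a z - ?c\<bar> \<le> 2 * ?g + e" if "z \<in> ?K" for z
    by (rule oscillation_le_boundary_lines[OF \<Omega> a v pos order_trans[OF Ksub sub] bd that])
  \<comment> \<open>Each value is within \<open>2 * (5 * sqrt J) + sqrt J\<close> of
    \<open>?c\<close>, so two values differ by at most \<open>22 * sqrt J\<close>; the constant 40
    leaves room.\<close>
  have "?g = sqrt (20 * J)" using \<rho> by simp
  also have "\<dots> \<le> sqrt (25 * J)" using J by simp
  also have "\<dots> = 5 * sqrt J" by (simp add: real_sqrt_mult)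
  finally have "?g \<le> 5 * sqrt J" .
  moreover have "\<bar>a x - ?c\<bar> \<le> 2 * ?g + e" "\<bar>a y - ?c\<bar> \<le> 2 * ?g + e" using osc xy inK by blast+
  moreover have "0 \<le> sqrt J" using J by simp
  ultimately show ?thesis using e(3) by linarith
qed

subsection \<open>Sobolev maps\<close>

lemma finite_measure_on_bounded:
  fixes \<Omega> :: "(real^2) set"
  assumes "open \<Omega>" "bounded \<Omega>"
  shows "finite_measure (lebesgue_on \<Omega>)"
  using assms by (intro finite_measure_lebesgue_on bounded_set_imp_lmeasurable) auto

lemma measurable_lebesgue_on_borel [measurable (raw)]:
  "f \<in> borel_measurable borel \<Longrightarrow> f \<in> borel_measurable (lebesgue_on \<Omega>)"
  by (intro measurable_restrict_space1 measurable_completion) simp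

section \<open>Square-integrable functions on a bounded open set\<close>

lemma L2_on_measurable: "L2_on \<Omega> f \<Longrightarrow> f \<in> borel_measurable (lebesgue_on \<Omega>)"
  by (simp add: L2_on_def)

lemma L2_onI_bound:
  assumes f: "L2_on \<Omega> f" and [measurable]: "g \<in> borel_measurable (lebesgue_on \<Omega>)"
    and le: "\<And>x. x \<in> \<Omega> \<Longrightarrow> norm (g x) \<le> C * norm (f x)"
  shows "L2_on \<Omega> g"
  unfolding L2_on_def
proof
  show "integrable (lebesgue_on \<Omega>) (\<lambda>x. (norm (g x))\<^sup>2)"
  proof (rule Bochner_Integration.integrable_bound)
    show "integrable (lebesgue_on \<Omega>) (\<lambda>x. C\<^sup>2 * (norm (f x))\<^sup>2)" using f by (simp add: L2_on_def)
    show "AE x in lebesgue_on \<Omega>. norm ((norm (g x))\<^sup>2) \<le> norm (C\<^sup>2 * (norm (f x))\<^sup>2)"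
    proof (rule AE_I2)
      fix x assume "x \<in> space (lebesgue_on \<Omega>)"
      then have "(norm (g x))\<^sup>2 \<le> (C * norm (f x))\<^sup>2" using le by (intro power_mono) auto
      then show "norm ((norm (g x))\<^sup>2) \<le> norm (C\<^sup>2 * (norm (f x))\<^sup>2)" by (simp add: power_mult_distrib)
    qed
  qed measurable
qed simp

lemma L2_on_add:
  assumes f: "L2_on \<Omega> f" and g: "L2_on \<Omega> g"
  shows "L2_on \<Omega> (\<lambda>x. f x + g x)"
  unfolding L2_on_def
proof
  have [measurable]: "f \<in> borel_measurable (lebesgue_on \<Omega>)" "g \<in> borel_measurable (lebesgue_on \<Omega>)"
    using f g by (auto simp: L2_on_def)
  show "(\<lambda>x. f x + g x) \<in> borel_measurable (lebesgue_on \<Omega>)" by measurable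
  show "integrable (lebesgue_on \<Omega>) (\<lambda>x. (norm (f x + g x))\<^sup>2)"
  proof (rule Bochner_Integration.integrable_bound)
    show "integrable (lebesgue_on \<Omega>) (\<lambda>x. 2 * (norm (f x))\<^sup>2 + 2 * (norm (g x))\<^sup>2)" using f g by (simp add: L2_on_def)
    have "(norm (f x + g x))\<^sup>2 \<le> 2 * (norm (f x))\<^sup>2 + 2 * (norm (g x))\<^sup>2" for x
      by (rule order_trans[OF power_mono[OF norm_triangle_ineq norm_ge_zero] square_sum2])
    then show "AE x in lebesgue_on \<Omega>. norm ((norm (f x + g x))\<^sup>2) \<le> norm (2 * (norm (f x))\<^sup>2 + 2 * (norm (g x))\<^sup>2)"
      by simp
  qed measurable
qed

lemma L2_on_const: "open \<Omega> \<Longrightarrow> bounded \<Omega> \<Longrightarrow> L2_on \<Omega> (\<lambda>x. c)"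
  using finite_measure.integrable_const[OF finite_measure_on_bounded] by (auto simp: L2_on_def)

lemma L2_on_component: "L2_on \<Omega> f \<Longrightarrow> L2_on \<Omega> (\<lambda>x. f x $ i)"
  for f :: "real^2 \<Rightarrow> 'b::euclidean_space^2"
proof -
  assume f: "L2_on \<Omega> f"
  have "(\<lambda>x. f x $ i) \<in> borel_measurable (lebesgue_on \<Omega>)"
    using measurable_compose[OF L2_on_measurable[OF f] borel_measurable_continuous_onI[of "\<lambda>x. x $ i"]]
    by (simp add: continuous_on_component continuous_on_id)
  then show ?thesis using Finite_Cartesian_Product.norm_nth_le[of "f _" i] by (intro L2_onI_bound[OF f, of _ 1]) auto
qed

lemma L2_on_mult_integrable:
  fixes f k :: "real^2 \<Rightarrow> real"
  assumes \<Omega>: "open \<Omega>" "bounded \<Omega>" and f: "L2_on \<Omega> f" and [measurable]: "k \<in> borel_measurable (lebesgue_on \<Omega>)"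
    and k: "\<And>x. \<bar>k x\<bar> \<le> c"
  shows "integrable (lebesgue_on \<Omega>) (\<lambda>x. f x * k x)"
proof -
  interpret finite_measure "lebesgue_on \<Omega>" by (rule finite_measure_on_bounded[OF \<Omega>])
  have [measurable]: "f \<in> borel_measurable (lebesgue_on \<Omega>)" using f by (simp add: L2_on_def)
  have "integrable (lebesgue_on \<Omega>) f"
  proof (rule Bochner_Integration.integrable_bound)
    show "integrable (lebesgue_on \<Omega>) (\<lambda>x. 1 + (norm (f x))\<^sup>2)" using f by (simp add: L2_on_def)
    show "AE x in lebesgue_on \<Omega>. norm (f x) \<le> norm (1 + (norm (f x))\<^sup>2)"
      using abs_le_1_plus_square by simp
  qed measurable
  then show ?thesis by (rule integrable_mult_bounded[OF _ _ k]) measurable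
qed

lemma test_function_measurable:
  assumes "test_function \<Omega> \<phi>"
  shows "\<phi> \<in> borel_measurable borel" "partial_deriv j \<phi> \<in> borel_measurable borel"
proof -
  have "\<And>k. C_k k \<phi>" using assms by (simp add: test_function_def)
  then show "\<phi> \<in> borel_measurable borel" "partial_deriv j \<phi> \<in> borel_measurable borel"
    using smooth_continuous by (auto intro!: borel_measurable_continuous_onI)
qed

text \<open>Weak gradients are measurable only for the completed sigma-algebra, whereas iterated
  integrals are taken over Borel functions. The indicator extends the function by zero outside
  \<open>\<Omega>\<close>.\<close>

lemma borel_representative:
  fixes f :: "real^2 \<Rightarrow> real"
  assumes \<Omega>: "open \<Omega>" and f: "f \<in> borel_measurable (lebesgue_on \<Omega>)"
  obtains g where "g \<in> borel_measurable borel" "AE x in lebesgue. indicator \<Omega> x * f x = g x"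
proof -
  have "(\<lambda>x. indicator \<Omega> x * f x) \<in> borel_measurable lebesgue"
    using f \<Omega> borel_measurable_restrict_space_iff[of \<Omega> lebesgue f] by simp
  from completion_ex_borel_measurable_real[OF this] obtain g where
    "g \<in> borel_measurable lborel" "AE x in lborel. indicator \<Omega> x * f x = g x" by blast
  then show ?thesis by (intro that[of g]) (simp_all add: AE_completion)
qed

lemma integral_on_eq_lborel:
  fixes f g :: "real^2 \<Rightarrow> real"
  assumes \<Omega>: "open \<Omega>" and [measurable]: "g \<in> borel_measurable borel"
    and f: "f \<in> borel_measurable (lebesgue_on \<Omega>)" and ae: "AE x in lebesgue. indicator \<Omega> x * f x = g x"
  shows "(\<integral>x. f x \<partial>lebesgue_on \<Omega>) = (\<integral>x. g x \<partial>lborel)"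
    "integrable (lebesgue_on \<Omega>) f \<longleftrightarrow> integrable lborel g"
proof -
  have m: "(\<lambda>x. indicator \<Omega> x * f x) \<in> borel_measurable lebesgue"
    using f \<Omega> borel_measurable_restrict_space_iff[of \<Omega> lebesgue f] by simp
  have [measurable]: "g \<in> borel_measurable lebesgue" by (rule measurable_completion) simp
  have S: "\<Omega> \<inter> space lebesgue \<in> sets lebesgue" using \<Omega> by simp
  have "(\<integral>x. f x \<partial>lebesgue_on \<Omega>) = (\<integral>x. indicator \<Omega> x * f x \<partial>lebesgue)"
    using integral_restrict_space[OF S, of f] by simp
  also have "\<dots> = (\<integral>x. g x \<partial>lebesgue)" by (rule integral_cong_AE[OF m _ ae]) simp
  also have "\<dots> = (\<integral>x. g x \<partial>lborel)" by (rule integral_completion) simp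
  finally show "(\<integral>x. f x \<partial>lebesgue_on \<Omega>) = (\<integral>x. g x \<partial>lborel)" .
  have "integrable (lebesgue_on \<Omega>) f \<longleftrightarrow> integrable lebesgue (\<lambda>x. indicator \<Omega> x * f x)"
    using integrable_restrict_space[OF S, of f] by simp
  also have "\<dots> \<longleftrightarrow> integrable lebesgue g" by (rule integrable_cong_AE[OF m _ ae]) simp
  also have "\<dots> \<longleftrightarrow> integrable lborel g" by (rule integrable_completion) simp
  finally show "integrable (lebesgue_on \<Omega>) f \<longleftrightarrow> integrable lborel g" .
qed

lemma AE_lebesgue_on_iff:
  fixes \<Omega> :: "(real^2) set"
  assumes "open \<Omega>"
  shows "(AE x in lebesgue_on \<Omega>. P x) \<longleftrightarrow> (AE x in lebesgue. x \<in> \<Omega> \<longrightarrow> P x)"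
  using assms by (subst AE_restrict_space_iff) auto

lemma weak_gradientD:
  "weak_gradient \<Omega> u G \<Longrightarrow> test_function \<Omega> \<phi> \<Longrightarrow>
    (\<integral>x. u x $ i * partial_deriv j \<phi> x \<partial>lebesgue_on \<Omega>) = - (\<integral>x. G x $ i $ j * \<phi> x \<partial>lebesgue_on \<Omega>)"
  by (simp add: weak_gradient_def)

text \<open>\<open>grad\<close> picks an arbitrary weak gradient, so a gradient computed for a
  competitor becomes a statement about \<open>grad\<close> only through uniqueness. The fundamental
  lemma is applied to each entry of the difference.\<close>

lemma weak_gradient_unique:
  assumes \<Omega>: "open \<Omega>" "bounded \<Omega>" and G: "weak_gradient \<Omega> u G" "weak_gradient \<Omega> u G'"
  shows "AE x in lebesgue_on \<Omega>. G x = G' x"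
proof -
  have comp: "AE x in lebesgue_on \<Omega>. G x $ i $ j = G' x $ i $ j" for i j
  proof -
    have L: "L2_on \<Omega> (\<lambda>x. G x $ i $ j)" "L2_on \<Omega> (\<lambda>x. G' x $ i $ j)"
      using G by (auto simp: weak_gradient_def intro!: L2_on_component)
    let ?f = "\<lambda>x. G x $ i $ j - G' x $ i $ j"
    have "L2_on \<Omega> (\<lambda>x. - (G' x $ i $ j))"
      by (rule L2_onI_bound[OF L(2), of _ 1]) (simp_all add: L2_on_measurable[OF L(2)])
    then have Lf: "L2_on \<Omega> ?f" using L2_on_add[OF L(1)] by fastforce
    have mf: "?f \<in> borel_measurable (lebesgue_on \<Omega>)" using Lf by (rule L2_on_measurable)
    obtain g where g[measurable]: "g \<in> borel_measurable borel" and ae: "AE x in lebesgue. indicator \<Omega> x * ?f x = g x"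
      using borel_representative[OF \<Omega>(1) mf] by blast
    have "AE x in lborel. x \<in> \<Omega> \<longrightarrow> g x = 0"
    proof (rule AE_zero_if_orthogonal_to_test_functions[OF \<Omega>(1) g])
      have "AE x in lebesgue. indicator \<Omega> x * (?f x)\<^sup>2 = (g x)\<^sup>2"
        using ae by eventually_elim (auto simp: indicator_def split: if_splits)
      moreover have "integrable (lebesgue_on \<Omega>) (\<lambda>x. (?f x)\<^sup>2)" using Lf by (simp add: L2_on_def)
      ultimately show "integrable lborel (\<lambda>x. (g x)\<^sup>2)"
        using integral_on_eq_lborel(2)[OF \<Omega>(1), of "\<lambda>x. (g x)\<^sup>2" "\<lambda>x. (?f x)\<^sup>2"] mf by simp
      fix \<phi> assume \<phi>: "test_function \<Omega> \<phi>"
      note [measurable] = test_function_measurable[OF \<phi>]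
      obtain M where M: "\<And>x. \<bar>\<phi> x\<bar> \<le> M" using test_function_bounded[OF \<phi>] by metis
      have i: "integrable (lebesgue_on \<Omega>) (\<lambda>x. G x $ i $ j * \<phi> x)" "integrable (lebesgue_on \<Omega>) (\<lambda>x. G' x $ i $ j * \<phi> x)"
        by (intro L2_on_mult_integrable[OF \<Omega> L(1) _ M] L2_on_mult_integrable[OF \<Omega> L(2) _ M] measurable_lebesgue_on_borel; simp)+
      have "(\<integral>x. G x $ i $ j * \<phi> x \<partial>lebesgue_on \<Omega>) = (\<integral>x. G' x $ i $ j * \<phi> x \<partial>lebesgue_on \<Omega>)"
        using weak_gradientD[OF G(1) \<phi>, of i j] weak_gradientD[OF G(2) \<phi>, of i j] by simp
      then have "(\<integral>x. ?f x * \<phi> x \<partial>lebesgue_on \<Omega>) = 0" using i by (simp add: left_diff_distrib)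
      moreover have "AE x in lebesgue. indicator \<Omega> x * (?f x * \<phi> x) = g x * \<phi> x"
        using ae by eventually_elim (simp add: mult.assoc[symmetric])
      moreover have "(\<lambda>x. ?f x * \<phi> x) \<in> borel_measurable (lebesgue_on \<Omega>)"
        by (intro borel_measurable_times mf measurable_lebesgue_on_borel) simp
      ultimately show "(\<integral>x. g x * \<phi> x \<partial>lborel) = 0"
        using integral_on_eq_lborel(1)[OF \<Omega>(1), of "\<lambda>x. g x * \<phi> x" "\<lambda>x. ?f x * \<phi> x"] by simp
    qed
    then have "AE x in lebesgue. x \<in> \<Omega> \<longrightarrow> g x = 0" by (rule AE_completion)
    then have "AE x in lebesgue. x \<in> \<Omega> \<longrightarrow> G x $ i $ j = G' x $ i $ j"
      using ae by eventually_elim (auto simp: indicator_def)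
    then show ?thesis by (simp add: AE_lebesgue_on_iff[OF \<Omega>(1)])
  qed
  have "AE x in lebesgue_on \<Omega>. \<forall>i\<in>UNIV. \<forall>j\<in>UNIV. G x $ i $ j = G' x $ i $ j"
    by (intro AE_finite_allI comp) simp_all
  then show ?thesis by eventually_elim (simp add: vec_eq_iff)
qed

lemma weak_gradient_grad: "u \<in> W12 \<Omega> \<Longrightarrow> weak_gradient \<Omega> u (grad \<Omega> u)"
  unfolding W12_def grad_def by (auto intro: someI[where P = "weak_gradient \<Omega> u"])

text \<open>The bridge from matrix-valued weak gradients over \<open>lebesgue_on \<Omega>\<close> to
  the scalar Borel setting. Only the gradient is altered on a null set; a continuous function on an
  open set, extended by zero, is already Borel.\<close>

lemma W12_scalar_wgrad:
  assumes \<Omega>: "open \<Omega>" "bounded \<Omega>" and u: "u \<in> W12 \<Omega>" "continuous_on \<Omega> u"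
  obtains A :: "real^2 \<Rightarrow> real^2^2" where "AE x in lebesgue_on \<Omega>. grad \<Omega> u x = A x"
    "\<And>i. scalar_wgrad \<Omega> (\<lambda>x. indicator \<Omega> x * u x $ i) (\<lambda>x. A x $ i)"
proof -
  note wg = weak_gradient_grad[OF u(1)]
  have Lu: "L2_on \<Omega> (\<lambda>x. u x $ i)" for i using u(1) by (auto simp: W12_def intro: L2_on_component)
  have LG: "L2_on \<Omega> (\<lambda>x. grad \<Omega> u x $ i $ j)" for i j
    using wg by (auto simp: weak_gradient_def intro!: L2_on_component)
  have "\<exists>g. g \<in> borel_measurable borel \<and> (AE x in lebesgue. indicator \<Omega> x * grad \<Omega> u x $ i $ j = g x)" for i j
    using borel_representative[OF \<Omega>(1) L2_on_measurable[OF LG[of i j]]] by blast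
  from someI_ex[OF this] obtain g where
    g: "\<And>i j. g i j \<in> borel_measurable borel" "\<And>i j. AE x in lebesgue. indicator \<Omega> x * grad \<Omega> u x $ i $ j = g i j x"
    by (intro that[of "\<lambda>i j. SOME g. g \<in> borel_measurable borel \<and> (AE x in lebesgue. indicator \<Omega> x * grad \<Omega> u x $ i $ j = g x)"]) simp_all
  note [measurable] = g(1)
  define A :: "real^2 \<Rightarrow> real^2^2" where "A = (\<lambda>x. \<chi> i j. g i j x)"
  have gi: "integrable lborel (\<lambda>x. (g i j x)\<^sup>2)" for i j
  proof -
    have "AE x in lebesgue. indicator \<Omega> x * (grad \<Omega> u x $ i $ j)\<^sup>2 = (g i j x)\<^sup>2"
      using g(2)[of i j] by eventually_elim (auto simp: indicator_def split: if_splits)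
    moreover have "integrable (lebesgue_on \<Omega>) (\<lambda>x. (grad \<Omega> u x $ i $ j)\<^sup>2)" using LG[of i j] by (simp add: L2_on_def)
    ultimately show ?thesis
      using integral_on_eq_lborel(2)[OF \<Omega>(1), of "\<lambda>x. (g i j x)\<^sup>2" "\<lambda>x. (grad \<Omega> u x $ i $ j)\<^sup>2"] L2_on_measurable[OF LG[of i j]] by simp
  qed
  have um: "(\<lambda>x. indicator \<Omega> x * u x $ i) \<in> borel_measurable borel" for i
  proof -
    have "continuous_on \<Omega> (\<lambda>x. u x $ i)" using u(2) by (intro continuous_intros)
    then have "(\<lambda>x. if x \<in> \<Omega> then u x $ i else 0) \<in> borel_measurable borel"
      using \<Omega>(1) by (intro borel_measurable_continuous_on_if) auto
    then show ?thesis by (rule measurable_cong[THEN iffD1, rotated]) (auto simp: indicator_def)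
  qed
  show ?thesis
  proof
    have "AE x in lebesgue. \<forall>i\<in>UNIV. \<forall>j\<in>UNIV. indicator \<Omega> x * grad \<Omega> u x $ i $ j = g i j x"
      by (intro AE_finite_allI g(2)) simp_all
    then have "AE x in lebesgue. x \<in> \<Omega> \<longrightarrow> grad \<Omega> u x = A x"
      by eventually_elim (auto simp: vec_eq_iff A_def)
    then show "AE x in lebesgue_on \<Omega>. grad \<Omega> u x = A x" by (simp add: AE_lebesgue_on_iff[OF \<Omega>(1)])
    fix i
    have n: "(norm (A x $ i))\<^sup>2 = (g i 1 x)\<^sup>2 + (g i 2 x)\<^sup>2" for x
      by (simp only: power2_norm_eq_inner) (simp add: inner_vec_def sum_2 A_def power2_eq_square)
    show "scalar_wgrad \<Omega> (\<lambda>x. indicator \<Omega> x * u x $ i) (\<lambda>x. A x $ i)"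
      unfolding scalar_wgrad_def
    proof (intro conjI allI impI)
      show "(\<lambda>x. A x $ i) \<in> borel_measurable borel"
        by (subst borel_measurable_euclidean_space) (auto simp: Basis_vec_def inner_axis A_def)
      show "integrable lborel (\<lambda>x. (norm (A x $ i))\<^sup>2)" unfolding n using gi by simp
      have "integrable (lebesgue_on \<Omega>) (\<lambda>x. u x $ i * 1)"
        by (rule L2_on_mult_integrable[OF \<Omega> Lu, of _ 1]) auto
      then show "integrable lborel (\<lambda>x. indicator \<Omega> x * u x $ i)"
        using integral_on_eq_lborel(2)[OF \<Omega>(1) um[of i] L2_on_measurable[OF Lu[of i]]] by simp
      fix \<phi> j assume \<phi>: "test_function \<Omega> \<phi>"
      note [measurable] = test_function_measurable[OF \<phi>] um
      have "(\<integral>x. u x $ i * partial_deriv j \<phi> x \<partial>lebesgue_on \<Omega>) = (\<integral>x. indicator \<Omega> x * u x $ i * partial_deriv j \<phi> x \<partial>lborel)"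
      proof (rule integral_on_eq_lborel(1)[OF \<Omega>(1)])
        show "(\<lambda>x. indicator \<Omega> x * u x $ i * partial_deriv j \<phi> x) \<in> borel_measurable borel"
          by (rule borel_measurable_times[OF um test_function_measurable(2)[OF \<phi>]])
        show "(\<lambda>x. u x $ i * partial_deriv j \<phi> x) \<in> borel_measurable (lebesgue_on \<Omega>)"
          by (intro borel_measurable_times L2_on_measurable Lu measurable_lebesgue_on_borel test_function_measurable[OF \<phi>])
      qed (simp add: mult.assoc)
      moreover have "(\<integral>x. grad \<Omega> u x $ i $ j * \<phi> x \<partial>lebesgue_on \<Omega>) = (\<integral>x. g i j x * \<phi> x \<partial>lborel)"
      proof (rule integral_on_eq_lborel(1)[OF \<Omega>(1)])
        show "AE x in lebesgue. indicator \<Omega> x * (grad \<Omega> u x $ i $ j * \<phi> x) = g i j x * \<phi> x"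
          using g(2)[of i j] by eventually_elim (simp add: mult.assoc[symmetric])
        show "(\<lambda>x. grad \<Omega> u x $ i $ j * \<phi> x) \<in> borel_measurable (lebesgue_on \<Omega>)"
          by (intro borel_measurable_times L2_on_measurable LG measurable_lebesgue_on_borel test_function_measurable[OF \<phi>])
      qed measurable
      moreover have "(\<integral>x. u x $ i * partial_deriv j \<phi> x \<partial>lebesgue_on \<Omega>) = - (\<integral>x. grad \<Omega> u x $ i $ j * \<phi> x \<partial>lebesgue_on \<Omega>)"
        using wg \<phi> by (simp add: weak_gradient_def)
      ultimately show "(\<integral>x. indicator \<Omega> x * u x $ i * partial_deriv j \<phi> x \<partial>lborel) = - (\<integral>x. A x $ i $ j * \<phi> x \<partial>lborel)"
        by (simp add: A_def)
    qed
  qed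
qed

subsection \<open>Outer variations towards a point\<close>

definition outer :: "real^2 \<Rightarrow> real^2 \<Rightarrow> real^2^2" where
  "outer q d = (\<chi> i j. q $ i * d $ j)"

definition full_grad :: "(real^2 \<Rightarrow> real) \<Rightarrow> real^2 \<Rightarrow> real^2" where
  "full_grad \<zeta> x = (\<chi> j. partial_deriv j \<zeta> x)"

text \<open>For \<open>0 \<le> e * \<zeta> x \<le> 1\<close> this is a convex combination of
  \<open>u x\<close> and the fixed target \<open>c\<close>.\<close>

definition pull :: "(real^2 \<Rightarrow> real) \<Rightarrow> real^2 \<Rightarrow> real \<Rightarrow> (real^2 \<Rightarrow> real^2) \<Rightarrow> real^2 \<Rightarrow> real^2" where
  "pull \<zeta> c e u x = u x - (e * \<zeta> x) *\<^sub>R (u x - c)"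

definition pull_grad :: "(real^2 \<Rightarrow> real) \<Rightarrow> real^2 \<Rightarrow> real \<Rightarrow> (real^2 \<Rightarrow> real^2) \<Rightarrow> (real^2 \<Rightarrow> real^2^2) \<Rightarrow> real^2 \<Rightarrow> real^2^2" where
  "pull_grad \<zeta> c e u G x = (1 - e * \<zeta> x) *\<^sub>R G x - e *\<^sub>R outer (u x - c) (full_grad \<zeta> x)"

lemma norm_outer: "norm (outer q d) = norm q * norm d"
proof -
  have "outer q d $ i = (q $ i) *\<^sub>R d" for i by (simp add: outer_def vec_eq_iff)
  then have "norm (outer q d) = L2_set (\<lambda>i. norm (q $ i) * norm d) UNIV"
    by (subst norm_vec_def) simp
  also have "\<dots> = L2_set (\<lambda>i. norm (q $ i)) UNIV * norm d"
    by (rule L2_set_left_distrib[symmetric]) simp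
  finally show ?thesis by (simp add: norm_vec_def[of q])
qed

lemma outer_measurable:
  assumes "f \<in> borel_measurable M" "g \<in> borel_measurable M"
  shows "(\<lambda>x. outer (f x) (g x)) \<in> borel_measurable M"
proof -
  have "continuous_on UNIV (\<lambda>z. outer (fst z) (snd z))"
    unfolding outer_def by (intro continuous_on_vec_lambda continuous_intros)
  from borel_measurable_continuous_Pair[OF assms this]
  show ?thesis by simp
qed

lemma full_grad_measurable:
  assumes "test_function \<Omega> \<zeta>"
  shows "full_grad \<zeta> \<in> borel_measurable borel"
proof -
  have "\<And>k. C_k k \<zeta>" using assms by (simp add: test_function_def)
  then have "continuous_on UNIV (full_grad \<zeta>)"
    unfolding full_grad_def[abs_def] by (intro continuous_on_vec_lambda smooth_continuous)
  then show ?thesis by (rule borel_measurable_continuous_onI)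
qed

lemma full_grad_bounded:
  assumes "test_function \<Omega> \<zeta>"
  obtains M where "M > 0" "\<And>x. norm (full_grad \<zeta> x) \<le> M"
proof -
  obtain M1 where M1: "M1 > 0" "\<And>x. \<bar>partial_deriv 1 \<zeta> x\<bar> \<le> M1" using test_function_bounded[OF assms] by metis
  obtain M2 where M2: "M2 > 0" "\<And>x. \<bar>partial_deriv 2 \<zeta> x\<bar> \<le> M2" using test_function_bounded[OF assms] by metis
  have "norm (full_grad \<zeta> x) \<le> 2 * max M1 M2" for x
    using M1(2)[of x] M2(2)[of x] by (intro norm_le_two_component) (auto simp: full_grad_def le_max_iff_disj)
  then show ?thesis using M1(1) by (intro that[of "2 * max M1 M2"]) auto
qed

text \<open>This covers the constant target \<open>c\<close> in \<open>pull\<close>, whose share of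
  the weak gradient concerns two smooth functions only. The product of the two has compact support,
  so its partial derivative integrates to zero.\<close>

lemma test_function_integration_by_parts:
  assumes \<Omega>: "open \<Omega>" "bounded \<Omega>" and \<phi>: "test_function \<Omega> \<phi>" and \<zeta>: "test_function \<Omega> \<zeta>"
  shows "(\<integral>x. \<zeta> x * partial_deriv j \<phi> x \<partial>lebesgue_on \<Omega>) = - (\<integral>x. partial_deriv j \<zeta> x * \<phi> x \<partial>lebesgue_on \<Omega>)"
proof -
  have s: "\<And>k. C_k k \<phi>" "\<And>k. C_k k \<zeta>" using \<phi> \<zeta> by (auto simp: test_function_def)
  let ?\<psi> = "\<lambda>x. \<zeta> x * \<phi> x"
  have t: "test_function \<Omega> ?\<psi>" by (rule test_function_mult[OF \<zeta> s(1)])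
  have sm: "\<And>k. C_k k ?\<psi>" using t by (simp add: test_function_def)
  obtain K where K: "compact K" "K \<subseteq> \<Omega>" "\<And>x. x \<notin> K \<Longrightarrow> ?\<psi> x = 0" "\<And>x j. x \<notin> K \<Longrightarrow> partial_deriv j ?\<psi> x = 0"
    by (rule test_functionD[OF t]) (rule that)
  obtain M where M: "\<And>x. \<bar>?\<psi> x\<bar> \<le> M" "\<And>x. \<bar>partial_deriv j ?\<psi> x\<bar> \<le> M"
    by (rule test_function_bounded[OF t, of j]) (rule that)
  have "(\<integral>x. partial_deriv j ?\<psi> x \<partial>lborel) = 0"
  proof (rule integral_directional_derivative_eq_0[where \<psi> = ?\<psi> and e = "axis j 1" and K = K and M = M])
    fix x :: "real^2"
    let ?D = "\<chi> j. partial_deriv j ?\<psi> x"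
    have "((\<lambda>t. x + t *\<^sub>R axis j 1) has_derivative (\<lambda>t. t *\<^sub>R axis j 1)) (at (0::real))"
      by (auto intro!: derivative_eq_intros)
    moreover have "(?\<psi> has_derivative (\<lambda>h. ?D \<bullet> h)) (at (x + 0 *\<^sub>R axis j 1))"
      using smooth_has_derivative[OF sm, of x] by simp
    ultimately have "((\<lambda>t. ?\<psi> (x + t *\<^sub>R axis j 1)) has_derivative (\<lambda>t. ?D \<bullet> (t *\<^sub>R axis j 1))) (at 0)"
      by (rule has_derivative_compose)
    then show "((\<lambda>t. ?\<psi> (x + t *\<^sub>R axis j 1)) has_real_derivative partial_deriv j ?\<psi> x) (at 0)"
      by (simp add: has_field_derivative_def inner_axis mult.commute[of _ "partial_deriv j ?\<psi> x"])
  qed (use K M test_function_measurable[OF t] in auto)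
  moreover have "(\<integral>x. partial_deriv j ?\<psi> x \<partial>lebesgue_on \<Omega>) = (\<integral>x. partial_deriv j ?\<psi> x \<partial>lborel)"
  proof (rule integral_on_eq_lborel(1)[OF \<Omega>(1)])
    show "AE x in lebesgue. indicator \<Omega> x * partial_deriv j ?\<psi> x = partial_deriv j ?\<psi> x"
    proof (rule AE_I2)
      fix x show "indicator \<Omega> x * partial_deriv j ?\<psi> x = partial_deriv j ?\<psi> x"
        using K(2) K(4)[of x j] by (cases "x \<in> K") auto
    qed
  qed (use test_function_measurable[OF t] in auto)
  moreover have "(\<integral>x. partial_deriv j ?\<psi> x \<partial>lebesgue_on \<Omega>)
     = (\<integral>x. \<zeta> x * partial_deriv j \<phi> x \<partial>lebesgue_on \<Omega>) + (\<integral>x. partial_deriv j \<zeta> x * \<phi> x \<partial>lebesgue_on \<Omega>)"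
  proof -
    note [measurable] = test_function_measurable[OF \<phi>] test_function_measurable[OF \<zeta>]
    obtain M1 where M1: "\<And>x. \<bar>\<phi> x\<bar> \<le> M1" "\<And>x. \<bar>partial_deriv j \<phi> x\<bar> \<le> M1"
      by (rule test_function_bounded[OF \<phi>, of j]) (rule that)
    obtain M2 where M2: "\<And>x. \<bar>\<zeta> x\<bar> \<le> M2" "\<And>x. \<bar>partial_deriv j \<zeta> x\<bar> \<le> M2"
      by (rule test_function_bounded[OF \<zeta>, of j]) (rule that)
    have L: "L2_on \<Omega> \<zeta>" "L2_on \<Omega> (partial_deriv j \<zeta>)"
      by (rule L2_onI_bound[OF L2_on_const[OF \<Omega>, of "1::real"], of _ M2]; use M2 in auto)+
    have "integrable (lebesgue_on \<Omega>) (\<lambda>x. \<zeta> x * partial_deriv j \<phi> x)"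
      "integrable (lebesgue_on \<Omega>) (\<lambda>x. partial_deriv j \<zeta> x * \<phi> x)"
      by (rule L2_on_mult_integrable[OF \<Omega> L(1) _ M1(2)], simp) (rule L2_on_mult_integrable[OF \<Omega> L(2) _ M1(1)], simp)
    then show ?thesis by (simp add: partial_deriv_mult s)
  qed
  ultimately show ?thesis by simp
qed

lemma L2_on_pull:
  assumes \<Omega>: "open \<Omega>" "bounded \<Omega>" and \<zeta>: "test_function \<Omega> \<zeta>" and u: "L2_on \<Omega> u"
  shows "L2_on \<Omega> (\<lambda>x. u x - c)" "L2_on \<Omega> (pull \<zeta> c e u)"
proof -
  note [measurable] = L2_on_measurable[OF u] test_function_measurable[OF \<zeta>]
  show 1: "L2_on \<Omega> (\<lambda>x. u x - c)" using L2_on_add[OF u L2_on_const[OF \<Omega>, of "- c"]] by simp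
  obtain M where M: "M > 0" "\<And>x. \<bar>\<zeta> x\<bar> \<le> M" using test_function_bounded[OF \<zeta>] by metis
  have "L2_on \<Omega> (\<lambda>x. - ((e * \<zeta> x) *\<^sub>R (u x - c)))"
  proof (rule L2_onI_bound[OF 1, of _ "\<bar>e\<bar> * M"])
    show "norm (- ((e * \<zeta> x) *\<^sub>R (u x - c))) \<le> \<bar>e\<bar> * M * norm (u x - c)" for x
      using M(2)[of x] by (auto simp: abs_mult intro!: mult_right_mono mult_left_mono)
  qed measurable
  from L2_on_add[OF u this] show "L2_on \<Omega> (pull \<zeta> c e u)" by (simp add: pull_def[abs_def])
qed

text \<open>A product rule with one smooth factor: \<open>\<phi> x * \<zeta> x\<close> is again a
  test function for \<open>u\<close>, and the two terms of its derivative account for the two terms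
  of \<open>pull_grad\<close>.\<close>

lemma weak_gradient_pull:
  assumes \<Omega>: "open \<Omega>" "bounded \<Omega>" and \<zeta>: "test_function \<Omega> \<zeta>" and u: "L2_on \<Omega> u" and G: "weak_gradient \<Omega> u G"
  shows "weak_gradient \<Omega> (pull \<zeta> c e u) (pull_grad \<zeta> c e u G)"
  unfolding weak_gradient_def
proof (intro conjI allI impI)
  have LG: "L2_on \<Omega> G" using G by (simp add: weak_gradient_def)
  note [measurable] = L2_on_measurable[OF u] L2_on_measurable[OF LG] test_function_measurable[OF \<zeta>]
  have s: "\<And>k. C_k k \<zeta>" using \<zeta> by (simp add: test_function_def)
  obtain M where M: "M > 0" "\<And>x. \<bar>\<zeta> x\<bar> \<le> M" using test_function_bounded[OF \<zeta>] by metis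
  obtain M' where M': "M' > 0" "\<And>x. norm (full_grad \<zeta> x) \<le> M'" using full_grad_bounded[OF \<zeta>] by metis
  have "L2_on \<Omega> (\<lambda>x. (1 - e * \<zeta> x) *\<^sub>R G x)"
  proof (rule L2_onI_bound[OF LG, of _ "1 + \<bar>e\<bar> * M"])
    fix x
    have "\<bar>1 - e * \<zeta> x\<bar> \<le> 1 + \<bar>e\<bar> * \<bar>\<zeta> x\<bar>" using abs_triangle_ineq4[of 1 "e * \<zeta> x"] by (simp add: abs_mult)
    also have "\<dots> \<le> 1 + \<bar>e\<bar> * M" using M(2)[of x] by (intro add_left_mono mult_left_mono) auto
    finally show "norm ((1 - e * \<zeta> x) *\<^sub>R G x) \<le> (1 + \<bar>e\<bar> * M) * norm (G x)" by (simp add: mult_right_mono)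
  qed measurable
  moreover have "L2_on \<Omega> (\<lambda>x. - (e *\<^sub>R outer (u x - c) (full_grad \<zeta> x)))"
  proof (rule L2_onI_bound[OF L2_on_pull(1)[OF \<Omega> \<zeta> u, of c], of _ "\<bar>e\<bar> * M'"])
    fix x
    have "\<bar>e\<bar> * (norm (u x - c) * norm (full_grad \<zeta> x)) \<le> \<bar>e\<bar> * (norm (u x - c) * M')"
      using M'(2)[of x] by (intro mult_left_mono) auto
    then show "norm (- (e *\<^sub>R outer (u x - c) (full_grad \<zeta> x))) \<le> \<bar>e\<bar> * M' * norm (u x - c)"
      by (simp add: norm_outer mult_ac)
  next
    show "(\<lambda>x. - (e *\<^sub>R outer (u x - c) (full_grad \<zeta> x))) \<in> borel_measurable (lebesgue_on \<Omega>)"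
      by (intro borel_measurable_uminus borel_measurable_scaleR borel_measurable_const outer_measurable
          measurable_lebesgue_on_borel[OF full_grad_measurable[OF \<zeta>]]) measurable
  qed
  ultimately show "L2_on \<Omega> (pull_grad \<zeta> c e u G)"
    unfolding pull_grad_def[abs_def] using L2_on_add by fastforce
  fix \<phi> i j assume \<phi>: "test_function \<Omega> \<phi>"
  note [measurable] = test_function_measurable[OF \<phi>]
  have sp: "\<And>k. C_k k \<phi>" using \<phi> by (simp add: test_function_def)
  obtain P where P: "P > 0" "\<And>x. \<bar>\<phi> x\<bar> \<le> P" "\<And>x. \<bar>partial_deriv j \<phi> x\<bar> \<le> P"
    by (rule test_function_bounded[OF \<phi>, of j]) (rule that)
  obtain Q where Q: "Q > 0" "\<And>x. \<bar>\<zeta> x\<bar> \<le> Q" "\<And>x. \<bar>partial_deriv j \<zeta> x\<bar> \<le> Q"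
    by (rule test_function_bounded[OF \<zeta>, of j]) (rule that)
  have PQ: "\<bar>\<phi> x * \<zeta> x\<bar> \<le> P * Q" "\<bar>\<phi> x * partial_deriv j \<zeta> x\<bar> \<le> P * Q" "\<bar>partial_deriv j \<phi> x * \<zeta> x\<bar> \<le> P * Q" for x
    unfolding abs_mult using P Q by (auto intro!: mult_mono)
  have Lu: "L2_on \<Omega> (\<lambda>x. u x $ i)" by (rule L2_on_component[OF u])
  have LGij: "L2_on \<Omega> (\<lambda>x. G x $ i $ j)" by (rule L2_on_component[OF L2_on_component[OF LG]])
  have L1: "L2_on \<Omega> (\<lambda>x. 1 :: real)" by (rule L2_on_const[OF \<Omega>])
  have i1: "integrable (lebesgue_on \<Omega>) (\<lambda>x. u x $ i * partial_deriv j \<phi> x)"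
    by (rule L2_on_mult_integrable[OF \<Omega> Lu _ P(3)]) simp
  have i2: "integrable (lebesgue_on \<Omega>) (\<lambda>x. u x $ i * (\<phi> x * partial_deriv j \<zeta> x))"
    by (rule L2_on_mult_integrable[OF \<Omega> Lu _ PQ(2)]) simp
  have i3: "integrable (lebesgue_on \<Omega>) (\<lambda>x. u x $ i * (partial_deriv j \<phi> x * \<zeta> x))"
    by (rule L2_on_mult_integrable[OF \<Omega> Lu _ PQ(3)]) simp
  have i4: "integrable (lebesgue_on \<Omega>) (\<lambda>x. G x $ i $ j * \<phi> x)"
    by (rule L2_on_mult_integrable[OF \<Omega> LGij _ P(2)]) simp
  have i5: "integrable (lebesgue_on \<Omega>) (\<lambda>x. G x $ i $ j * (\<phi> x * \<zeta> x))"
    by (rule L2_on_mult_integrable[OF \<Omega> LGij _ PQ(1)]) simp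
  have i6: "integrable (lebesgue_on \<Omega>) (\<lambda>x. \<zeta> x * partial_deriv j \<phi> x)"
  proof -
    have "integrable (lebesgue_on \<Omega>) (\<lambda>x. 1 * (partial_deriv j \<phi> x * \<zeta> x))"
      by (rule L2_on_mult_integrable[OF \<Omega> L1 _ PQ(3)]) simp
    then show ?thesis by (simp add: mult.commute)
  qed
  have i7: "integrable (lebesgue_on \<Omega>) (\<lambda>x. partial_deriv j \<zeta> x * \<phi> x)"
  proof -
    have "integrable (lebesgue_on \<Omega>) (\<lambda>x. 1 * (\<phi> x * partial_deriv j \<zeta> x))"
      by (rule L2_on_mult_integrable[OF \<Omega> L1 _ PQ(2)]) simp
    then show ?thesis by (simp add: mult.commute)
  qed
  have e1: "(\<integral>x. u x $ i * partial_deriv j \<phi> x \<partial>lebesgue_on \<Omega>) = - (\<integral>x. G x $ i $ j * \<phi> x \<partial>lebesgue_on \<Omega>)"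
    by (rule weak_gradientD[OF G \<phi>])
  have "(\<integral>x. u x $ i * partial_deriv j (\<lambda>x. \<phi> x * \<zeta> x) x \<partial>lebesgue_on \<Omega>) = - (\<integral>x. G x $ i $ j * (\<phi> x * \<zeta> x) \<partial>lebesgue_on \<Omega>)"
    by (rule weak_gradientD[OF G test_function_mult[OF \<phi> s]])
  moreover have "u x $ i * partial_deriv j (\<lambda>x. \<phi> x * \<zeta> x) x = u x $ i * (\<phi> x * partial_deriv j \<zeta> x) + u x $ i * (partial_deriv j \<phi> x * \<zeta> x)" for x
    by (simp add: partial_deriv_mult[OF sp s] distrib_left)
  ultimately have e2: "(\<integral>x. u x $ i * (\<phi> x * partial_deriv j \<zeta> x) \<partial>lebesgue_on \<Omega>) + (\<integral>x. u x $ i * (partial_deriv j \<phi> x * \<zeta> x) \<partial>lebesgue_on \<Omega>)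
      = - (\<integral>x. G x $ i $ j * (\<phi> x * \<zeta> x) \<partial>lebesgue_on \<Omega>)"
    using i2 i3 by simp
  have e3: "(\<integral>x. \<zeta> x * partial_deriv j \<phi> x \<partial>lebesgue_on \<Omega>) = - (\<integral>x. partial_deriv j \<zeta> x * \<phi> x \<partial>lebesgue_on \<Omega>)"
    by (rule test_function_integration_by_parts[OF \<Omega> \<phi> \<zeta>])
  have "pull \<zeta> c e u x $ i * partial_deriv j \<phi> x = u x $ i * partial_deriv j \<phi> x - e * (u x $ i * (partial_deriv j \<phi> x * \<zeta> x))
      + e * c $ i * (\<zeta> x * partial_deriv j \<phi> x)" for x
    by (simp add: pull_def algebra_simps)
  then have "(\<integral>x. pull \<zeta> c e u x $ i * partial_deriv j \<phi> x \<partial>lebesgue_on \<Omega>)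
    = (\<integral>x. u x $ i * partial_deriv j \<phi> x \<partial>lebesgue_on \<Omega>) - e * (\<integral>x. u x $ i * (partial_deriv j \<phi> x * \<zeta> x) \<partial>lebesgue_on \<Omega>)
      + e * c $ i * (\<integral>x. \<zeta> x * partial_deriv j \<phi> x \<partial>lebesgue_on \<Omega>)"
    using i1 i3 i6 by simp
  moreover have "pull_grad \<zeta> c e u G x $ i $ j * \<phi> x = G x $ i $ j * \<phi> x - e * (G x $ i $ j * (\<phi> x * \<zeta> x))
      - e * (u x $ i * (\<phi> x * partial_deriv j \<zeta> x)) + e * c $ i * (partial_deriv j \<zeta> x * \<phi> x)" for x
    by (simp add: pull_grad_def outer_def full_grad_def algebra_simps)
  then have "(\<integral>x. pull_grad \<zeta> c e u G x $ i $ j * \<phi> x \<partial>lebesgue_on \<Omega>)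
    = (\<integral>x. G x $ i $ j * \<phi> x \<partial>lebesgue_on \<Omega>) - e * (\<integral>x. G x $ i $ j * (\<phi> x * \<zeta> x) \<partial>lebesgue_on \<Omega>)
      - e * (\<integral>x. u x $ i * (\<phi> x * partial_deriv j \<zeta> x) \<partial>lebesgue_on \<Omega>) + e * c $ i * (\<integral>x. partial_deriv j \<zeta> x * \<phi> x \<partial>lebesgue_on \<Omega>)"
    using i2 i4 i5 i7 by simp
  \<comment> \<open>What remains is arithmetic in seven integrals, stated for arbitrary numbers so
    that the integrals stay opaque.\<close>
  moreover have "P = - R"
    if "R = I4 - e * I5 - e * I2 + e * c $ i * I7" "P = I1 - e * I3 + e * c $ i * I6"
      "I1 = - I4" "I2 + I3 = - I5" "I6 = - I7" for P R I1 I2 I3 I4 I5 I6 I7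
  proof -
    have "e * (I2 + I3) = e * - I5" using that(4) by (rule arg_cong)
    then have "e * I2 + e * I3 = - (e * I5)" by (simp only: distrib_left mult_minus_right)
    then show ?thesis unfolding that(1,2) that(3,5) by simp
  qed
  ultimately show "(\<integral>x. pull \<zeta> c e u x $ i * partial_deriv j \<phi> x \<partial>lebesgue_on \<Omega>) = - (\<integral>x. pull_grad \<zeta> c e u G x $ i $ j * \<phi> x \<partial>lebesgue_on \<Omega>)"
    using e1 e2 e3 by blast
qed

lemma pull_W12:
  assumes \<Omega>: "open \<Omega>" "bounded \<Omega>" and \<zeta>: "test_function \<Omega> \<zeta>" and u: "u \<in> W12 \<Omega>"
  shows "pull \<zeta> c e u \<in> W12 \<Omega>"
    "AE x in lebesgue_on \<Omega>. grad \<Omega> (pull \<zeta> c e u) x = pull_grad \<zeta> c e u (grad \<Omega> u) x"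
proof -
  have L: "L2_on \<Omega> u" using u by (simp add: W12_def)
  note w = weak_gradient_pull[OF \<Omega> \<zeta> L weak_gradient_grad[OF u], of c e]
  show 1: "pull \<zeta> c e u \<in> W12 \<Omega>" unfolding W12_def using L2_on_pull(2)[OF \<Omega> \<zeta> L] w by blast
  show "AE x in lebesgue_on \<Omega>. grad \<Omega> (pull \<zeta> c e u) x = pull_grad \<zeta> c e u (grad \<Omega> u) x"
    by (rule weak_gradient_unique[OF \<Omega> weak_gradient_grad[OF 1] w])
qed

lemma grad_measurable: "u \<in> W12 \<Omega> \<Longrightarrow> grad \<Omega> u \<in> borel_measurable (lebesgue_on \<Omega>)"
  using weak_gradient_grad[of u \<Omega>] by (auto simp: weak_gradient_def L2_on_def)

lemma tendsto_0_ennreal_bound: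
  fixes f g :: "nat \<Rightarrow> ennreal"
  assumes "\<And>n. f n \<le> g n" "g \<longlonglongrightarrow> 0"
  shows "f \<longlonglongrightarrow> 0"
  by (rule tendsto_sandwich[OF _ _ tendsto_const assms(2)]) (use assms(1) in auto)

text \<open>The sequence approximating \<open>u\<close> is pulled in the same way. On the frontier
  \<open>\<zeta>\<close> vanishes and the boundary values are untouched. Inside, differences are
  multiplied by a factor in \<open>[0, 1]\<close>, and the gradient gains a term bounded by the
  difference of values, which also tends to zero in mean square.\<close>

lemma has_trace_pull:
  assumes \<Omega>: "open \<Omega>" "bounded \<Omega>" and \<zeta>: "test_function \<Omega> \<zeta>" "\<And>x. 0 \<le> \<zeta> x" "\<And>x. \<zeta> x \<le> 1"
    and e: "0 \<le> e" "e \<le> 1" and u: "u \<in> W12 \<Omega>" and tr: "has_trace \<Omega> u w"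
  shows "has_trace \<Omega> (pull \<zeta> c e u) w"
proof -
  obtain \<phi> where \<phi>: "\<And>n. \<phi> n \<in> W12 \<Omega>" "\<And>n. continuous_on (closure \<Omega>) (\<phi> n)"
    "(\<lambda>n. \<integral>\<^sup>+x. ennreal ((norm (\<phi> n x - u x))\<^sup>2) \<partial>lebesgue_on \<Omega>) \<longlonglongrightarrow> 0"
    "(\<lambda>n. \<integral>\<^sup>+x. ennreal ((norm (grad \<Omega> (\<phi> n) x - grad \<Omega> u x))\<^sup>2) \<partial>lebesgue_on \<Omega>) \<longlonglongrightarrow> 0"
    "(\<lambda>n. \<integral>\<^sup>+x\<in>frontier \<Omega>. ennreal ((norm (\<phi> n x - w x))\<^sup>2) \<partial>hausdorff1) \<longlonglongrightarrow> 0"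
    using tr unfolding has_trace_def by blast
  have s: "\<And>k. C_k k \<zeta>" using \<zeta> by (simp add: test_function_def)
  obtain K where K: "compact K" "K \<subseteq> \<Omega>" "\<And>x. x \<notin> K \<Longrightarrow> \<zeta> x = 0" by (rule test_functionD[OF \<zeta>(1)]) (rule that)
  obtain M where M: "M > 0" "\<And>x. norm (full_grad \<zeta> x) \<le> M" using full_grad_bounded[OF \<zeta>(1)] by metis
  have \<tau>: "0 \<le> 1 - e * \<zeta> x" "1 - e * \<zeta> x \<le> 1" for x
    using e \<zeta>(2,3)[of x] by (auto simp: mult_le_one)
  have m: "\<phi> n \<in> borel_measurable (lebesgue_on \<Omega>)" "u \<in> borel_measurable (lebesgue_on \<Omega>)"
    "grad \<Omega> (\<phi> n) \<in> borel_measurable (lebesgue_on \<Omega>)" "grad \<Omega> u \<in> borel_measurable (lebesgue_on \<Omega>)" for n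
    using grad_measurable[OF \<phi>(1)] grad_measurable[OF u] \<phi>(1)[of n] u
    by (auto intro: L2_on_measurable simp: W12_def)
  note [measurable] = m
  show ?thesis unfolding has_trace_def
  proof (intro exI[of _ "\<lambda>n. pull \<zeta> c e (\<phi> n)"] conjI allI)
    fix n
    show "pull \<zeta> c e (\<phi> n) \<in> W12 \<Omega>" by (rule pull_W12(1)[OF \<Omega> \<zeta>(1) \<phi>(1)])
    show "continuous_on (closure \<Omega>) (pull \<zeta> c e (\<phi> n))"
      unfolding pull_def[abs_def] by (intro continuous_intros \<phi>(2) smooth_continuous s)
  next
    show "(\<lambda>n. \<integral>\<^sup>+x. ennreal ((norm (pull \<zeta> c e (\<phi> n) x - pull \<zeta> c e u x))\<^sup>2) \<partial>lebesgue_on \<Omega>) \<longlonglongrightarrow> 0"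
    proof (rule tendsto_0_ennreal_bound[OF nn_integral_mono \<phi>(3)])
      fix n x
      have "pull \<zeta> c e (\<phi> n) x - pull \<zeta> c e u x = (1 - e * \<zeta> x) *\<^sub>R (\<phi> n x - u x)"
        by (simp add: pull_def algebra_simps)
      then have "norm (pull \<zeta> c e (\<phi> n) x - pull \<zeta> c e u x) \<le> norm (\<phi> n x - u x)"
        using \<tau>[of x] by (simp add: mult_left_le_one_le)
      then show "ennreal ((norm (pull \<zeta> c e (\<phi> n) x - pull \<zeta> c e u x))\<^sup>2) \<le> ennreal ((norm (\<phi> n x - u x))\<^sup>2)"
        by (intro ennreal_leI power_mono) auto
    qed
  next
    show "(\<lambda>n. \<integral>\<^sup>+x. ennreal ((norm (grad \<Omega> (pull \<zeta> c e (\<phi> n)) x - grad \<Omega> (pull \<zeta> c e u) x))\<^sup>2) \<partial>lebesgue_on \<Omega>) \<longlonglongrightarrow> 0"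
    proof (rule tendsto_0_ennreal_bound)
      let ?a = "\<lambda>n x. ennreal ((norm (grad \<Omega> (\<phi> n) x - grad \<Omega> u x))\<^sup>2)" and ?b = "\<lambda>n x. ennreal ((norm (\<phi> n x - u x))\<^sup>2)"
      show "(\<lambda>n. 2 * (\<integral>\<^sup>+x. ?a n x \<partial>lebesgue_on \<Omega>) + ennreal (2 * M\<^sup>2) * (\<integral>\<^sup>+x. ?b n x \<partial>lebesgue_on \<Omega>)) \<longlonglongrightarrow> 0"
        using tendsto_add[OF ennreal_tendsto_cmult[OF _ \<phi>(4), of 2] ennreal_tendsto_cmult[OF _ \<phi>(3), of "ennreal (2 * M\<^sup>2)"]] by simp
      fix n
      have "(\<integral>\<^sup>+x. ennreal ((norm (grad \<Omega> (pull \<zeta> c e (\<phi> n)) x - grad \<Omega> (pull \<zeta> c e u) x))\<^sup>2) \<partial>lebesgue_on \<Omega>)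
         \<le> (\<integral>\<^sup>+x. 2 * ?a n x + ennreal (2 * M\<^sup>2) * ?b n x \<partial>lebesgue_on \<Omega>)"
      proof (rule nn_integral_mono_AE)
        show "AE x in lebesgue_on \<Omega>. ennreal ((norm (grad \<Omega> (pull \<zeta> c e (\<phi> n)) x - grad \<Omega> (pull \<zeta> c e u) x))\<^sup>2)
           \<le> 2 * ?a n x + ennreal (2 * M\<^sup>2) * ?b n x"
          using pull_W12(2)[OF \<Omega> \<zeta>(1) \<phi>(1)[of n], of c e] pull_W12(2)[OF \<Omega> \<zeta>(1) u, of c e]
        proof eventually_elim
          case (elim x)
          let ?p = "grad \<Omega> (\<phi> n) x - grad \<Omega> u x" and ?q = "\<phi> n x - u x"
          have "pull_grad \<zeta> c e (\<phi> n) (grad \<Omega> (\<phi> n)) x - pull_grad \<zeta> c e u (grad \<Omega> u) x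
             = (1 - e * \<zeta> x) *\<^sub>R ?p - e *\<^sub>R outer ?q (full_grad \<zeta> x)"
            by (simp add: pull_grad_def outer_def vec_eq_iff algebra_simps)
          then have "norm (grad \<Omega> (pull \<zeta> c e (\<phi> n)) x - grad \<Omega> (pull \<zeta> c e u) x)
             \<le> norm ((1 - e * \<zeta> x) *\<^sub>R ?p) + norm (e *\<^sub>R outer ?q (full_grad \<zeta> x))"
            unfolding elim by (simp only: norm_triangle_ineq4)
          also have "\<dots> \<le> norm ?p + norm ?q * M"
          proof (rule add_mono)
            show "norm ((1 - e * \<zeta> x) *\<^sub>R ?p) \<le> norm ?p" using \<tau>[of x] by (simp add: mult_left_le_one_le)
            have "norm (e *\<^sub>R outer ?q (full_grad \<zeta> x)) = e * (norm ?q * norm (full_grad \<zeta> x))" using e by (simp add: norm_outer)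
            also have "\<dots> \<le> 1 * (norm ?q * M)" using e M(2)[of x] by (intro mult_mono) auto
            finally show "norm (e *\<^sub>R outer ?q (full_grad \<zeta> x)) \<le> norm ?q * M" by simp
          qed
          finally have "(norm (grad \<Omega> (pull \<zeta> c e (\<phi> n)) x - grad \<Omega> (pull \<zeta> c e u) x))\<^sup>2 \<le> (norm ?p + norm ?q * M)\<^sup>2"
            by (rule power_mono) simp
          also have "\<dots> \<le> 2 * (norm ?p)\<^sup>2 + (2 * M\<^sup>2) * (norm ?q)\<^sup>2"
            using square_sum2[of "norm ?p" "norm ?q * M"] by (simp add: power_mult_distrib mult_ac)
          finally have "ennreal ((norm (grad \<Omega> (pull \<zeta> c e (\<phi> n)) x - grad \<Omega> (pull \<zeta> c e u) x))\<^sup>2)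
             \<le> ennreal (2 * (norm ?p)\<^sup>2 + (2 * M\<^sup>2) * (norm ?q)\<^sup>2)" by (rule ennreal_leI)
          also have "\<dots> = 2 * ennreal ((norm ?p)\<^sup>2) + ennreal (2 * M\<^sup>2) * ennreal ((norm ?q)\<^sup>2)"
            by (simp add: ennreal_plus ennreal_mult)
          finally show ?case .
        qed
      qed
      also have "\<dots> = 2 * (\<integral>\<^sup>+x. ?a n x \<partial>lebesgue_on \<Omega>) + ennreal (2 * M\<^sup>2) * (\<integral>\<^sup>+x. ?b n x \<partial>lebesgue_on \<Omega>)"
        by (subst nn_integral_add) (auto simp: nn_integral_cmult)
      finally show "(\<integral>\<^sup>+x. ennreal ((norm (grad \<Omega> (pull \<zeta> c e (\<phi> n)) x - grad \<Omega> (pull \<zeta> c e u) x))\<^sup>2) \<partial>lebesgue_on \<Omega>)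
         \<le> 2 * (\<integral>\<^sup>+x. ?a n x \<partial>lebesgue_on \<Omega>) + ennreal (2 * M\<^sup>2) * (\<integral>\<^sup>+x. ?b n x \<partial>lebesgue_on \<Omega>)" .
    qed
  next
    have "\<zeta> x = 0" if "x \<in> frontier \<Omega>" for x
      using that K \<Omega>(1) frontier_disjoint_eq[of \<Omega>] by blast
    then have "pull \<zeta> c e (\<phi> n) x = \<phi> n x" if "x \<in> frontier \<Omega>" for n x using that by (simp add: pull_def)
    then have "(\<lambda>n. \<integral>\<^sup>+x\<in>frontier \<Omega>. ennreal ((norm (pull \<zeta> c e (\<phi> n) x - w x))\<^sup>2) \<partial>hausdorff1)
       = (\<lambda>n. \<integral>\<^sup>+x\<in>frontier \<Omega>. ennreal ((norm (\<phi> n x - w x))\<^sup>2) \<partial>hausdorff1)"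
      by (intro ext nn_integral_cong) (auto simp: indicator_def)
    then show "(\<lambda>n. \<integral>\<^sup>+x\<in>frontier \<Omega>. ennreal ((norm (pull \<zeta> c e (\<phi> n) x - w x))\<^sup>2) \<partial>hausdorff1) \<longlonglongrightarrow> 0"
      using \<phi>(5) by simp
  qed
qed

subsection \<open>The stored energy density\<close>

text \<open>A real-valued form of \<open>h_fun\<close> for positive arguments, so that differences
  can be taken.\<close>

definition h_real :: "real \<Rightarrow> real \<Rightarrow> real \<Rightarrow> real \<Rightarrow> (real \<Rightarrow> real) \<Rightarrow> real \<Rightarrow> real" where
  "h_real l m c1 c2 \<theta> s = (if s < c1 then \<bar>ln s\<bar> else if s \<le> c2 then \<theta> s else l * s + m)"

lemma h_fun_eq: "s > 0 \<Longrightarrow> h_fun l m c1 c2 \<theta> s = ennreal (h_real l m c1 c2 \<theta> s)"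
  by (simp add: h_fun_def h_real_def)

lemma mono_on_glue:
  fixes f :: "real \<Rightarrow> real"
  assumes "mono_on (S \<inter> {..c}) f" "mono_on (S \<inter> {c..}) f" "c \<in> S"
  shows "mono_on S f"
proof (rule mono_onI)
  fix s t assume st: "s \<in> S" "t \<in> S" "s \<le> t"
  consider "t \<le> c" | "c \<le> s" | "s \<le> c" "c \<le> t" by linarith
  then show "f s \<le> f t"
  proof cases
    case 1 then show ?thesis using st by (intro mono_onD[OF assms(1)]) auto
  next
    case 2 then show ?thesis using st by (intro mono_onD[OF assms(2)]) auto
  next
    case 3
    have "f s \<le> f c" using st 3 assms(3) by (intro mono_onD[OF assms(1)]) auto
    also have "f c \<le> f t" using st 3 assms(3) by (intro mono_onD[OF assms(2)]) auto
    finally show ?thesis .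
  qed
qed

lemma mono_on_Icc_DERIV:
  fixes f :: "real \<Rightarrow> real"
  assumes "continuous_on {a..b} f" "\<And>x. a < x \<Longrightarrow> x < b \<Longrightarrow> (f has_real_derivative f' x) (at x)"
    "\<And>x. a < x \<Longrightarrow> x < b \<Longrightarrow> f' x \<ge> 0"
  shows "mono_on {a..b} f"
proof (rule mono_onI)
  fix s t assume "s \<in> {a..b}" "t \<in> {a..b}" "s \<le> t"
  note st = this
  show "f s \<le> f t"
  proof (rule DERIV_nonneg_imp_increasing_open[of s t f])
    show "\<exists>y. (f has_real_derivative y) (at x) \<and> 0 \<le> y" if "s < x" "x < t" for x
      using assms(2)[of x] assms(3)[of x] st that by (intro exI[of _ "f' x"]) auto
  qed (use st assms(1) in \<open>auto intro: continuous_on_subset\<close>)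
qed

context
  fixes l m c1 c2 :: real and \<theta> :: "real \<Rightarrow> real"
  assumes constants: "l > 0" "m > 0" "0 < c1" "c1 < 1" "1 < c2"
    and theta: "theta_conditions l m c1 c2 \<theta>"
begin

lemma h_real_nonneg: "s > 0 \<Longrightarrow> h_real l m c1 c2 \<theta> s \<ge> 0"
  using theta constants by (auto simp: h_real_def theta_conditions_def less_imp_le)

lemma theta_continuous: "continuous_on {c1..c2} \<theta>"
  using theta unfolding theta_conditions_def by (blast intro: DERIV_continuous_on)

lemma h_fun_measurable: "h_fun l m c1 c2 \<theta> \<in> borel_measurable borel"
proof -
  have [measurable]: "(\<lambda>s. indicator {c1..c2} s *\<^sub>R \<theta> s) \<in> borel_measurable borel"
    by (intro borel_measurable_continuous_on_indicator theta_continuous) simp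
  have "h_fun l m c1 c2 \<theta> = (\<lambda>s. if s \<le> 0 then \<infinity> else if s < c1 then ennreal \<bar>ln s\<bar>
      else if s \<le> c2 then ennreal (indicator {c1..c2} s *\<^sub>R \<theta> s) else ennreal (l * s + m))"
    by (auto simp: fun_eq_iff h_fun_def)
  then show ?thesis by simp
qed

text \<open>Integrated forms of \<open>h' \<le> l\<close> and
  \<open>h' \<ge> - 1 / (c1 * s)\<close>. For the second one, the slope is \<open>- 1 / s\<close>
  below \<open>c1 < 1\<close>, at least \<open>- 1 / c1\<close> from there up to 1, and nonnegative
  beyond. As monotonicity of \<open>l * s - h\<close> and of \<open>h + ln s / c1\<close>, both can
  be checked on three pieces and glued at \<open>c1\<close> and \<open>c2\<close>.\<close>

lemma h_real_bounds:
  assumes "0 < s" "s \<le> t"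
  shows "h_real l m c1 c2 \<theta> t - h_real l m c1 c2 \<theta> s \<le> l * (t - s)"
    "h_real l m c1 c2 \<theta> s - h_real l m c1 c2 \<theta> t \<le> (1 / c1) * (ln t - ln s)"
proof -
  let ?H = "h_real l m c1 c2 \<theta>"
  have th: "\<theta> c1 = - ln c1" "\<theta> c2 = l * c2 + m" using theta constants by (auto simp: theta_conditions_def)
  obtain \<theta>' \<theta>'' where d: "\<And>s. s \<in> {c1..c2} \<Longrightarrow> (\<theta> has_real_derivative \<theta>' s) (at s within {c1..c2})"
    "continuous_on {c1..c2} \<theta>'" "\<And>s. s \<in> {c1<..<c2} \<Longrightarrow> (\<theta>' has_real_derivative \<theta>'' s) (at s)"
    "\<And>s. s \<in> {c1<..<c2} \<Longrightarrow> \<theta>'' s > 0" "\<theta>' c1 = - 1 / c1" "\<theta>' c2 = l" "\<theta>' 1 = 0"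
    using theta unfolding theta_conditions_def by blast
  \<comment> \<open>By convexity, the prescribed values of \<open>\<theta>'\<close> at
    \<open>c1\<close>, 1 and \<open>c2\<close> bound it in between.\<close>
  have m': "mono_on {c1..c2} \<theta>'"
    by (rule mono_on_Icc_DERIV[OF d(2) d(3)]) (use d(4) in \<open>auto intro: less_imp_le\<close>)
  have d': "(\<theta> has_real_derivative \<theta>' s) (at s)" if "c1 < s" "s < c2" for s
    using d(1)[of s] that by (simp add: at_within_Icc_at)
  have b1: "\<theta>' s \<le> l" if "c1 < s" "s < c2" for s
    using mono_onD[OF m', of s c2] that d(6) by auto
  have b2: "\<theta>' s + (1 / c1) * (1 / s) \<ge> 0" if s: "c1 < s" "s < c2" for s
  proof (cases "s \<le> 1")
    case True
    have "- 1 / c1 \<le> \<theta>' s" using mono_onD[OF m', of c1 s] s d(5) by auto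
    moreover have "1 \<le> 1 / s" using True s constants by simp
    then have "(1 / c1) * 1 \<le> (1 / c1) * (1 / s)" using constants by (intro mult_left_mono) auto
    ultimately show ?thesis by simp
  next
    case False
    have "0 \<le> \<theta>' s" using mono_onD[OF m', of 1 s] s d(7) False constants by auto
    moreover have "0 \<le> (1 / c1) * (1 / s)" using s constants by simp
    ultimately show ?thesis by linarith
  qed
  have e1: "?H s = - ln s" if "0 < s" "s \<le> c1" for s
    using that constants th by (cases "s = c1") (auto simp: h_real_def)
  have e2: "?H s = \<theta> s" if "s \<in> {c1..c2}" for s using that by (auto simp: h_real_def)
  have e3: "?H s = l * s + m" if "c2 \<le> s" for s
    using that constants th by (cases "s = c2") (auto simp: h_real_def)
  have A: "mono_on {0<..} (\<lambda>s. l * s - ?H s)"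
  proof (rule mono_on_glue[where c = c1])
    show "mono_on ({0<..} \<inter> {..c1}) (\<lambda>s. l * s - ?H s)"
    proof (rule mono_onI)
      fix s t assume "s \<in> {0<..} \<inter> {..c1}" "t \<in> {0<..} \<inter> {..c1}" "s \<le> t"
      then show "l * s - ?H s \<le> l * t - ?H t" using e1[of s] e1[of t] constants by (auto intro!: add_mono)
    qed
    show "mono_on ({0<..} \<inter> {c1..}) (\<lambda>s. l * s - ?H s)"
    proof (rule mono_on_glue[where c = c2])
      have "mono_on {c1..c2} (\<lambda>s. l * s - \<theta> s)"
        by (rule mono_on_Icc_DERIV[where f' = "\<lambda>s. l - \<theta>' s"])
          (use b1 in \<open>auto intro!: continuous_intros theta_continuous derivative_eq_intros d'\<close>)
      then have "mono_on {c1..c2} (\<lambda>s. l * s - ?H s)" using e2 by (auto simp: mono_on_def)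
      moreover have "{0<..} \<inter> {c1..} \<inter> {..c2} = {c1..c2}" using constants by auto
      ultimately show "mono_on ({0<..} \<inter> {c1..} \<inter> {..c2}) (\<lambda>s. l * s - ?H s)" by simp
      show "mono_on ({0<..} \<inter> {c1..} \<inter> {c2..}) (\<lambda>s. l * s - ?H s)" using e3 by (auto simp: mono_on_def)
    qed (use constants in auto)
  qed (use constants in auto)
  have B: "mono_on {0<..} (\<lambda>s. ?H s + (1 / c1) * ln s)"
  proof (rule mono_on_glue[where c = c1])
    show "mono_on ({0<..} \<inter> {..c1}) (\<lambda>s. ?H s + (1 / c1) * ln s)"
    proof (rule mono_onI)
      fix s t assume st: "s \<in> {0<..} \<inter> {..c1}" "t \<in> {0<..} \<inter> {..c1}" "s \<le> t"
      have "(1 / c1 - 1) * ln s \<le> (1 / c1 - 1) * ln t" using st constants by (intro mult_left_mono) auto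
      then show "?H s + (1 / c1) * ln s \<le> ?H t + (1 / c1) * ln t" using st e1[of s] e1[of t] by (simp add: algebra_simps)
    qed
    show "mono_on ({0<..} \<inter> {c1..}) (\<lambda>s. ?H s + (1 / c1) * ln s)"
    proof (rule mono_on_glue[where c = c2])
      have "mono_on {c1..c2} (\<lambda>s. \<theta> s + (1 / c1) * ln s)"
      proof (rule mono_on_Icc_DERIV[where f' = "\<lambda>s. \<theta>' s + (1 / c1) * (1 / s)"])
        show "continuous_on {c1..c2} (\<lambda>s. \<theta> s + (1 / c1) * ln s)"
          using constants by (intro continuous_intros theta_continuous) auto
        fix s assume s: "c1 < s" "s < c2"
        show "((\<lambda>s. \<theta> s + (1 / c1) * ln s) has_real_derivative \<theta>' s + (1 / c1) * (1 / s)) (at s)"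
          using s constants by (intro DERIV_add DERIV_cmult d' DERIV_ln_divide) auto
        show "0 \<le> \<theta>' s + (1 / c1) * (1 / s)" by (rule b2[OF s])
      qed
      then have "mono_on {c1..c2} (\<lambda>s. ?H s + (1 / c1) * ln s)" using e2 by (auto simp: mono_on_def)
      moreover have "{0<..} \<inter> {c1..} \<inter> {..c2} = {c1..c2}" using constants by auto
      ultimately show "mono_on ({0<..} \<inter> {c1..} \<inter> {..c2}) (\<lambda>s. ?H s + (1 / c1) * ln s)" by simp
      show "mono_on ({0<..} \<inter> {c1..} \<inter> {c2..}) (\<lambda>s. ?H s + (1 / c1) * ln s)"
      proof (rule mono_onI)
        fix s t assume st: "s \<in> {0<..} \<inter> {c1..} \<inter> {c2..}" "t \<in> {0<..} \<inter> {c1..} \<inter> {c2..}" "s \<le> t"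
        have "(1 / c1) * ln s \<le> (1 / c1) * ln t" "l * s \<le> l * t" using st constants by (auto intro!: mult_left_mono divide_right_mono)
        then show "?H s + (1 / c1) * ln s \<le> ?H t + (1 / c1) * ln t" using st e3[of s] e3[of t] by simp
      qed
    qed (use constants in auto)
  qed (use constants in auto)
  show "?H t - ?H s \<le> l * (t - s)" using mono_onD[OF A, of s t] assms by (simp add: algebra_simps)
  show "?H s - ?H t \<le> (1 / c1) * (ln t - ln s)" using mono_onD[OF B, of s t] assms by (simp add: algebra_simps)
qed

text \<open>The matrix determinant lemma: the perturbation has rank at most one and determinant
  zero, so it enters linearly, without a term in \<open>e^2\<close>.\<close>

lemma det_pull_matrix:
  "det (\<tau> *\<^sub>R A - e *\<^sub>R outer q d) = \<tau>\<^sup>2 * det A - e * \<tau> * ((adj2 A *v q) \<bullet> d)" for A :: "real^2^2"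
  by (simp add: det_2 adj2_def cof2_def outer_def transpose_def matrix_vector_mult_def inner_vec_def sum_2
      power2_eq_square algebra_simps)

text \<open>In the Frobenius norm, the gap between the squares of the two sides is itself an
  explicit sum of two squares.\<close>

lemma norm_adj2_mult_le: "norm (adj2 A *v q) \<le> norm A * norm q"
proof -
  have "(norm (adj2 A *v q))\<^sup>2 \<le> (norm A * norm q)\<^sup>2"
  proof -
    have "(norm A * norm q)\<^sup>2 - (norm (adj2 A *v q))\<^sup>2 = (A$2$2 * q$2 + A$1$2 * q$1)\<^sup>2 + (A$2$1 * q$2 + A$1$1 * q$1)\<^sup>2"
      unfolding power_mult_distrib power2_norm_eq_inner
      by (simp add: inner_vec_def sum_2 adj2_def cof2_def transpose_def matrix_vector_mult_def power2_eq_square algebra_simps)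
    also have "\<dots> \<ge> 0" by simp
    finally show ?thesis by simp
  qed
  then show ?thesis by (rule power2_le_imp_le) simp
qed

text \<open>The passage from \<open>det A\<close> to \<open>det B\<close> goes through
  \<open>\<tau>^2 * det A\<close>. The decrease by \<open>\<tau>^2\<close> costs a logarithm,
  bounded linearly in \<open>e\<close>; the increase by the twist term \<open>p\<close> costs at
  most the slope \<open>l\<close>. The gain sits in the Dirichlet part and comes from
  \<open>\<tau>^2 \<le> \<tau> = 1 - e * z\<close>. The last term has a spare factor
  \<open>e\<close> and disappears in the limit.\<close>

lemma density_estimate:
  fixes A :: "real^2^2" and q d :: "real^2"
  assumes lam: "lam > 0" and e: "0 < e" "e \<le> 1 / 2" and z: "0 \<le> z" "z \<le> 1" and det: "det A > 0"
    and T: "(adj2 A *v q) \<bullet> d \<le> 0"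
  defines "B \<equiv> (1 - e * z) *\<^sub>R A - e *\<^sub>R outer q d"
  shows "det B > 0"
    "lam * (norm B)\<^sup>2 + h_real l m c1 c2 \<theta> (det B) + e * (lam * z * (norm A)\<^sup>2)
      \<le> lam * (norm A)\<^sup>2 + h_real l m c1 c2 \<theta> (det A)
        + e * ((4 / c1 * z + (2 * lam + l) * (norm A * (norm q * norm d))) + e * (lam * (norm q * norm d)\<^sup>2))"
proof -
  let ?H = "h_real l m c1 c2 \<theta>"
  define \<tau> where "\<tau> = 1 - e * z"
  have ez: "0 \<le> e * z" "e * z \<le> e" using e z by (auto simp: mult_left_le)
  have \<tau>: "1 / 2 \<le> \<tau>" "\<tau> \<le> 1" using ez e unfolding \<tau>_def by linarith+
  define p where "p = e * \<tau> * (- ((adj2 A *v q) \<bullet> d))"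
  have p0: "p \<ge> 0" unfolding p_def using e \<tau> T by (intro mult_nonneg_nonneg) auto
  have "\<bar>(adj2 A *v q) \<bullet> d\<bar> \<le> norm (adj2 A *v q) * norm d" by (rule Cauchy_Schwarz_ineq2)
  also have "\<dots> \<le> norm A * norm q * norm d" by (intro mult_right_mono norm_adj2_mult_le) simp
  finally have ad: "- ((adj2 A *v q) \<bullet> d) \<le> norm A * (norm q * norm d)" by (simp add: mult.assoc)
  have "e * \<tau> * (- ((adj2 A *v q) \<bullet> d)) \<le> e * 1 * (norm A * (norm q * norm d))"
    using e \<tau> T by (intro mult_mono ad) auto
  then have p1: "p \<le> e * (norm A * (norm q * norm d))" by (simp add: p_def)
  have dB: "det B = \<tau>\<^sup>2 * det A + p" by (simp add: B_def \<tau>_def[symmetric] det_pull_matrix p_def)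
  have pos: "\<tau>\<^sup>2 * det A > 0" using det \<tau> by simp
  then show "det B > 0" using dB p0 by simp
  have "?H (det B) \<le> ?H (\<tau>\<^sup>2 * det A) + l * p"
    using h_real_bounds(1)[OF pos, of "det B"] p0 dB by simp
  also have "?H (\<tau>\<^sup>2 * det A) \<le> ?H (det A) + (1 / c1) * (ln (det A) - ln (\<tau>\<^sup>2 * det A))"
  proof -
    have "\<tau>\<^sup>2 \<le> 1" using \<tau> by (simp add: power_le_one)
    then have "\<tau>\<^sup>2 * det A \<le> det A" using det by (simp add: mult_left_le_one_le)
    from h_real_bounds(2)[OF pos this] show ?thesis by linarith
  qed
  also have "ln (det A) - ln (\<tau>\<^sup>2 * det A) = - 2 * ln \<tau>" using det \<tau> by (simp add: ln_mult ln_realpow)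
  also have "(1 / c1) * (- 2 * ln \<tau>) \<le> e * (4 / c1 * z)"
  proof -
    \<comment> \<open>Since \<open>\<tau> \<ge> 1 / 2\<close>, the chain ends at
      \<open>2 * e * z\<close>; the square of \<open>\<tau>\<close> doubles this, which is the 4 in
      \<open>4 / c1 * z\<close>.\<close>
    have "- ln \<tau> = ln (1 / \<tau>)" using \<tau> by (simp add: ln_div)
    also have "\<dots> \<le> 1 / \<tau> - 1" using \<tau> by (intro ln_le_minus_one) auto
    also have "\<dots> = e * z / \<tau>" using \<tau> by (simp add: \<tau>_def field_simps)
    also have "\<dots> \<le> e * z / (1 / 2)" using \<tau> ez by (intro divide_left_mono) auto
    finally have "- 2 * ln \<tau> \<le> 4 * (e * z)" by simp
    then have "(1 / c1) * (- 2 * ln \<tau>) \<le> (1 / c1) * (4 * (e * z))" using constants by (intro mult_left_mono) auto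
    then show ?thesis by (simp add: mult_ac)
  qed
  also have "l * p \<le> l * (e * (norm A * (norm q * norm d)))" using p1 constants by (intro mult_left_mono) auto
  finally have hB: "?H (det B) \<le> ?H (det A) + e * (4 / c1 * z) + l * (e * (norm A * (norm q * norm d)))" by simp
  have "norm B \<le> norm (\<tau> *\<^sub>R A) + norm (e *\<^sub>R outer q d)" unfolding B_def \<tau>_def by (rule norm_triangle_ineq4)
  also have "\<dots> = \<tau> * norm A + e * (norm q * norm d)" using \<tau> e by (simp add: norm_outer)
  finally have "(norm B)\<^sup>2 \<le> (\<tau> * norm A + e * (norm q * norm d))\<^sup>2" by (rule power_mono) simp
  also have "\<dots> = \<tau>\<^sup>2 * (norm A)\<^sup>2 + \<tau> * (2 * e * (norm A * (norm q * norm d))) + e * (e * (norm q * norm d)\<^sup>2)"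
    by (simp add: power2_eq_square algebra_simps)
  also have "\<dots> \<le> (1 - e * z) * (norm A)\<^sup>2 + 1 * (2 * e * (norm A * (norm q * norm d))) + e * (e * (norm q * norm d)\<^sup>2)"
  proof (intro add_mono mult_right_mono)
    have "\<tau> * \<tau> \<le> \<tau> * 1" using \<tau> by (intro mult_left_mono) auto
    then show "\<tau>\<^sup>2 \<le> 1 - e * z" by (simp add: \<tau>_def[symmetric] power2_eq_square)
  qed (use \<tau> e in auto)
  finally have "lam * (norm B)\<^sup>2 \<le> lam * ((1 - e * z) * (norm A)\<^sup>2 + 1 * (2 * e * (norm A * (norm q * norm d))) + e * (e * (norm q * norm d)\<^sup>2))"
    using lam by (intro mult_left_mono) auto
  with hB show "lam * (norm B)\<^sup>2 + h_real l m c1 c2 \<theta> (det B) + e * (lam * z * (norm A)\<^sup>2)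
      \<le> lam * (norm A)\<^sup>2 + h_real l m c1 c2 \<theta> (det A)
        + e * ((4 / c1 * z + (2 * lam + l) * (norm A * (norm q * norm d))) + e * (lam * (norm q * norm d)\<^sup>2))"
    by (simp add: algebra_simps)
qed

end

subsection \<open>The Caccioppoli inequality\<close>

text \<open>Lets the size of a variation tend to zero. Finiteness of \<open>K\<close> matters
  because \<open>ennreal e * \<infinity>\<close> stays infinite for every positive
  \<open>e\<close>.\<close>

lemma ennreal_le_of_le_add_small:
  fixes x y K :: ennreal
  assumes K: "K < \<infinity>" and e0: "e0 > 0" and le: "\<And>e. 0 < e \<Longrightarrow> e \<le> e0 \<Longrightarrow> x \<le> y + ennreal e * K"
  shows "x \<le> y"
proof (rule ennreal_le_epsilon)
  fix d :: real assume d: "0 < d"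
  obtain k where k: "K = ennreal k" "k \<ge> 0" using K by (cases K) auto
  define e where "e = min e0 (d / (k + 1))"
  have e: "0 < e" "e \<le> e0" "e \<le> d / (k + 1)" using e0 d k by (auto simp: e_def)
  have "e * k \<le> d / (k + 1) * k" using e k by (intro mult_right_mono) auto
  also have "\<dots> \<le> d" using d k by (simp add: field_simps)
  finally have "ennreal e * K \<le> ennreal d" using e k by (simp add: ennreal_mult[symmetric] ennreal_leI)
  then show "x \<le> y + ennreal d" using le[OF e(1,2)] by (meson add_left_mono order_trans)
qed

lemma det_grad_measurable:
  assumes "u \<in> W12 \<Omega>"
  shows "(\<lambda>x. det (grad \<Omega> u x)) \<in> borel_measurable (lebesgue_on \<Omega>)"
proof -
  have "continuous_on UNIV (det :: real^2^2 \<Rightarrow> real)"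
    unfolding det_2[abs_def] by (intro continuous_intros)
  from measurable_compose[OF grad_measurable[OF assms] borel_measurable_continuous_onI[OF this]] show ?thesis .
qed

lemma full_grad_radial_cutoff:
  "full_grad (radial_cutoff p \<rho>) x = - radial_slope p \<rho> x *\<^sub>R (x - p)"
  by (simp add: full_grad_def partial_deriv_radial_cutoff vec_eq_iff)

text \<open>Minimality is applied to \<open>pull\<close> with size \<open>e\<close>: the finite
  energy of \<open>u\<close> cancels, the factor \<open>e\<close> is divided out, and
  \<open>e\<close> tends to zero. The Dirichlet gain weighted by the cutoff stays on the left, the
  price in \<open>h\<close> and the cross term on the right. Since only energies at positive
  \<open>e\<close> are compared, the singularity of \<open>h\<close> does no harm.\<close>

lemma caccioppoli_inequality:
  fixes l m c1 c2 lam :: real and \<theta> :: "real \<Rightarrow> real" and u u0 :: "real^2 \<Rightarrow> real^2"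
  assumes \<Omega>: "open \<Omega>" "bounded \<Omega>" and lam: "lam > 0"
    and constants: "l > 0" "m > 0" "0 < c1" "c1 < 1" "1 < c2"
    and theta: "theta_conditions l m c1 c2 \<theta>"
    and cont: "continuous_on \<Omega> u"
    and minimizer: "strong_local_minimizer lam (h_fun l m c1 c2 \<theta>) \<Omega> u0 u"
    and \<rho>: "\<rho> > 0" and sub: "cball p (2 * \<rho>) \<subseteq> \<Omega>"
    and tw: "AE x in lebesgue_on \<Omega>. x \<in> ball p (2 * \<rho>) \<longrightarrow> twist \<Omega> u x p \<ge> 0"
  shows "(\<integral>\<^sup>+x. ennreal (lam * radial_cutoff p \<rho> x * (norm (grad \<Omega> u x))\<^sup>2) \<partial>lebesgue_on \<Omega>)
     \<le> (\<integral>\<^sup>+x. ennreal (4 / c1 * radial_cutoff p \<rho> x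
          + (2 * lam + l) * (norm (grad \<Omega> u x) * (norm (u x - u p) * norm (full_grad (radial_cutoff p \<rho>) x)))) \<partial>lebesgue_on \<Omega>)"
proof -
  let ?M = "lebesgue_on \<Omega>" and ?\<zeta> = "radial_cutoff p \<rho>" and ?h = "h_fun l m c1 c2 \<theta>" and ?H = "h_real l m c1 c2 \<theta>"
  let ?G = "grad \<Omega> u"
  let ?Q = "\<lambda>x. norm (u x - u p) * norm (full_grad ?\<zeta> x)"
  let ?R0 = "\<lambda>x. 4 / c1 * ?\<zeta> x + (2 * lam + l) * (norm (?G x) * ?Q x)"
  let ?R1 = "\<lambda>x. lam * (?Q x)\<^sup>2"
  let ?L = "\<lambda>x. lam * ?\<zeta> x * (norm (?G x))\<^sup>2"
  have \<zeta>: "test_function \<Omega> ?\<zeta>" by (rule radial_cutoff_test_function[OF \<rho> sub])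
  note zb = radial_cutoff_bounds[of p \<rho>]
  obtain \<gamma> where adm: "u \<in> admissible lam ?h \<Omega> u0" and \<gamma>: "\<gamma> > 0"
    "\<And>v. v \<in> admissible lam ?h \<Omega> u0 \<Longrightarrow> sup_norm_on \<Omega> (\<lambda>x. v x - u x) < ereal \<gamma> \<Longrightarrow> energy lam ?h \<Omega> u \<le> energy lam ?h \<Omega> v"
    using minimizer unfolding strong_local_minimizer_def by blast
  have u: "u \<in> W12 \<Omega>" "AE x in ?M. det (?G x) > 0" "has_trace \<Omega> u u0" and fin: "energy lam ?h \<Omega> u < \<infinity>"
    using adm by (auto simp: admissible_def admissible1_def)
  note [measurable] = grad_measurable[OF u(1)] det_grad_measurable[OF u(1)] test_function_measurable[OF \<zeta>]
    full_grad_measurable[OF \<zeta>] h_fun_measurable[OF constants theta]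
  have Lu: "L2_on \<Omega> u" using u(1) by (simp add: W12_def)
  note [measurable] = L2_on_measurable[OF Lu]
  have LG: "L2_on \<Omega> ?G" using weak_gradient_grad[OF u(1)] by (simp add: weak_gradient_def)
  have "bounded ((\<lambda>x. u x - u p) ` cball p (2 * \<rho>))"
    by (intro compact_imp_bounded compact_continuous_image continuous_intros continuous_on_subset[OF cont sub]) simp
  then obtain b where b: "b > 0" "\<And>x. x \<in> cball p (2 * \<rho>) \<Longrightarrow> norm (u x - u p) \<le> b" by (auto simp: bounded_pos)
  obtain d where d: "d > 0" "\<And>x. norm (full_grad ?\<zeta> x) \<le> d" using full_grad_bounded[OF \<zeta>] by metis
  have out: "?\<zeta> x = 0" "full_grad ?\<zeta> x = 0" if "x \<notin> cball p (2 * \<rho>)" for x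
    using that radial_cutoff_outside[OF \<rho>, of x p] by (auto simp: full_grad_radial_cutoff dist_commute)
  have Qb: "?Q x \<le> b * d" for x
    using b d out(2)[of x] by (cases "x \<in> cball p (2 * \<rho>)") (auto intro!: mult_mono)
  have Q0: "0 \<le> ?Q x" for x by simp
  \<comment> \<open>The gradient of the cutoff is a nonpositive multiple of \<open>x - p\<close>, so
    the pairing is minus the twist up to a nonnegative factor; beyond distance
    \<open>2 * \<rho>\<close> the slope is zero.\<close>
  have T: "AE x in ?M. (adj2 (?G x) *v (u x - u p)) \<bullet> full_grad ?\<zeta> x \<le> 0"
    using tw
  proof eventually_elim
    case (elim x)
    let ?w = "adj2 (?G x) *v (u x - u p)"
    \<comment> \<open>At \<open>x = p\<close> both sides are zero.\<close>
    have "?w \<bullet> (x - p) = norm (x - p) * twist \<Omega> u x p" by (cases "x = p") (simp_all add: twist_def)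
    then have "?w \<bullet> full_grad ?\<zeta> x = - (radial_slope p \<rho> x * (norm (x - p) * twist \<Omega> u x p))"
      by (simp add: full_grad_radial_cutoff)
    moreover have "radial_slope p \<rho> x = 0 \<or> x \<in> ball p (2 * \<rho>)"
      using radial_cutoff_outside(2)[OF \<rho>, of x p] by (auto simp: dist_commute not_less)
    ultimately show ?case using elim radial_slope_nonneg[of p \<rho> x] by auto
  qed
  \<comment> \<open>Both integrals have to be finite for the competitor to have finite energy, the
    first one also for the limit.\<close>
  have R1fin: "(\<integral>\<^sup>+x. ennreal (?R1 x) \<partial>?M) < \<infinity>" and R0fin: "(\<integral>\<^sup>+x. ennreal (?R0 x) \<partial>?M) < \<infinity>"
  proof -
    interpret finite_measure ?M by (rule finite_measure_on_bounded[OF \<Omega>])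
    have "(\<integral>\<^sup>+x. ennreal (?R1 x) \<partial>?M) \<le> (\<integral>\<^sup>+x. ennreal (lam * (b * d)\<^sup>2) \<partial>?M)"
      using lam Qb Q0 by (intro nn_integral_mono ennreal_leI mult_left_mono power_mono) auto
    also have "\<dots> < \<infinity>" by (simp add: ennreal_mult_eq_top_iff less_top[symmetric])
    finally show "(\<integral>\<^sup>+x. ennreal (?R1 x) \<partial>?M) < \<infinity>" .
    have "(\<integral>\<^sup>+x. ennreal (?R0 x) \<partial>?M) \<le> (\<integral>\<^sup>+x. ennreal ((4 / c1 + (2 * lam + l) * (b * d)) + (2 * lam + l) * (b * d) * (norm (?G x))\<^sup>2) \<partial>?M)"
    proof (intro nn_integral_mono ennreal_leI)
      fix x
      have g: "norm (?G x) \<le> 1 + (norm (?G x))\<^sup>2" using abs_le_1_plus_square[of "norm (?G x)"] by simp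
      have "norm (?G x) * ?Q x \<le> (1 + (norm (?G x))\<^sup>2) * (b * d)" by (rule mult_mono[OF g Qb]) auto
      then have "(2 * lam + l) * (norm (?G x) * ?Q x) \<le> (2 * lam + l) * ((1 + (norm (?G x))\<^sup>2) * (b * d))"
        using lam constants by (intro mult_left_mono) auto
      moreover have "4 / c1 * ?\<zeta> x \<le> 4 / c1 * 1" using zb constants by (intro mult_left_mono) auto
      ultimately show "?R0 x \<le> (4 / c1 + (2 * lam + l) * (b * d)) + (2 * lam + l) * (b * d) * (norm (?G x))\<^sup>2"
        by (simp add: algebra_simps)
    qed
    also have "\<dots> < \<infinity>"
    proof -
      have "integrable ?M (\<lambda>x. (4 / c1 + (2 * lam + l) * (b * d)) + (2 * lam + l) * (b * d) * (norm (?G x))\<^sup>2)"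
        using LG by (simp add: L2_on_def)
      from integrableD(2)[OF this] show ?thesis
        using lam constants b(1) d(1) by (simp add: less_top[symmetric])
    qed
    finally show "(\<integral>\<^sup>+x. ennreal (?R0 x) \<partial>?M) < \<infinity>" .
  qed
  \<comment> \<open>\<open>1 / 2\<close> is the range of the pointwise estimate;
    \<open>\<gamma> / (2 * b)\<close> keeps the competitor within \<open>\<gamma> / 2\<close> of
    \<open>u\<close>, strictly inside the neighbourhood in which \<open>u\<close> is
    minimal.\<close>
  define e0 where "e0 = min (1 / 2) (\<gamma> / (2 * b))"
  have e0: "e0 > 0" "e0 \<le> 1 / 2" "e0 * b < \<gamma>"
  proof -
    show "e0 > 0" "e0 \<le> 1 / 2" using \<gamma> b by (auto simp: e0_def)
    have "e0 * b \<le> \<gamma> / (2 * b) * b" using b by (intro mult_right_mono) (auto simp: e0_def)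
    then show "e0 * b < \<gamma>" using b \<gamma> by simp
  qed
  have step: "(\<integral>\<^sup>+x. ennreal (?L x) \<partial>?M) \<le> (\<integral>\<^sup>+x. ennreal (?R0 x) \<partial>?M) + ennreal e * (\<integral>\<^sup>+x. ennreal (?R1 x) \<partial>?M)"
    if e: "0 < e" "e \<le> e0" for e
  proof -
    have e': "e \<le> 1 / 2" using e e0 by linarith
    let ?v = "pull ?\<zeta> (u p) e u"
    have v: "?v \<in> W12 \<Omega>" and gv: "AE x in ?M. grad \<Omega> ?v x = pull_grad ?\<zeta> (u p) e u ?G x"
      using pull_W12[OF \<Omega> \<zeta> u(1)] by auto
    note [measurable] = grad_measurable[OF v] det_grad_measurable[OF v]
    have est: "AE x in ?M. det (grad \<Omega> ?v x) > 0 \<and>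
        ennreal (lam * (norm (grad \<Omega> ?v x))\<^sup>2) + ?h (det (grad \<Omega> ?v x)) + ennreal e * ennreal (?L x)
        \<le> ennreal (lam * (norm (?G x))\<^sup>2) + ?h (det (?G x)) + ennreal e * (ennreal (?R0 x) + ennreal e * ennreal (?R1 x))"
      using gv u(2) T
    proof eventually_elim
      case (elim x)
      note de = density_estimate[OF constants theta lam e(1) e' zb(1)[of x] zb(2)[of x] elim(2,3)]
      have B: "grad \<Omega> ?v x = (1 - e * ?\<zeta> x) *\<^sub>R ?G x - e *\<^sub>R outer (u x - u p) (full_grad ?\<zeta> x)"
        using elim(1) by (simp add: pull_grad_def)
      have pos: "det (grad \<Omega> ?v x) > 0" unfolding B by (rule de(1))
      have nn: "0 \<le> ?H (det (grad \<Omega> ?v x))" "0 \<le> ?H (det (?G x))"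
        using h_real_nonneg[OF constants theta] pos elim(2) by auto
      have L0: "0 \<le> ?L x" using lam zb[of x] by simp
      have R00: "0 \<le> ?R0 x" using lam constants zb[of x] by (intro add_nonneg_nonneg mult_nonneg_nonneg) auto
      have R10: "0 \<le> ?R1 x" using lam by simp
      have "lam * (norm (grad \<Omega> ?v x))\<^sup>2 + ?H (det (grad \<Omega> ?v x)) + e * ?L x
         \<le> lam * (norm (?G x))\<^sup>2 + ?H (det (?G x)) + e * (?R0 x + e * ?R1 x)"
        unfolding B by (rule de(2))
      then have "ennreal (lam * (norm (grad \<Omega> ?v x))\<^sup>2 + ?H (det (grad \<Omega> ?v x)) + e * ?L x)
         \<le> ennreal (lam * (norm (?G x))\<^sup>2 + ?H (det (?G x)) + e * (?R0 x + e * ?R1 x))" by (rule ennreal_leI)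
      then have "ennreal (lam * (norm (grad \<Omega> ?v x))\<^sup>2) + ?h (det (grad \<Omega> ?v x)) + ennreal e * ennreal (?L x)
        \<le> ennreal (lam * (norm (?G x))\<^sup>2) + ?h (det (?G x)) + ennreal e * (ennreal (?R0 x) + ennreal e * ennreal (?R1 x))"
        unfolding h_fun_eq[OF pos] h_fun_eq[OF elim(2)]
        using lam e(1) nn L0 R00 R10 by (simp only: ennreal_plus ennreal_mult add_nonneg_nonneg mult_nonneg_nonneg zero_le_power2 less_imp_le)
      with pos show ?case by blast
    qed
    have ineq: "energy lam ?h \<Omega> ?v + ennreal e * (\<integral>\<^sup>+x. ennreal (?L x) \<partial>?M)
       \<le> energy lam ?h \<Omega> u + ennreal e * ((\<integral>\<^sup>+x. ennreal (?R0 x) \<partial>?M) + ennreal e * (\<integral>\<^sup>+x. ennreal (?R1 x) \<partial>?M))"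
    proof -
      have "energy lam ?h \<Omega> ?v + ennreal e * (\<integral>\<^sup>+x. ennreal (?L x) \<partial>?M)
        = (\<integral>\<^sup>+x. ennreal (lam * (norm (grad \<Omega> ?v x))\<^sup>2) + ?h (det (grad \<Omega> ?v x)) + ennreal e * ennreal (?L x) \<partial>?M)"
        unfolding energy_def by (subst nn_integral_add) (auto simp: nn_integral_cmult)
      also have "\<dots> \<le> (\<integral>\<^sup>+x. ennreal (lam * (norm (?G x))\<^sup>2) + ?h (det (?G x)) + ennreal e * (ennreal (?R0 x) + ennreal e * ennreal (?R1 x)) \<partial>?M)"
        by (rule nn_integral_mono_AE) (use est in eventually_elim, simp)
      also have "\<dots> = energy lam ?h \<Omega> u + ennreal e * ((\<integral>\<^sup>+x. ennreal (?R0 x) \<partial>?M) + ennreal e * (\<integral>\<^sup>+x. ennreal (?R1 x) \<partial>?M))"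
        unfolding energy_def by (subst nn_integral_add) (auto simp: nn_integral_cmult nn_integral_add)
      finally show ?thesis .
    qed
    have "energy lam ?h \<Omega> ?v \<le> energy lam ?h \<Omega> u + ennreal e * ((\<integral>\<^sup>+x. ennreal (?R0 x) \<partial>?M) + ennreal e * (\<integral>\<^sup>+x. ennreal (?R1 x) \<partial>?M))"
      using ineq by (rule order_trans[rotated]) simp
    also have "\<dots> < \<infinity>" using fin R0fin R1fin by (simp add: ennreal_mult_less_top)
    finally have finv: "energy lam ?h \<Omega> ?v < \<infinity>" .
    have "AE x in ?M. det (grad \<Omega> ?v x) > 0" using est by eventually_elim simp
    moreover have "has_trace \<Omega> ?v u0"
      by (rule has_trace_pull[OF \<Omega> \<zeta> zb _ _ u(1,3)]) (use e e' in auto)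
    ultimately have admv: "?v \<in> admissible lam ?h \<Omega> u0"
      using v finv by (simp add: admissible_def admissible1_def)
    have "sup_norm_on \<Omega> (\<lambda>x. ?v x - u x) \<le> ereal (e0 * b)"
      unfolding sup_norm_on_def
    proof (rule esssup_I)
      show "(\<lambda>x. ereal (norm (?v x - u x))) \<in> borel_measurable ?M"
        unfolding pull_def by measurable
      have "norm (?v x - u x) \<le> e0 * b" for x
      proof (cases "x \<in> cball p (2 * \<rho>)")
        case True
        have "norm (?v x - u x) = e * ?\<zeta> x * norm (u x - u p)" using e zb[of x] by (simp add: pull_def)
        also have "\<dots> \<le> e0 * 1 * b" using e zb[of x] b(2)[OF True] by (intro mult_mono) auto
        finally show ?thesis by simp
      qed (use out e0 b in \<open>simp add: pull_def\<close>)
      then show "AE x in ?M. ereal (norm (?v x - u x)) \<le> ereal (e0 * b)" by simp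
    qed
    also have "\<dots> < ereal \<gamma>" using e0 by simp
    finally have "energy lam ?h \<Omega> u \<le> energy lam ?h \<Omega> ?v" by (rule \<gamma>(2)[OF admv])
    then have "energy lam ?h \<Omega> u + ennreal e * (\<integral>\<^sup>+x. ennreal (?L x) \<partial>?M)
      \<le> energy lam ?h \<Omega> u + ennreal e * ((\<integral>\<^sup>+x. ennreal (?R0 x) \<partial>?M) + ennreal e * (\<integral>\<^sup>+x. ennreal (?R1 x) \<partial>?M))"
      using ineq by (meson add_right_mono order_trans)
    then have "ennreal e * (\<integral>\<^sup>+x. ennreal (?L x) \<partial>?M) \<le> ennreal e * ((\<integral>\<^sup>+x. ennreal (?R0 x) \<partial>?M) + ennreal e * (\<integral>\<^sup>+x. ennreal (?R1 x) \<partial>?M))"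
      using fin by (auto simp: ennreal_add_left_cancel_le top.not_eq_extremum)
    then show ?thesis using e(1) by (simp add: ennreal_mult_le_mult_iff)
  qed
  show ?thesis by (rule ennreal_le_of_le_add_small[OF R1fin e0(1) step])
qed

subsection \<open>Positive twist at every centre\<close>

text \<open>\<open>F = 0\<close> says only that the inner integral vanishes for almost every centre.
  By Fatou's lemma the integral is lower semicontinuous in the centre, so a positive value at
  \<open>p\<close> would stay above some \<open>c > 0\<close> on a whole disc of centres and make
  \<open>F\<close> positive.\<close>

lemma twist_nonneg_at_every_centre:
  assumes \<Omega>: "open \<Omega>" and u: "u \<in> W12 \<Omega>" "continuous_on \<Omega> u"
    and F: "F_functional \<Omega> u (ball z \<delta>) r' = 0"
    and sub: "\<And>q. q \<in> ball z \<delta> \<Longrightarrow> q \<in> \<Omega> \<and> ball q r' \<subseteq> \<Omega>" and p: "p \<in> ball z \<delta>"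
  shows "AE x in lebesgue_on \<Omega>. x \<in> ball p r' \<longrightarrow> twist \<Omega> u x p \<ge> 0"
proof -
  let ?f = "\<lambda>q x. ennreal (g_fun (twist \<Omega> u x q)) * indicator (ball q r') x"
  let ?I = "\<lambda>q. \<integral>\<^sup>+x. ?f q x \<partial>lebesgue"
  have gc: "continuous_on UNIV g_fun"
  proof -
    have eq: "g_fun = (\<lambda>s. max (- s) 0)" by (auto simp: g_fun_def fun_eq_iff)
    show ?thesis unfolding eq by (intro continuous_intros)
  qed
  have I: "(\<integral>\<^sup>+x. ennreal (g_fun (twist \<Omega> u x q)) \<partial>lebesgue_on (ball q r')) = ?I q" for q
    by (rule nn_integral_restrict_space) simp
  \<comment> \<open>\<open>grad\<close> is known to be measurable only on \<open>\<Omega>\<close>,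
    which is why the ball around the centre has to lie inside.\<close>
  have fm: "?f q \<in> borel_measurable lebesgue" if q: "q \<in> ball z \<delta>" for q
  proof -
    have um: "u \<in> borel_measurable (lebesgue_on \<Omega>)"
      using u(1) by (auto simp: W12_def L2_on_def)
    have eq: "adj2 A *v w = (\<chi> i. if i = 1 then A $ 2 $ 2 * w $ 1 - A $ 1 $ 2 * w $ 2 else A $ 1 $ 1 * w $ 2 - A $ 2 $ 1 * w $ 1)"
      for A :: "real^2^2" and w
      by (simp add: vec_eq_iff forall_2 adj2_def cof2_def transpose_def matrix_vector_mult_def sum_2)
    have "continuous_on UNIV (\<lambda>z. if i = 1 then fst z $ 2 $ 2 * snd z $ 1 - fst z $ 1 $ 2 * snd z $ 2
        else fst z $ 1 $ 1 * snd z $ 2 - fst z $ 2 $ 1 * snd z $ 1 :: real)" for i :: 2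
      by (cases "i = 1") (simp_all, (intro continuous_intros)+)
    then have "continuous_on UNIV (\<lambda>z. (adj2 (fst z) *v (snd z)) :: real^2)"
      unfolding eq by (rule continuous_on_vec_lambda)
    from borel_measurable_continuous_Pair[OF grad_measurable[OF u(1)] borel_measurable_diff[OF um borel_measurable_const[of "u q"]] this]
    have "(\<lambda>x. adj2 (grad \<Omega> u x) *v (u x - u q)) \<in> borel_measurable (lebesgue_on \<Omega>)" by simp
    moreover have "(\<lambda>x. (x - q) /\<^sub>R norm (x - q)) \<in> borel_measurable (lebesgue_on \<Omega>)"
      by (intro measurable_lebesgue_on_borel) measurable
    ultimately have "(\<lambda>x. twist \<Omega> u x q) \<in> borel_measurable (lebesgue_on \<Omega>)"
      unfolding twist_def by (rule borel_measurable_inner)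
    then have "(\<lambda>x. ennreal (g_fun (twist \<Omega> u x q))) \<in> borel_measurable (lebesgue_on \<Omega>)"
      using measurable_compose[OF _ borel_measurable_continuous_onI[OF gc]] by (intro measurable_compose[OF _ measurable_ennreal]) blast
    then have "(\<lambda>x. ennreal (g_fun (twist \<Omega> u x q)) * indicator \<Omega> x) \<in> borel_measurable lebesgue"
      using \<Omega> by (subst (asm) borel_measurable_restrict_space_iff_ennreal) auto
    then have "(\<lambda>x. ennreal (g_fun (twist \<Omega> u x q)) * indicator \<Omega> x * indicator (ball q r') x) \<in> borel_measurable lebesgue"
      by (rule borel_measurable_times_ennreal) (simp add: borel_measurable_indicator)
    moreover have "ennreal (g_fun (twist \<Omega> u x q)) * indicator \<Omega> x * indicator (ball q r') x = ?f q x" for x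
      using sub[OF q] by (auto simp: indicator_def)
    ultimately show ?thesis by simp
  qed
  have lsc: "\<exists>e>0. \<forall>q\<in>ball p e. q \<in> ball z \<delta> \<longrightarrow> c < ?I q" if c: "c < ?I p" for c
  proof (rule ccontr)
    assume neg: "\<not> ?thesis"
    have "\<exists>q. q \<in> ball p (inverse (real (Suc n))) \<and> q \<in> ball z \<delta> \<and> ?I q \<le> c" for n
    proof -
      have "inverse (real (Suc n)) > 0" by simp
      then have "\<not> (\<forall>q\<in>ball p (inverse (real (Suc n))). q \<in> ball z \<delta> \<longrightarrow> c < ?I q)" using neg by blast
      then show ?thesis unfolding Ball_def not_all not_imp not_less by blast
    qed
    then have "\<exists>q. \<forall>n. q n \<in> ball p (inverse (real (Suc n))) \<and> q n \<in> ball z \<delta> \<and> ?I (q n) \<le> c"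
      by (intro choice allI)
    then obtain q where q: "\<And>n. q n \<in> ball p (inverse (real (Suc n)))" "\<And>n. q n \<in> ball z \<delta>" "\<And>n. ?I (q n) \<le> c" by blast
    have qp: "q \<longlonglongrightarrow> p"
    proof (rule metric_tendsto_imp_tendsto[OF LIMSEQ_inverse_real_of_nat])
      show "\<forall>\<^sub>F n in sequentially. dist (q n) p \<le> dist (inverse (real (Suc n))) 0"
        using q(1) by (intro always_eventually allI) (auto simp: dist_commute less_imp_le)
    qed
    have "isCont u p" using u(2) \<Omega> sub[OF p] by (simp add: continuous_on_eq_continuous_at)
    then have uq: "(\<lambda>n. u (q n)) \<longlonglongrightarrow> u p" using qp isCont_tendsto_compose by blast
    \<comment> \<open>A point of the open ball stays inside for nearby centres, and its twist
      converges because \<open>u\<close> is continuous at \<open>p\<close>. At all other points, and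
      at \<open>x = p\<close>, where the twist divides by zero, the left-hand side is zero.\<close>
    have pw: "?f p x \<le> liminf (\<lambda>n. ?f (q n) x)" for x
    proof (cases "x \<in> ball p r' \<and> x \<noteq> p")
      case True
      have "(\<lambda>n. dist (q n) x) \<longlonglongrightarrow> dist p x" by (intro tendsto_intros qp)
      then have ev: "\<forall>\<^sub>F n in sequentially. x \<in> ball (q n) r'"
        using True by (auto dest: order_tendstoD(2)[of _ "dist p x" _ r'])
      have "(\<lambda>n. twist \<Omega> u x (q n)) \<longlonglongrightarrow> twist \<Omega> u x p"
        unfolding twist_def using True
        by (intro tendsto_intros uq qp bounded_linear.tendsto[OF matrix_vector_mul_bounded_linear]) auto
      then have "(\<lambda>n. g_fun (twist \<Omega> u x (q n))) \<longlonglongrightarrow> g_fun (twist \<Omega> u x p)"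
        using gc continuous_on_tendsto_compose[of UNIV g_fun] by auto
      then have "(\<lambda>n. ennreal (g_fun (twist \<Omega> u x (q n)))) \<longlonglongrightarrow> ennreal (g_fun (twist \<Omega> u x p))" by (rule tendsto_ennrealI)
      then have "(\<lambda>n. ?f (q n) x) \<longlonglongrightarrow> ennreal (g_fun (twist \<Omega> u x p))"
        by (rule Lim_transform_eventually) (use ev in eventually_elim, simp)
      then have "(\<lambda>n. ?f (q n) x) \<longlonglongrightarrow> ?f p x" using True by simp
      then have "liminf (\<lambda>n. ?f (q n) x) = ?f p x" by (rule lim_imp_Liminf[OF sequentially_bot])
      then show ?thesis by simp
    next
      case False
      then have "?f p x = 0" by (auto simp: twist_def g_fun_def)
      then show ?thesis by (simp only: zero_le)
    qed
    have "?I p \<le> (\<integral>\<^sup>+x. liminf (\<lambda>n. ?f (q n) x) \<partial>lebesgue)" by (intro nn_integral_mono pw)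
    also have "\<dots> \<le> liminf (\<lambda>n. ?I (q n))" by (intro nn_integral_liminf fm q(2))
    also have "\<dots> \<le> liminf (\<lambda>n::nat. c)" by (intro Liminf_mono always_eventually allI q(3))
    also have "\<dots> = c" by (simp add: Liminf_const)
    finally show False using c by simp
  qed
  have "?I p = 0"
  proof (rule ccontr)
    assume "?I p \<noteq> 0"
    then obtain c where c: "0 < c" "c < ?I p" using dense[of 0 "?I p"] by (auto simp: zero_less_iff_neq_zero)
    obtain e where e: "e > 0" "\<And>q. q \<in> ball p e \<Longrightarrow> q \<in> ball z \<delta> \<Longrightarrow> c < ?I q" using lsc[OF c(2)] by blast
    obtain e' where e': "e' > 0" "ball p e' \<subseteq> ball z \<delta>" using p open_contains_ball by blast
    let ?B = "ball p (min e e')"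
    have "c * emeasure lebesgue ?B = (\<integral>\<^sup>+x. c * indicator ?B x \<partial>lebesgue)" by (subst nn_integral_cmult_indicator) auto
    also have "\<dots> \<le> (\<integral>\<^sup>+x. ?I x * indicator (ball z \<delta>) x \<partial>lebesgue)"
    proof (rule nn_integral_mono)
      fix x
      show "c * indicator ?B x \<le> ?I x * indicator (ball z \<delta>) x"
      proof (cases "x \<in> ?B")
        case True
        then have "x \<in> ball z \<delta>" using e'(2) by auto
        moreover have "c < ?I x" using True \<open>x \<in> ball z \<delta>\<close> by (intro e(2)) auto
        ultimately show ?thesis using True by (simp only: indicator_simps mult_1_right less_imp_le)
      qed simp
    qed
    also have "\<dots> = F_functional \<Omega> u (ball z \<delta>) r'"
      unfolding F_functional_def I by (rule nn_integral_restrict_space[symmetric]) simp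
    finally have "c * emeasure lebesgue ?B = 0" using F by simp
    then have "emeasure lebesgue ?B = 0" using c(1) by auto
    then have "?B \<in> null_sets lebesgue" by (simp add: null_sets_def)
    then have "negligible ?B" by (simp add: negligible_iff_null_sets)
    then show False using open_not_negligible[of ?B] e(1) e'(1) by auto
  qed
  then have "AE x in lebesgue. ?f p x = 0" using nn_integral_0_iff_AE[OF fm[OF p]] by simp
  then have "AE x in lebesgue. x \<in> \<Omega> \<longrightarrow> x \<in> ball p r' \<longrightarrow> twist \<Omega> u x p \<ge> 0"
    by eventually_elim (auto simp: g_fun_def split: if_splits)
  then show ?thesis by (simp add: AE_lebesgue_on_iff[OF \<Omega>])
qed

subsection \<open>Decay and Hoelder continuity\<close>

text \<open>The quadratic error is absorbed by iterating \<open>W \<rho> + C * \<rho>^2\<close>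
  instead of \<open>W\<close>: passing to \<open>6 * \<rho>\<close> multiplies the square by 36, and
  \<open>36 * \<kappa> \<ge> 18\<close> dominates the two copies of the error.\<close>

lemma geometric_decay:
  fixes W :: "real \<Rightarrow> real"
  assumes step: "\<And>\<rho>. 0 < \<rho> \<Longrightarrow> 6 * \<rho> \<le> R \<Longrightarrow> W \<rho> \<le> \<kappa> * W (6 * \<rho>) + C * \<rho>\<^sup>2"
    and R: "R > 0" and \<kappa>: "1 / 2 \<le> \<kappa>" and C: "C \<ge> 0"
  shows "W (R / 6 ^ n) + C * (R / 6 ^ n)\<^sup>2 \<le> \<kappa> ^ n * (W R + C * R\<^sup>2)"
proof (induction n)
  case (Suc n)
  let ?\<rho> = "R / 6 ^ Suc n"
  have e: "6 * ?\<rho> = R / 6 ^ n" by simp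
  have "R \<le> R * 6 ^ n" using R by simp
  then have "W ?\<rho> \<le> \<kappa> * W (6 * ?\<rho>) + C * ?\<rho>\<^sup>2" (is ?step) using R unfolding e by (intro step[of ?\<rho>, unfolded e]) (auto simp: field_simps)
  then have st: ?step .
  have "2 * (C * \<rho>\<^sup>2) \<le> \<kappa> * (C * (6 * \<rho>)\<^sup>2)" for \<rho> :: real
  proof -
    have "2 * (C * \<rho>\<^sup>2) \<le> (1 / 2 * 36) * (C * \<rho>\<^sup>2)" using C by (intro mult_right_mono) auto
    also have "\<dots> \<le> (\<kappa> * 36) * (C * \<rho>\<^sup>2)" using C \<kappa> by (intro mult_right_mono) auto
    finally show ?thesis by (simp add: power_mult_distrib mult_ac)
  qed
  from this[of ?\<rho>] st have "W ?\<rho> + C * ?\<rho>\<^sup>2 \<le> \<kappa> * W (6 * ?\<rho>) + \<kappa> * (C * (6 * ?\<rho>)\<^sup>2)" by linarith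
  then have "W ?\<rho> + C * ?\<rho>\<^sup>2 \<le> \<kappa> * (W (6 * ?\<rho>) + C * (6 * ?\<rho>)\<^sup>2)" by (simp only: distrib_left)
  also have "\<dots> \<le> \<kappa> * (\<kappa> ^ n * (W R + C * R\<^sup>2))" unfolding e using \<kappa> by (intro mult_left_mono Suc.IH) auto
  finally show ?case by (simp only: power_Suc mult.assoc)
qed simp

text \<open>With \<open>\<alpha> = - log 6 s\<close>, the decay \<open>s ^ n\<close> is the scale
  \<open>1 / 6 ^ n\<close> to the power \<open>\<alpha>\<close>; \<open>s < 1\<close> makes this
  exponent positive and \<open>1 / 6 \<le> s\<close> keeps it at most one. Distances above
  \<open>R / 6\<close> are covered by the bound \<open>S\<close>.\<close>

lemma hoelder_on_if_geometric_scales: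
  fixes f :: "'a::metric_space \<Rightarrow> 'b::metric_space"
  assumes R: "R > 0" and s: "1 / 6 \<le> s" "s < 1" and C: "C \<ge> 0"
    and bdd: "\<And>x y. x \<in> K \<Longrightarrow> y \<in> K \<Longrightarrow> dist (f x) (f y) \<le> S"
    and osc: "\<And>x y n. x \<in> K \<Longrightarrow> y \<in> K \<Longrightarrow> dist x y \<le> R / 6 ^ Suc n \<Longrightarrow> dist (f x) (f y) \<le> C * s ^ n"
  shows "hoelder_on K f"
proof -
  define \<alpha> where "\<alpha> = - log 6 s"
  have s0: "s > 0" using s by linarith
  have "log 6 s < 0" using s s0 by (simp add: log_less_zero_cancel_iff)
  moreover have "log 6 (1 / 6) \<le> log 6 s" using s s0 by (subst log_le_cancel_iff) auto
  then have "-1 \<le> log 6 s" by (simp add: log_divide)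
  ultimately have \<alpha>: "0 < \<alpha>" "\<alpha> \<le> 1" by (auto simp: \<alpha>_def)
  have spow: "s ^ n = (1 / 6 ^ n) powr \<alpha>" for n
  proof -
    have "s = 6 powr (- \<alpha>)" using s0 by (simp add: \<alpha>_def)
    then have "s ^ n = (6 powr (- \<alpha>)) ^ n" by simp
    also have "\<dots> = 6 powr (- \<alpha> * real n)" by (simp add: powr_power mult.commute)
    also have "- \<alpha> * real n = - real n * \<alpha>" by simp
    also have "6 powr (- real n * \<alpha>) = (6 powr (- real n)) powr \<alpha>" by (simp only: powr_powr)
    also have "6 powr (- real n) = 1 / 6 ^ n" by (simp add: powr_minus powr_realpow divide_inverse)
    finally show ?thesis .
  qed
  define D where "D = max 0 S / (R / 6) powr \<alpha> + C / s\<^sup>2 / R powr \<alpha>"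
  have t1: "0 \<le> max 0 S / (R / 6) powr \<alpha>" and t2: "0 \<le> C / s\<^sup>2 / R powr \<alpha>" using R C s0 by auto
  have "dist (f x) (f y) \<le> D * dist x y powr \<alpha>" if xy: "x \<in> K" "y \<in> K" for x y
  proof (cases "x = y")
    case False
    define d where "d = dist x y"
    have d: "d > 0" using False by (simp add: d_def)
    show ?thesis
    proof (cases "d \<le> R / 6")
      case True
      have "\<exists>n. R / 6 ^ (n + 2) < d"
      proof -
        obtain n where "(1 / 6) ^ n < d / R" using real_arch_pow_inv[of "d / R" "1 / 6"] d R by auto
        then have "R / 6 ^ n < d" using R by (simp add: field_simps power_divide)
        moreover have "R / 6 ^ (n + 2) \<le> R / 6 ^ n" using R by (intro divide_left_mono power_increasing) auto
        ultimately show ?thesis by (intro exI[of _ n]) linarith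
      qed
      \<comment> \<open>The least such \<open>n\<close> places \<open>d\<close> between
        \<open>R / 6 ^ (n + 2)\<close> and \<open>R / 6 ^ Suc n\<close>. The upper bound admits the
        hypothesis on oscillations; the lower one turns \<open>s ^ (n + 2)\<close> into a power of
        \<open>d\<close>, at the cost of dividing the constant by \<open>s^2\<close>.\<close>
      then obtain n where n: "R / 6 ^ (n + 2) < d" "\<And>k. k < n \<Longrightarrow> \<not> R / 6 ^ (k + 2) < d"
        using exists_least_iff[of "\<lambda>n. R / 6 ^ (n + 2) < d"] by blast
      have "d \<le> R / 6 ^ Suc n"
      proof (cases n)
        case (Suc k)
        then show ?thesis using n(2)[of k] by (simp add: not_less)
      qed (use True in simp)
      then have "dist (f x) (f y) \<le> C * s ^ n" using osc[OF xy] by (simp add: d_def)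
      also have "C * s ^ n = C / s\<^sup>2 * s ^ (n + 2)" using s0 by (simp add: power_add power2_eq_square field_simps)
      also have "\<dots> \<le> C / s\<^sup>2 * (d / R) powr \<alpha>"
      proof (intro mult_left_mono)
        have "1 / 6 ^ (n + 2) \<le> d / R" using n(1) R by (simp add: field_simps less_imp_le)
        then show "s ^ (n + 2) \<le> (d / R) powr \<alpha>" unfolding spow using \<alpha> by (intro powr_mono2) auto
      qed (use C in simp)
      also have "(d / R) powr \<alpha> = d powr \<alpha> / R powr \<alpha>" using d R by (simp add: powr_divide)
      also have "C / s\<^sup>2 * (d powr \<alpha> / R powr \<alpha>) \<le> D * d powr \<alpha>"
        using mult_right_mono[OF t1, of "d powr \<alpha>"] by (simp add: D_def distrib_right)
      finally show ?thesis by (simp add: d_def)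
    next
      case False
      have "(R / 6) powr \<alpha> \<le> d powr \<alpha>" using False R \<alpha> by (intro powr_mono2) auto
      then have "max 0 S / (R / 6) powr \<alpha> * (R / 6) powr \<alpha> \<le> max 0 S / (R / 6) powr \<alpha> * d powr \<alpha>" by (rule mult_left_mono[OF _ t1])
      then have "max 0 S \<le> max 0 S / (R / 6) powr \<alpha> * d powr \<alpha>" using R by simp
      also have "\<dots> \<le> D * d powr \<alpha>" using mult_right_mono[OF t2, of "d powr \<alpha>"] by (simp add: D_def distrib_right)
      finally show ?thesis using bdd[OF xy] by (simp add: d_def)
    qed
  qed simp
  with \<alpha> show ?thesis unfolding hoelder_on_def by blast
qed

section \<open>From scalar components to the map \<open>u\<close>\<close>

lemma components_le_norm_matrix: "(norm (A $ i))\<^sup>2 \<le> (norm A)\<^sup>2" for A :: "real^2^2"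
  by (intro power_mono Finite_Cartesian_Product.norm_nth_le) simp

lemma oscillation_of_map:
  fixes A :: "real^2 \<Rightarrow> real^2^2"
  assumes \<Omega>: "open \<Omega>" "bounded \<Omega>" and u: "continuous_on \<Omega> u"
    and det: "AE x in lebesgue_on \<Omega>. det (grad \<Omega> u x) > 0" and G: "AE x in lebesgue_on \<Omega>. grad \<Omega> u x = A x"
    and sw: "\<And>i. scalar_wgrad \<Omega> (\<lambda>x. indicator \<Omega> x * u x $ i) (\<lambda>x. A x $ i)"
    and \<rho>: "\<rho> > 0" and sub: "square p (4 * \<rho>) \<subseteq> \<Omega>" and J: "J > 0"
    and le: "(\<integral>\<^sup>+x\<in>square p (4 * \<rho>) - open_square p (2 * \<rho>). ennreal ((norm (A x))\<^sup>2) \<partial>lborel) \<le> ennreal J"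
    and x: "x \<in> square p (2 * \<rho>)"
  shows "norm (u x - u p) \<le> 80 * sqrt J"
proof -
  let ?a = "\<lambda>i x. indicator \<Omega> x * u x $ i"
  have "AE x in lebesgue_on \<Omega>. det (A x) > 0" using det G by eventually_elim simp
  then have "AE x in lebesgue. x \<in> \<Omega> \<longrightarrow> det (A x) > 0" by (simp add: AE_lebesgue_on_iff[OF \<Omega>(1)])
  then have pos: "AE x in lborel. x \<in> \<Omega> \<longrightarrow> A x $ 1 $ 1 * A x $ 2 $ 2 - A x $ 1 $ 2 * A x $ 2 $ 1 > 0"
    unfolding AE_completion_iff det_2 .
  \<comment> \<open>For the second component the partner is minus the first: exchanging the rows of
    the gradient reverses the sign of the determinant, and the negation restores it.\<close>
  then have pos': "AE x in lborel. x \<in> \<Omega> \<longrightarrow> A x $ 2 $ 1 * (- A x $ 1) $ 2 - A x $ 2 $ 2 * (- A x $ 1) $ 1 > 0"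
    by eventually_elim (simp add: mult.commute)
  have cont: "continuous_on \<Omega> (?a i)" for i
  proof -
    have "continuous_on \<Omega> (\<lambda>x. u x $ i)" using u by (intro continuous_intros)
    then show ?thesis by (rule continuous_on_cong[THEN iffD1, rotated -1]) auto
  qed
  have le': "(\<integral>\<^sup>+x\<in>square p (4 * \<rho>) - open_square p (2 * \<rho>). ennreal ((norm (A x $ i))\<^sup>2) \<partial>lborel) \<le> ennreal J" for i
    by (rule order_trans[OF nn_integral_mono le]) (intro mult_right_mono ennreal_leI components_le_norm_matrix, simp)
  have p: "p \<in> square p (2 * \<rho>)" using \<rho> by (simp add: square_def)
  have sq: "square p (2 * \<rho>) \<subseteq> \<Omega>" using sub \<rho> by (force simp: square_def)
  have in\<Omega>: "x \<in> \<Omega>" "p \<in> \<Omega>" using sq x p by auto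
  have 1: "\<bar>?a 1 x - ?a 1 p\<bar> \<le> 40 * sqrt J"
    by (rule oscillation_on_square[OF \<Omega>(1) sw cont sw cont pos \<rho> sub J le' x p])
  have 2: "\<bar>?a 2 x - ?a 2 p\<bar> \<le> 40 * sqrt J"
    by (rule oscillation_on_square[OF \<Omega>(1) sw cont scalar_wgrad_uminus[OF sw] continuous_on_minus[OF cont] pos' \<rho> sub J le' x p])
  show ?thesis
    using norm_le_two_component[of "u x - u p" "40 * sqrt J"] 1 2 in\<Omega> by simp
qed

lemma measure_square: "r \<ge> 0 \<Longrightarrow> measure lborel (square p r) = (2 * r)\<^sup>2"
proof -
  assume r: "r \<ge> 0"
  have "pt r r $ i = r" for i using exhaust_2[of i] by auto
  then have "\<forall>b\<in>Basis. (p - pt r r) \<bullet> b \<le> (p + pt r r) \<bullet> b"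
    using r by (auto simp: Basis_vec_def inner_axis)
  then show ?thesis unfolding square_eq_cbox measure_lborel_cbox_eq
    by (simp only: if_True prod_Basis_real2) (simp add: inner_axis power2_eq_square)
qed

lemma ball_square_inclusions:
  "ball p r \<subseteq> square p r" "cball p r \<subseteq> square p r" "0 < r \<Longrightarrow> square p (4 * r) \<subseteq> ball p (6 * r)" "ball p r \<subseteq> open_square p r"
proof -
  have c: "\<bar>x $ i - p $ i\<bar> \<le> dist p x" for x :: "real^2" and i
    using component_le_norm_cart[of "x - p" i] by (simp add: dist_norm norm_minus_commute)
  show "ball p r \<subseteq> square p r" "cball p r \<subseteq> square p r" "ball p r \<subseteq> open_square p r"
    by (auto simp: square_def open_square_def intro: order_trans[OF c] le_less_trans[OF c] less_imp_le)
  assume r: "0 < r"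
  show "square p (4 * r) \<subseteq> ball p (6 * r)"
  proof
    fix x assume x: "x \<in> square p (4 * r)"
    have "(dist p x)\<^sup>2 = (x $ 1 - p $ 1)\<^sup>2 + (x $ 2 - p $ 2)\<^sup>2"
      unfolding dist_norm norm_minus_commute[of p] power2_norm_eq_inner
      by (simp add: inner_vec_def sum_2 power2_eq_square)
    \<comment> \<open>The half-diagonal of the square is \<open>sqrt 32 * r\<close>, below
      \<open>6 * r\<close>. The ratio 6 of successive radii comes from here.\<close>
    also have "\<dots> \<le> (4 * r)\<^sup>2 + (4 * r)\<^sup>2"
      using x r by (intro add_mono abs_le_square_iff[THEN iffD1]) (auto simp: square_def)
    also have "\<dots> < (6 * r)\<^sup>2" using r by (simp add: power_mult_distrib)
    finally have "dist p x < 6 * r" using r by (intro power2_less_imp_less[of _ "6 * r"]) auto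
    then show "x \<in> ball p (6 * r)" by simp
  qed
qed

definition local_energy :: "(real^2 \<Rightarrow> real^2^2) \<Rightarrow> real^2 \<Rightarrow> real \<Rightarrow> real" where
  "local_energy A p r = (\<integral>x. (norm (A x))\<^sup>2 * indicator (ball p r) x \<partial>lborel)"

text \<open>The square annulus lies in the disc of radius \<open>6 * \<rho>\<close> and avoids the
  one of radius \<open>2 * \<rho>\<close>, so the oscillation is paid for by energy outside the
  hole.\<close>

lemma annulus_energy_le:
  assumes iA: "integrable lborel (\<lambda>x. (norm (A x))\<^sup>2)" and \<rho>: "\<rho> > 0"
  shows "(\<integral>\<^sup>+x\<in>square p (4 * \<rho>) - open_square p (2 * \<rho>). ennreal ((norm (A x))\<^sup>2) \<partial>lborel)
    \<le> ennreal (local_energy A p (6 * \<rho>) - local_energy A p \<rho>)"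
proof -
  have iB: "integrable lborel (\<lambda>x. (norm (A x))\<^sup>2 * indicator (ball p r) x)" for r
    using iA by (intro integrable_mult_bounded[where c = 1]) (auto simp: indicator_def)
  let ?d = "\<lambda>x. (norm (A x))\<^sup>2 * indicator (ball p (6 * \<rho>)) x - (norm (A x))\<^sup>2 * indicator (ball p \<rho>) x"
  have nn: "0 \<le> ?d x" for x using \<rho> by (auto simp: indicator_def)
  have "(\<integral>\<^sup>+x\<in>square p (4 * \<rho>) - open_square p (2 * \<rho>). ennreal ((norm (A x))\<^sup>2) \<partial>lborel) \<le> (\<integral>\<^sup>+x. ennreal (?d x) \<partial>lborel)"
  proof (rule nn_integral_mono)
    fix x
    show "ennreal ((norm (A x))\<^sup>2) * indicator (square p (4 * \<rho>) - open_square p (2 * \<rho>)) x \<le> ennreal (?d x)"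
    proof (cases "x \<in> square p (4 * \<rho>) - open_square p (2 * \<rho>)")
      case True
      then have "x \<in> ball p (6 * \<rho>)" "x \<notin> ball p (2 * \<rho>)"
        using ball_square_inclusions(3)[OF \<rho>] ball_square_inclusions(4) by blast+
      moreover then have "x \<notin> ball p \<rho>" using \<rho> by auto
      ultimately show ?thesis using True by simp
    qed simp
  qed
  also have "\<dots> = ennreal (\<integral>x. ?d x \<partial>lborel)"
    by (rule nn_integral_eq_integral) (use iB nn in auto)
  also have "(\<integral>x. ?d x \<partial>lborel) = local_energy A p (6 * \<rho>) - local_energy A p \<rho>"
    unfolding local_energy_def by (rule Bochner_Integration.integral_diff[OF iB iB])
  finally show ?thesis .
qed

text \<open>Young's inequality splits the cross term of the Caccioppoli inequality into annular
  energy and the squared oscillation over \<open>\<rho>^2\<close>, on a set of area of order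
  \<open>\<rho>^2\<close>. The oscillation bound turns the second part into annular energy as well,
  so the right-hand side contains \<open>W\<close> only through
  \<open>W (6 * \<rho>) - W \<rho>\<close>.\<close>

lemma hole_filling:
  fixes l m c1 c2 lam :: real and \<theta> :: "real \<Rightarrow> real" and u u0 :: "real^2 \<Rightarrow> real^2" and A :: "real^2 \<Rightarrow> real^2^2"
  assumes \<Omega>: "open \<Omega>" "bounded \<Omega>" and lam: "lam > 0"
    and constants: "l > 0" "m > 0" "0 < c1" "c1 < 1" "1 < c2"
    and theta: "theta_conditions l m c1 c2 \<theta>"
    and cont: "continuous_on \<Omega> u"
    and minimizer: "strong_local_minimizer lam (h_fun l m c1 c2 \<theta>) \<Omega> u0 u"
    and det: "AE x in lebesgue_on \<Omega>. det (grad \<Omega> u x) > 0" and G: "AE x in lebesgue_on \<Omega>. grad \<Omega> u x = A x"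
    and sw: "\<And>i. scalar_wgrad \<Omega> (\<lambda>x. indicator \<Omega> x * u x $ i) (\<lambda>x. A x $ i)"
    and iA: "integrable lborel (\<lambda>x. (norm (A x))\<^sup>2)"
    and S: "\<And>p \<rho> x. \<rho> > 0 \<Longrightarrow> radial_slope p \<rho> x * norm (x - p) \<le> S / \<rho>"
    and \<rho>: "\<rho> > 0" and sub: "ball p (6 * \<rho>) \<subseteq> \<Omega>"
    and tw: "AE x in lebesgue_on \<Omega>. x \<in> ball p (2 * \<rho>) \<longrightarrow> twist \<Omega> u x p \<ge> 0"
  defines "W \<equiv> local_energy A p"
  shows "lam * bump (bump 1) * W \<rho> \<le> 64 / c1 * \<rho>\<^sup>2 + (2 * lam + l) * (W (6 * \<rho>) - W \<rho>)
     + (2 * lam + l) * (102400 * S\<^sup>2) * (W (6 * \<rho>) - W \<rho> + \<rho>\<^sup>2)"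
proof -
  let ?\<zeta> = "radial_cutoff p \<rho>" and ?b = "bump (bump 1)"
  have iB: "integrable lborel (\<lambda>x. (norm (A x))\<^sup>2 * indicator (ball p r) x)" for r
    using iA by (intro integrable_mult_bounded[where c = 1]) (auto simp: indicator_def)
  have W_mono: "W \<rho> \<le> W (6 * \<rho>)"
    unfolding W_def local_energy_def using \<rho> by (intro integral_mono iB) (auto simp: indicator_def)
  \<comment> \<open>The summand \<open>\<rho>^2\<close> makes \<open>J\<close> positive even if the
    annulus carries no energy; an error of this order is present anyway.\<close>
  define J where "J = W (6 * \<rho>) - W \<rho> + \<rho>\<^sup>2"
  have J: "J > 0" using W_mono \<rho> by (simp add: J_def add_nonneg_pos)
  have sq4: "square p (4 * \<rho>) \<subseteq> \<Omega>" using ball_square_inclusions(3)[OF \<rho>] sub by blast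
  have cb: "cball p (2 * \<rho>) \<subseteq> \<Omega>"
    using sub \<rho> by (intro order_trans[OF _ sub] subsetI) auto
  have "(\<integral>\<^sup>+x\<in>square p (4 * \<rho>) - open_square p (2 * \<rho>). ennreal ((norm (A x))\<^sup>2) \<partial>lborel) \<le> ennreal J"
    by (rule order_trans[OF annulus_energy_le[OF iA \<rho>]]) (simp add: J_def W_def ennreal_leI)
  note osc = oscillation_of_map[OF \<Omega> cont det G sw \<rho> sq4 J this]
  note cac = caccioppoli_inequality[OF \<Omega> lam constants theta cont minimizer \<rho> cb tw]
  \<comment> \<open>A majorant built from indicators of discs and a square, whose integral is
    computed exactly. \<open>6400\<close> is the square of the oscillation constant 80.\<close>
  let ?B = "\<lambda>x. 4 / c1 * indicator (square p (2 * \<rho>)) x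
     + (2 * lam + l) * ((norm (A x))\<^sup>2 * indicator (ball p (6 * \<rho>)) x - (norm (A x))\<^sup>2 * indicator (ball p \<rho>) x
         + 6400 * J * (S / \<rho>)\<^sup>2 * indicator (square p (2 * \<rho>)) x)"
  have isq: "integrable lborel (indicator (square p (2 * \<rho>)) :: _ \<Rightarrow> real)"
    unfolding square_eq_cbox by (rule integrable_real_indicator[OF _ emeasure_lborel_cbox_finite]) simp
  have iBB: "integrable lborel ?B"
    by (intro Bochner_Integration.integrable_add Bochner_Integration.integrable_diff integrable_mult_right iB isq)
  have pw: "4 / c1 * ?\<zeta> x + (2 * lam + l) * (norm (A x) * (norm (u x - u p) * norm (full_grad ?\<zeta> x))) \<le> ?B x" for x
  proof -
    have a0: "0 \<le> 4 / c1" "0 \<le> 2 * lam + l" using lam constants by auto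
    consider "dist x p \<ge> 2 * \<rho>" | "dist x p \<le> \<rho>" | "\<rho> < dist x p" "dist x p < 2 * \<rho>" by linarith
    then show ?thesis
    proof cases
      case 1
      have nn: "0 \<le> (norm (A x))\<^sup>2 * indicator (ball p (6 * \<rho>)) x - (norm (A x))\<^sup>2 * indicator (ball p \<rho>) x"
        using \<rho> by (auto simp: indicator_def)
      have "0 \<le> ?B x" using J by (intro add_nonneg_nonneg mult_nonneg_nonneg a0 nn) auto
      then show ?thesis using radial_cutoff_outside[OF \<rho> 1] by (simp add: full_grad_radial_cutoff)
    next
      case 2
      have nn: "0 \<le> (norm (A x))\<^sup>2 * indicator (ball p (6 * \<rho>)) x - (norm (A x))\<^sup>2 * indicator (ball p \<rho>) x"
        using \<rho> by (auto simp: indicator_def)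
      have m: "x \<in> square p (2 * \<rho>)" using 2 \<rho> ball_square_inclusions(2)[of p "2 * \<rho>"] by (auto simp: dist_commute)
      have "4 / c1 * ?\<zeta> x \<le> 4 / c1 * indicator (square p (2 * \<rho>)) x"
        using radial_cutoff_bounds[of p \<rho> x] m by (intro mult_left_mono a0) auto
      moreover have "0 \<le> (2 * lam + l) * ((norm (A x))\<^sup>2 * indicator (ball p (6 * \<rho>)) x - (norm (A x))\<^sup>2 * indicator (ball p \<rho>) x
         + 6400 * J * (S / \<rho>)\<^sup>2 * indicator (square p (2 * \<rho>)) x)"
        using J by (intro add_nonneg_nonneg mult_nonneg_nonneg a0 nn) auto
      moreover have "full_grad ?\<zeta> x = 0" using radial_cutoff_inside(2)[OF \<rho> 2] by (simp add: full_grad_radial_cutoff)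
      ultimately show ?thesis by simp
    next
      case 3
      have m: "x \<in> square p (2 * \<rho>)" using 3 ball_square_inclusions(2)[of p "2 * \<rho>"] by (auto simp: dist_commute)
      have i: "x \<in> ball p (6 * \<rho>)" "x \<notin> ball p \<rho>" using 3 by (auto simp: dist_commute)
      have fg: "norm (full_grad ?\<zeta> x) \<le> S / \<rho>"
        using S[OF \<rho>, of p x] radial_slope_nonneg[of p \<rho> x] by (simp add: full_grad_radial_cutoff)
      have S0: "0 \<le> S / \<rho>" by (rule order_trans[OF norm_ge_zero fg])
      have q: "norm (u x - u p) * norm (full_grad ?\<zeta> x) \<le> 80 * sqrt J * (S / \<rho>)"
        using osc[OF m] fg J by (intro mult_mono) auto
      have "norm (A x) * (norm (u x - u p) * norm (full_grad ?\<zeta> x)) \<le> norm (A x) * (80 * sqrt J * (S / \<rho>))"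
        by (intro mult_left_mono q) simp
      also have "\<dots> \<le> 1 * (norm (A x))\<^sup>2 + (80 * sqrt J * (S / \<rho>))\<^sup>2 / 1"
        by (rule order_trans[OF abs_ge_self abs_mult_le_scaled_squares]) simp
      also have "(80 * sqrt J * (S / \<rho>))\<^sup>2 = 6400 * J * (S / \<rho>)\<^sup>2" using J by (simp only: power_mult_distrib real_sqrt_pow2 less_imp_le) simp
      finally have 1: "norm (A x) * (norm (u x - u p) * norm (full_grad ?\<zeta> x)) \<le> (norm (A x))\<^sup>2 + 6400 * J * (S / \<rho>)\<^sup>2" by simp
      have "4 / c1 * ?\<zeta> x \<le> 4 / c1 * 1" using radial_cutoff_bounds[of p \<rho> x] by (intro mult_left_mono a0) auto
      then show ?thesis using mult_left_mono[OF 1 a0(2)] m i by simp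
    qed
  qed
  have restr: "(\<integral>\<^sup>+x. f x \<partial>lebesgue_on \<Omega>) = (\<integral>\<^sup>+x. f x * indicator \<Omega> x \<partial>lebesgue)" for f :: "real^2 \<Rightarrow> ennreal"
    using \<Omega>(1) by (intro nn_integral_restrict_space) simp
  have leb: "(\<integral>\<^sup>+x. ennreal (f x) \<partial>lebesgue) = ennreal (\<integral>x. f x \<partial>lborel)" if "integrable lborel f" "\<And>x. 0 \<le> f x" for f :: "real^2 \<Rightarrow> real"
    using that by (subst nn_integral_completion) (simp add: nn_integral_eq_integral)
  have AEG: "AE x in lebesgue. x \<in> \<Omega> \<longrightarrow> grad \<Omega> u x = A x" using G by (simp add: AE_lebesgue_on_iff[OF \<Omega>(1)])
  have B0: "0 \<le> ?B x" for x
    using pw[of x] radial_cutoff_bounds[of p \<rho> x] lam constants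
    by (intro order_trans[OF _ pw] add_nonneg_nonneg mult_nonneg_nonneg) auto
  have "ennreal (lam * ?b * W \<rho>) = ennreal (\<integral>x. lam * ?b * ((norm (A x))\<^sup>2 * indicator (ball p \<rho>) x) \<partial>lborel)"
    by (simp add: W_def local_energy_def)
  also have "\<dots> = (\<integral>\<^sup>+x. ennreal (lam * ?b * ((norm (A x))\<^sup>2 * indicator (ball p \<rho>) x)) \<partial>lebesgue)"
    using iB lam bump_nonneg by (intro leb[symmetric] integrable_mult_right mult_nonneg_nonneg) auto
  also have "\<dots> \<le> (\<integral>\<^sup>+x. ennreal (lam * ?\<zeta> x * (norm (grad \<Omega> u x))\<^sup>2) * indicator \<Omega> x \<partial>lebesgue)"
  proof (rule nn_integral_mono_AE)
    show "AE x in lebesgue. ennreal (lam * ?b * ((norm (A x))\<^sup>2 * indicator (ball p \<rho>) x))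
       \<le> ennreal (lam * ?\<zeta> x * (norm (grad \<Omega> u x))\<^sup>2) * indicator \<Omega> x"
      using AEG
    proof eventually_elim
      case (elim x)
      show ?case
      proof (cases "x \<in> ball p \<rho>")
        case True
        then have "x \<in> \<Omega>" "dist x p \<le> \<rho>" using cb \<rho> by (auto simp: dist_commute)
        then show ?thesis using elim True radial_cutoff_inside(1)[OF \<rho>] by simp
      qed simp
    qed
  qed
  also have "\<dots> \<le> (\<integral>\<^sup>+x. ennreal (4 / c1 * ?\<zeta> x
        + (2 * lam + l) * (norm (grad \<Omega> u x) * (norm (u x - u p) * norm (full_grad ?\<zeta> x)))) * indicator \<Omega> x \<partial>lebesgue)"
    using cac unfolding restr .
  also have "\<dots> \<le> (\<integral>\<^sup>+x. ennreal (?B x) \<partial>lebesgue)"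
  proof (rule nn_integral_mono_AE)
    show "AE x in lebesgue. ennreal (4 / c1 * ?\<zeta> x
        + (2 * lam + l) * (norm (grad \<Omega> u x) * (norm (u x - u p) * norm (full_grad ?\<zeta> x)))) * indicator \<Omega> x \<le> ennreal (?B x)"
      using AEG
    proof eventually_elim
      case (elim x)
      show ?case using elim pw[of x] by (cases "x \<in> \<Omega>") (auto intro: ennreal_leI)
    qed
  qed
  also have "\<dots> = ennreal (\<integral>x. ?B x \<partial>lborel)" by (rule leb[OF iBB B0])
  finally have le: "lam * ?b * W \<rho> \<le> (\<integral>x. ?B x \<partial>lborel)"
    using B0 by (subst (asm) ennreal_le_iff) auto
  \<comment> \<open>The square of half-side \<open>2 * \<rho>\<close> has area
    \<open>16 * \<rho>^2\<close>, hence \<open>64 / c1\<close> and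
    \<open>102400 = 16 * 6400\<close>.\<close>
  have "(\<integral>x. ?B x \<partial>lborel) = 4 / c1 * (4 * \<rho>)\<^sup>2 + (2 * lam + l) * (W (6 * \<rho>) - W \<rho> + 6400 * J * (S / \<rho>)\<^sup>2 * (4 * \<rho>)\<^sup>2)"
  proof -
    have "(\<integral>x. indicator (square p (2 * \<rho>)) x \<partial>lborel) = (4 * \<rho>)\<^sup>2" using measure_square[of "2 * \<rho>" p] \<rho> by simp
    then show ?thesis unfolding W_def local_energy_def
      by (subst Bochner_Integration.integral_add integral_mult_right_zero Bochner_Integration.integral_diff;
          (intro Bochner_Integration.integrable_add Bochner_Integration.integrable_diff integrable_mult_right iB isq)?)+ simp
  qed
  also have "6400 * J * (S / \<rho>)\<^sup>2 * (4 * \<rho>)\<^sup>2 = 102400 * S\<^sup>2 * J" using \<rho> by (simp add: power_mult_distrib power_divide)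
  finally show ?thesis using le by (simp add: J_def power_mult_distrib algebra_simps)
qed

text \<open>A ball is connected, so one that meets \<open>\<Omega>\<close> without lying in it meets
  the frontier, at distance less than \<open>r\<close> from its centre.\<close>

lemma ball_subset_if_far_from_frontier:
  fixes q :: "'a::euclidean_space"
  assumes q: "q \<in> S" "S \<subseteq> \<Omega>" and r: "r < setdist S (frontier \<Omega>)"
  shows "ball q r \<subseteq> \<Omega>"
proof (rule ccontr)
  assume ns: "\<not> ball q r \<subseteq> \<Omega>"
  have "r > 0"
  proof (rule ccontr)
    assume "\<not> r > 0"
    then have "ball q r = {}" by simp
    with ns show False by simp
  qed
  then have "q \<in> ball q r \<inter> \<Omega>" using q by auto
  then have "ball q r \<inter> frontier \<Omega> \<noteq> {}"
    using ns connected_Int_frontier[OF connected_ball, of q r \<Omega>] by blast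
  then obtain w where w: "w \<in> frontier \<Omega>" "dist q w < r" by auto
  have "setdist S (frontier \<Omega>) \<le> dist q w" by (rule setdist_le_dist[OF q(1) w(1)])
  then show False using w r by simp
qed

theorem theorem3p7:
  fixes \<Omega> :: "(real^2) set" and u0 u :: "real^2 \<Rightarrow> real^2"
    and lam l m c1 c2 :: real and \<theta> :: "real \<Rightarrow> real"
    and z :: "real^2" and \<delta> r' :: real
  assumes domain: "lipschitz_domain \<Omega>"
    and u0: "\<exists>w. homeomorphism (closure \<Omega>) (u0 ` closure \<Omega>) u0 w"
    and nonempty: "admissible1 \<Omega> u0 \<noteq> {}"
    and lam_pos: "lam > 0"
    and constants: "l > 0" "m > 0" "0 < c1" "c1 < 1" "1 < c2"
    and theta: "theta_conditions l m c1 c2 \<theta>"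
    and continuous_representative: "continuous_on \<Omega> u"
    and minimizer: "strong_local_minimizer lam (h_fun l m c1 c2 \<theta>) \<Omega> u0 u"
    and delta: "\<delta> > 0"
    and inside: "compactly_contained (ball z \<delta>) \<Omega>"
    and radius: "0 < r'" "r' < setdist (ball z \<delta>) (frontier \<Omega>)"
    and F_zero: "F_functional \<Omega> u (ball z \<delta>) r' = 0"
  shows "\<forall>K. compact K \<and> K \<subseteq> ball z \<delta> \<longrightarrow> hoelder_on K u"
proof (intro allI impI)
  fix K assume K: "compact K \<and> K \<subseteq> ball z \<delta>"
  have \<Omega>: "open \<Omega>" "bounded \<Omega>" using domain by (auto simp: lipschitz_domain_def)
  have u: "u \<in> W12 \<Omega>" "AE x in lebesgue_on \<Omega>. det (grad \<Omega> u x) > 0"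
    using minimizer by (auto simp: strong_local_minimizer_def admissible_def admissible1_def)
  have ball_in: "ball z \<delta> \<subseteq> \<Omega>"
    using inside closure_subset by (auto simp: compactly_contained_def)
  have sub: "q \<in> \<Omega> \<and> ball q r' \<subseteq> \<Omega>" if "q \<in> ball z \<delta>" for q
    using ball_subset_if_far_from_frontier[OF that ball_in radius(2)] that ball_in by blast
  obtain A where A: "AE x in lebesgue_on \<Omega>. grad \<Omega> u x = A x"
    "\<And>i. scalar_wgrad \<Omega> (\<lambda>x. indicator \<Omega> x * u x $ i) (\<lambda>x. A x $ i)"
    by (rule W12_scalar_wgrad[OF \<Omega> u(1) continuous_representative]) (rule that)
  have "(norm (A x))\<^sup>2 = (norm (A x $ 1))\<^sup>2 + (norm (A x $ 2))\<^sup>2" for x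
    unfolding power2_norm_eq_inner by (simp add: inner_vec_def[of "A x"] sum_2)
  then have iA: "integrable lborel (\<lambda>x. (norm (A x))\<^sup>2)" using scalar_wgradD(5)[OF A(2)] by simp
  obtain S where S: "\<And>p \<rho> x. \<rho> > 0 \<Longrightarrow> radial_slope p \<rho> x * norm (x - p) \<le> S / \<rho>"
    by (rule radial_slope_bound) (rule that)
  have iB: "integrable lborel (\<lambda>x. (norm (A x))\<^sup>2 * indicator (ball p r) x)" for p r
    using iA by (intro integrable_mult_bounded[where c = 1]) (auto simp: indicator_def)
  have W0: "0 \<le> local_energy A p r" for p r unfolding local_energy_def by simp
  have W1: "local_energy A p r \<le> (\<integral>x. (norm (A x))\<^sup>2 \<partial>lborel)" for p r
    unfolding local_energy_def by (intro integral_mono iB iA) (simp add: indicator_def)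
  \<comment> \<open>Smaller than \<open>r'\<close>, so that for \<open>6 * \<rho> \<le> R\<close>
    the discs around all centres lie in \<open>\<Omega>\<close> and in the region where the sign of
    the twist is known.\<close>
  define R where "R = r' / 2"
  define b where "b = lam * bump (bump 1)"
  define C1 where "C1 = (2 * lam + l) * (1 + 102400 * S\<^sup>2)"
  define C2 where "C2 = 64 / c1 + (2 * lam + l) * (102400 * S\<^sup>2)"
  \<comment> \<open>Adding \<open>C1\<close> times the inner energy to both sides fills the hole and
    leaves the ratio \<open>C1 / (b + C1) < 1\<close>. The lower bound \<open>1 / 2\<close> is what
    the iteration with a quadratic error asks for.\<close>
  define \<kappa> where "\<kappa> = max (C1 / (b + C1)) (1 / 2)"
  define C3 where "C3 = C2 / (b + C1)"
  have R: "R > 0" "R < r'" using radius by (auto simp: R_def)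
  have b: "b > 0" using lam_pos bump_pos by (simp add: b_def)
  have C1: "C1 > 0" using lam_pos constants by (auto simp: C1_def intro!: mult_pos_pos add_pos_nonneg)
  have C2: "C2 \<ge> 0" using lam_pos constants by (auto simp: C2_def intro!: mult_nonneg_nonneg add_nonneg_nonneg)
  have \<kappa>: "1 / 2 \<le> \<kappa>" "\<kappa> < 1" using b C1 by (auto simp: \<kappa>_def)
  have C3: "C3 \<ge> 0" using C2 b C1 by (simp add: C3_def)
  have step: "local_energy A p \<rho> \<le> \<kappa> * local_energy A p (6 * \<rho>) + C3 * \<rho>\<^sup>2"
    if p: "p \<in> ball z \<delta>" and \<rho>: "0 < \<rho>" "6 * \<rho> \<le> R" for p \<rho>
  proof -
    let ?W = "local_energy A p"
    have "ball p (6 * \<rho>) \<subseteq> ball p r'" using \<rho> R by (intro subset_ball) simp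
    then have 6: "ball p (6 * \<rho>) \<subseteq> \<Omega>" using sub[OF p] by blast
    have "AE x in lebesgue_on \<Omega>. x \<in> ball p r' \<longrightarrow> twist \<Omega> u x p \<ge> 0"
      by (rule twist_nonneg_at_every_centre[OF \<Omega>(1) u(1) continuous_representative F_zero sub p])
    then have tw: "AE x in lebesgue_on \<Omega>. x \<in> ball p (2 * \<rho>) \<longrightarrow> twist \<Omega> u x p \<ge> 0"
      by eventually_elim (use \<rho> R in auto)
    have "b * ?W \<rho> \<le> 64 / c1 * \<rho>\<^sup>2 + (2 * lam + l) * (?W (6 * \<rho>) - ?W \<rho>)
      + (2 * lam + l) * (102400 * S\<^sup>2) * (?W (6 * \<rho>) - ?W \<rho> + \<rho>\<^sup>2)"
      unfolding b_def
      by (rule hole_filling[OF \<Omega> lam_pos constants theta continuous_representative minimizer u(2) A iA S \<rho>(1) 6 tw])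
    also have "\<dots> = C1 * (?W (6 * \<rho>) - ?W \<rho>) + C2 * \<rho>\<^sup>2" by (simp add: C1_def C2_def algebra_simps)
    finally have "(b + C1) * ?W \<rho> \<le> C1 * ?W (6 * \<rho>) + C2 * \<rho>\<^sup>2" by (simp add: algebra_simps)
    then have "?W \<rho> \<le> (C1 * ?W (6 * \<rho>) + C2 * \<rho>\<^sup>2) / (b + C1)"
      using b C1 by (simp add: pos_le_divide_eq mult.commute)
    also have "\<dots> = C1 / (b + C1) * ?W (6 * \<rho>) + C3 * \<rho>\<^sup>2" by (simp add: C3_def add_divide_distrib)
    also have "\<dots> \<le> \<kappa> * ?W (6 * \<rho>) + C3 * \<rho>\<^sup>2"
      using W0 by (intro add_right_mono mult_right_mono) (auto simp: \<kappa>_def)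
    finally show ?thesis .
  qed
  \<comment> \<open>The final 1 keeps \<open>D\<close>, and with it the energy bound in the
    oscillation estimate, positive.\<close>
  define D where "D = (\<integral>x. (norm (A x))\<^sup>2 \<partial>lborel) + C3 * R\<^sup>2 + 1"
  have D: "D > 0" unfolding D_def using C3 by (intro add_nonneg_pos add_nonneg_nonneg) auto
  have decay: "local_energy A p (R / 6 ^ n) \<le> \<kappa> ^ n * D" if p: "p \<in> ball z \<delta>" for p n
  proof -
    have "local_energy A p (R / 6 ^ n) \<le> local_energy A p (R / 6 ^ n) + C3 * (R / 6 ^ n)\<^sup>2" using C3 by simp
    also have "\<dots> \<le> \<kappa> ^ n * (local_energy A p R + C3 * R\<^sup>2)"
      by (rule geometric_decay[OF step[OF p] R(1) \<kappa>(1) C3])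
    also have "\<dots> \<le> \<kappa> ^ n * D" using \<kappa> W1[of p R] by (intro mult_left_mono) (auto simp: D_def)
    finally show ?thesis .
  qed
  have "bounded (u ` K)"
    using K ball_in by (intro compact_imp_bounded compact_continuous_image continuous_on_subset[OF continuous_representative]) auto
  then obtain B where B: "\<And>x. x \<in> K \<Longrightarrow> norm (u x) \<le> B" by (auto simp: bounded_iff)
  \<comment> \<open>Oscillation is the square root of energy, hence the ratio
    \<open>sqrt \<kappa>\<close>; it is at least \<open>1 / 6\<close> because
    \<open>\<kappa> \<ge> 1 / 2 \<ge> 1 / 36\<close>.\<close>
  show "hoelder_on K u"
  proof (rule hoelder_on_if_geometric_scales[where R = R and s = "sqrt \<kappa>" and C = "80 * sqrt D" and S = "2 * B"])
    have "sqrt ((1 / 6)\<^sup>2) \<le> sqrt \<kappa>" using \<kappa> by (intro real_sqrt_le_mono) (simp add: power2_eq_square)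
    then show "1 / 6 \<le> sqrt \<kappa>" by simp
    show "sqrt \<kappa> < 1" using \<kappa> by simp
    show "dist (u x) (u y) \<le> 2 * B" if "x \<in> K" "y \<in> K" for x y
      using B[OF that(1)] B[OF that(2)] norm_triangle_ineq4[of "u x" "u y"] by (simp add: dist_norm)
    fix x y n assume xy: "x \<in> K" "y \<in> K" "dist x y \<le> R / 6 ^ Suc n"
    \<comment> \<open>Points at distance at most \<open>\<rho>\<close> are compared through the
      energy out to \<open>6 * \<rho> = R / 6 ^ n\<close>, one scale further out, so the decay is
      used with \<open>n\<close> and not \<open>Suc n\<close>. The centre is the point
      \<open>x\<close> itself, which is why the decay is needed at every centre.\<close>
    define \<rho> where "\<rho> = R / 6 ^ Suc n"
    have \<rho>: "\<rho> > 0" "6 * \<rho> = R / 6 ^ n" using R by (auto simp: \<rho>_def)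
    have "R / 6 ^ n \<le> R" using R by (simp add: pos_divide_le_eq)
    then have "6 * \<rho> \<le> R" by (simp only: \<rho>(2))
    then have "ball x (6 * \<rho>) \<subseteq> ball x r'" using R by (intro subset_ball) simp
    moreover have x: "x \<in> ball z \<delta>" using xy K by blast
    ultimately have sq: "square x (4 * \<rho>) \<subseteq> \<Omega>"
      using sub[OF x] ball_square_inclusions(3)[OF \<rho>(1)] by blast
    have J: "\<kappa> ^ n * D > 0" using \<kappa> D by simp
    have "(\<integral>\<^sup>+x'\<in>square x (4 * \<rho>) - open_square x (2 * \<rho>). ennreal ((norm (A x'))\<^sup>2) \<partial>lborel)
       \<le> ennreal (local_energy A x (6 * \<rho>) - local_energy A x \<rho>)"
      by (rule annulus_energy_le[OF iA \<rho>(1)])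
    also have "\<dots> \<le> ennreal (\<kappa> ^ n * D)"
      using decay[OF x, of n] W0[of x \<rho>] unfolding \<rho>(2) by (intro ennreal_leI) linarith
    finally have le: "(\<integral>\<^sup>+x'\<in>square x (4 * \<rho>) - open_square x (2 * \<rho>). ennreal ((norm (A x'))\<^sup>2) \<partial>lborel) \<le> ennreal (\<kappa> ^ n * D)" .
    have "y \<in> cball x (2 * \<rho>)" using xy(3) \<rho>(1) unfolding \<rho>_def[symmetric] by simp
    then have y: "y \<in> square x (2 * \<rho>)" using ball_square_inclusions(2) by blast
    have "norm (u y - u x) \<le> 80 * sqrt (\<kappa> ^ n * D)"
      by (rule oscillation_of_map[OF \<Omega> continuous_representative u(2) A \<rho>(1) sq J le y])
    also have "\<dots> = 80 * sqrt D * sqrt \<kappa> ^ n" by (simp add: real_sqrt_mult real_sqrt_power)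
    finally show "dist (u x) (u y) \<le> 80 * sqrt D * sqrt \<kappa> ^ n" by (simp add: dist_norm norm_minus_commute)
  qed (use R D in auto)
qed

end
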